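(* Let $Y=\{Y(x),x\ge0\}$ be a Lévy process with values in $\mathbb{R}^d$ and characteristic exponent $\psi$, and let $D=\{D(x),x\ge0\}$ be a subordinator with characteristic exponent $\sigma$, with $D(0)=0$, no drift and Lévy measure $\nu_D$ satisfying $\nu_D(0,\infty)=\infty$. Let $E_t=\inf\{x\ge0:D(x)>t\}$ and $X(t)=Y(E_t)$ for $t\ge0$. Suppose that $Z=\{(D(x),Y(x)),x\ge0\}$ is a Lévy process in $\mathbb{R}^{1+d}$ and that its characteristic exponent $\Phi$ satisfies $$K^{-1}\,{\rm Re}\left(\frac1{1+\sigma(\eta)+\psi(\xi)}\right)\le{\rm Re}\left(\frac1{1+\Phi(\eta,\xi)}\right)\le K\,{\rm Re}\left(\frac1{1+\sigma(\eta)+\psi(\xi)}\right)$$ for all $(\eta,\xi)\in\mathbb{R}^{1+d}$ with $|\eta|+\|\xi\|$ large, where $K\ge1$ is a constant. Then $$\dim_{\rm P}X([0,1])=\sup\left\{\gamma\ge0:\liminf_{r\to0^+}\frac{W(r)}{r^\gamma}=0\right\}\quad\text{a.s.},$$ where $$W(r)=\int_{\mathbb{R}^d}{\rm Re}\left(\frac1{1+\psi(\xi/r)}\right)\prod_{j=1}^d\frac1{1+\xi_j^2}\,d\xi,$$ and $\dim_{\rm P}{\rm Gr}X([0,1])=\max\{1,\chi'\}$ almost surely, where $$\chi'=\sup\left\{\gamma\ge0:\liminf_{r\to0^+}\frac{\widetilde W(r)}{r^\gamma}=0\right\}$$ and $$\widetilde W(r)=\int_{\mathbb{R}^{1+d}}{\rm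 Re}\left(\frac1{1+\sigma(\eta/r)+\psi(\xi/r)}\right)\frac1{1+\eta^2}\prod_{j=1}^d\frac1{1+\xi_j^2}\,d\eta\,d\xi.$$
   Context: $\dim_{\rm P}$ denotes packing dimension. $X([0,1])=\{X(t):t\in[0,1]\}$ is the range and ${\rm Gr}X([0,1])=\{(t,X(t)):t\in[0,1]\}$ is the graph. Characteristic exponents are defined by $\mathbb{E}(e^{i\langle\xi,Y(x)\rangle})=e^{-x\psi(\xi)}$, $\mathbb{E}(e^{i\eta D(x)})=e^{-x\sigma(\eta)}$ and $\mathbb{E}(e^{i\eta D(x)+i\langle\xi,Y(x)\rangle})=e^{-x\Phi(\eta,\xi)}$, and $\|\cdot\|$ is the Euclidean norm. Convention: $\sup\emptyset=0$. Lévy processes start at $0$. *)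

theory Defs
  imports "HOL-Probability.Probability"
begin

section \<open>Packing dimension\<close>

text \<open>
  A packing of \<open>A\<close> is a countable family of pairwise disjoint closed balls centred in \<open>A\<close>,
  encoded as a set of pairs (centre, radius).
\<close>

definition packings :: "real \<Rightarrow> 'a::metric_space set \<Rightarrow> ('a \<times> real) set set" where
  "packings \<delta> A = {P. countable P \<and> P \<subseteq> A \<times> {0<..\<delta>} \<and>
     disjoint_family_on (\<lambda>(x, r). cball x r) P}"

text \<open>
  The pre-measure is the limit as \<open>\<delta> \<rightarrow> 0+\<close> of the supremum over packings with radii at most
  \<open>\<delta>\<close>; the supremum is nondecreasing in \<open>\<delta>\<close>, so the limit is an infimum.
\<close>

definition packing_premeasure :: "real \<Rightarrow> 'a::metric_space set \<Rightarrow> ennreal" where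
  "packing_premeasure s A =
     (INF \<delta>\<in>{0<..}. SUP P\<in>packings \<delta> A. \<Sum>\<^sub>\<infinity>(x, r)\<in>P. ennreal ((2 * r) powr s))"

definition packing_measure :: "real \<Rightarrow> 'a::metric_space set \<Rightarrow> ennreal" where
  "packing_measure s A =
     (INF C\<in>{C :: nat \<Rightarrow> 'a set. A \<subseteq> (\<Union>i. C i)}. \<Sum>i. packing_premeasure s (C i))"

definition packing_dim :: "'a::metric_space set \<Rightarrow> ennreal" where
  "packing_dim A = Inf {ennreal s | s. 0 \<le> s \<and> packing_measure s A = 0}"


section \<open>Levy processes, characteristic exponents and subordinators\<close>

text \<open>
  Processes are indexed by \<open>real\<close>, but only nonnegative times are constrained. As usual, the
  starting point and the path properties are required almost surely.
\<close>

definition cadlag :: "(real \<Rightarrow> 'a::topological_space) \<Rightarrow> bool" where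
  "cadlag f \<longleftrightarrow> (\<forall>t\<ge>0. (f \<longlongrightarrow> f t) (at_right t)) \<and> (\<forall>t>0. \<exists>l. (f \<longlongrightarrow> l) (at_left t))"

definition (in prob_space) levy_process :: "(real \<Rightarrow> 'a \<Rightarrow> 'b::euclidean_space) \<Rightarrow> bool" where
  "levy_process X \<longleftrightarrow>
     (\<forall>t\<ge>0. random_variable borel (X t)) \<and>
     (AE \<omega> in M. X 0 \<omega> = 0) \<and>
     (\<forall>n. \<forall>t :: nat \<Rightarrow> real. 0 \<le> t 0 \<and> strict_mono_on {..n} t \<longrightarrow>
        indep_vars (\<lambda>_. borel) (\<lambda>i \<omega>. X (t (Suc i)) \<omega> - X (t i) \<omega>) {..<n}) \<and>
     (\<forall>s\<ge>0. \<forall>t\<ge>0. distr M borel (\<lambda>\<omega>. X (s + t) \<omega> - X s \<omega>) = distr M borel (\<lambda>\<omega>. X t \<omega> - X 0 \<omega>)) \<and>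
     (\<forall>t\<ge>0. \<forall>\<epsilon>>0.
        ((\<lambda>s. prob {\<omega> \<in> space M. dist (X s \<omega>) (X t \<omega>) > \<epsilon>}) \<longlongrightarrow> 0) (at t within {0..})) \<and>
     (AE \<omega> in M. cadlag (\<lambda>t. X t \<omega>))"

text \<open>
  This equation for all times \<open>x \<ge> 0\<close> determines \<open>\<psi>\<close> uniquely; no choice of a
  complex logarithm is involved.
\<close>

definition (in prob_space) characteristic_exponent ::
    "(real \<Rightarrow> 'a \<Rightarrow> 'b::euclidean_space) \<Rightarrow> ('b \<Rightarrow> complex) \<Rightarrow> bool" where
  "characteristic_exponent X \<psi> \<longleftrightarrow>
     (\<forall>\<xi>. \<forall>x\<ge>0. expectation (\<lambda>\<omega>. iexp (\<xi> \<bullet> X x \<omega>)) = exp (- (of_real x * \<psi> \<xi>)))"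

definition (in prob_space) subordinator :: "(real \<Rightarrow> 'a \<Rightarrow> real) \<Rightarrow> bool" where
  "subordinator D \<longleftrightarrow> levy_process D \<and> (AE \<omega> in M. mono_on {0..} (\<lambda>x. D x \<omega>))"

text \<open>
  Levy-Khintchine representation of the exponent of a subordinator with drift \<open>a\<close> and Levy
  measure \<open>\<nu>\<close>. The Levy measure lives on the open half-line; it is encoded as a Borel measure
  on the reals that vanishes on the nonpositive ones.
\<close>

definition subordinator_drift_levy_measure ::
    "(real \<Rightarrow> complex) \<Rightarrow> real \<Rightarrow> real measure \<Rightarrow> bool" where
  "subordinator_drift_levy_measure \<sigma> a \<nu> \<longleftrightarrow>
     0 \<le> a \<and> sets \<nu> = sets borel \<and> emeasure \<nu> {..0} = 0 \<and>
     (\<integral>\<^sup>+ y. ennreal (min 1 y) \<partial>\<nu>) < \<infinity> \<and>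
     (\<forall>\<eta>. \<sigma> \<eta> = - \<i> * of_real (a * \<eta>) + (\<integral>y. 1 - iexp (\<eta> * y) \<partial>\<nu>))"


section \<open>The index of a function at zero\<close>

text \<open>In \<open>ennreal\<close>, the supremum of the empty set is \<open>0\<close>.\<close>

definition liminf_index :: "(real \<Rightarrow> real) \<Rightarrow> ennreal" where
  "liminf_index V =
     Sup {ennreal \<gamma> | \<gamma>. 0 \<le> \<gamma> \<and> Liminf (at_right 0) (\<lambda>r. ereal (V r / r powr \<gamma>)) = 0}"

end

theory Submission
  imports Defs "HOL-Real_Asymp.Real_Asymp"
begin

text \<open>
  A Levy process \<open>Z\<close> in \<open>n\<close> dimensions is observed at an independent exponential time; the law
  obtained has Fourier transform \<open>1 / (1 + \<Phi>)\<close>. Since \<open>exp (- \<bar>x\<bar>)\<close> is the Fourier transform of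
  the Cauchy density, the function \<open>W\<close> is, up to a factor, the integral of \<open>\<Prod>\<^sub>b exp (- \<bar>x \<bullet> b\<bar> / r)\<close>
  against this law, so that \<open>W r\<close> measures the expected discounted time spent in a ball of radius \<open>r\<close>.

  Upper bound: decomposing at the first visit to a ball on a dyadic time grid shows that the volume of
  the \<open>r\<close>-neighbourhood of a path has expectation at most \<open>C r\<^sup>n\<close> divided by that expected time. If
  \<open>W r \<ge> c r powr g\<close> near \<open>0\<close>, the volumes along \<open>r = (1/2) ^ k\<close> are almost surely small enough to
  make every packing sum of exponent \<open>s > g\<close> vanish in the limit. Lower bound: if \<open>W r / r powr g\<close>
  has lower limit \<open>0\<close>, the occupation measure has lower \<open>g\<close>-density \<open>0\<close> almost everywhere along the
  path, and a Vitali covering argument shows that the packing measure of exponent \<open>g\<close> is not zero.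

  The subordinator increases strictly, because its Laplace transform is computed from \<open>\<sigma>\<close> by the
  same Cauchy kernel and the Levy measure is infinite. Hence the range of \<open>X\<close> is \<open>Y [0, E 1]\<close>, and
  the graph of \<open>X\<close> consists of points of the path of \<open>(D, Y)\<close> and countably many segments.
\<close>

section \<open>Packing measure\<close>

lemma infsum_ennreal_SUP:
  fixes f :: "'b \<Rightarrow> ennreal"
  shows "infsum f A = (SUP F\<in>{F. finite F \<and> F \<subseteq> A}. sum f F)"
  by (rule nonneg_infsum_complete) simp

lemma emeasure_UN_le_infsum:
  assumes "countable I" and X: "\<And>i. i \<in> I \<Longrightarrow> X i \<in> sets M"
  shows "emeasure M (\<Union>i\<in>I. X i) \<le> infsum (\<lambda>i. emeasure M (X i)) I"
proof (cases "finite I")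
  case True
  then show ?thesis using X by (auto intro!: emeasure_subadditive_finite)
next
  case False
  have ran: "range (from_nat_into I) = I"
    using range_from_nat_into assms(1) False by (metis finite.emptyI)
  have "emeasure M (\<Union>i\<in>I. X i) = emeasure M (\<Union>n. X (from_nat_into I n))"
    by (subst (1) ran[symmetric]) simp
  also have "\<dots> \<le> (\<Sum>n. emeasure M (X (from_nat_into I n)))"
    using X ran by (intro emeasure_subadditive_countably) auto
  also have "\<dots> = (SUP n. \<Sum>i<n. emeasure M (X (from_nat_into I i)))"
    by (simp add: suminf_eq_SUP)
  also have "\<dots> \<le> infsum (\<lambda>i. emeasure M (X i)) I"
  proof (rule SUP_least)
    fix n
    have inj: "inj_on (from_nat_into I) {..<n}"
      using bij_betw_from_nat_into[OF assms(1) False] by (auto simp: bij_betw_def intro: inj_on_subset)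
    have "sum (\<lambda>i. emeasure M (X i)) (from_nat_into I ` {..<n}) \<le> infsum (\<lambda>i. emeasure M (X i)) I"
      unfolding infsum_ennreal_SUP using ran by (intro SUP_upper) auto
    then show "(\<Sum>i<n. emeasure M (X (from_nat_into I i))) \<le> infsum (\<lambda>i. emeasure M (X i)) I"
      by (simp add: sum.reindex[OF inj])
  qed
  finally show ?thesis .
qed

definition packing_sum :: "real \<Rightarrow> ('a \<times> real) set \<Rightarrow> ennreal" where
  "packing_sum s P = (\<Sum>\<^sub>\<infinity>(x, r)\<in>P. ennreal ((2 * r) powr s))"

lemma packing_premeasure_alt:
  "packing_premeasure s A = (INF \<delta>\<in>{0<..}. SUP P\<in>packings \<delta> A. packing_sum s P)"
  by (simp add: packing_premeasure_def packing_sum_def)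

lemma packings_mono: "\<delta> \<le> \<epsilon> \<Longrightarrow> A \<subseteq> B \<Longrightarrow> packings \<delta> A \<subseteq> packings \<epsilon> B"
  unfolding packings_def by fastforce

lemma packing_premeasure_antimono_exponent:
  assumes "s \<le> t"
  shows "packing_premeasure t A \<le> packing_premeasure s A"
  unfolding packing_premeasure_alt
proof (rule INF_mono)
  fix \<delta> :: real assume "\<delta> \<in> {0<..}"
  then have \<delta>: "0 < min \<delta> (1/2)" by auto
  have "(SUP P\<in>packings (min \<delta> (1/2)) A. packing_sum t P)
      \<le> (SUP P\<in>packings \<delta> A. packing_sum s P)"
  proof (rule SUP_mono)
    fix P assume P: "P \<in> packings (min \<delta> (1/2)) A"
    have "packing_sum t P \<le> packing_sum s P"
      unfolding packing_sum_def
    proof (rule infsum_mono_neutral)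
      fix p assume "p \<in> P \<inter> P"
      then have "0 < snd p" "snd p \<le> 1/2" using P by (auto simp: packings_def)
      then show "(case p of (x, r) \<Rightarrow> ennreal ((2 * r) powr t)) \<le> (case p of (x, r) \<Rightarrow> ennreal ((2 * r) powr s))"
        using assms by (auto split: prod.split intro!: ennreal_leI powr_mono')
    qed (auto intro: nonneg_summable_on_complete)
    moreover have "P \<in> packings \<delta> A" using P packings_mono[of "min \<delta> (1/2)" \<delta> A A] by auto
    ultimately show "\<exists>Q\<in>packings \<delta> A. packing_sum t P \<le> packing_sum s Q" by blast
  qed
  then show "\<exists>\<epsilon>\<in>{0<..}. (SUP P\<in>packings \<epsilon> A. packing_sum t P) \<le> (SUP P\<in>packings \<delta> A. packing_sum s P)"
    using \<delta> by (intro bexI[of _ "min \<delta> (1/2)"]) auto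
qed

text \<open>A packing of the image lifts to a packing of the domain, because preimages of disjoint
  balls are disjoint and a short map sends balls into balls.\<close>

lemma packing_premeasure_image_le:
  fixes f :: "'a::metric_space \<Rightarrow> 'b::metric_space"
  assumes f: "\<And>x y. dist (f x) (f y) \<le> dist x y"
  shows "packing_premeasure s (f ` A) \<le> packing_premeasure s A"
  unfolding packing_premeasure_alt
proof (rule INF_mono)
  fix \<delta> :: real assume \<delta>: "\<delta> \<in> {0<..}"
  have "(SUP P\<in>packings \<delta> (f ` A). packing_sum s P) \<le> (SUP P\<in>packings \<delta> A. packing_sum s P)"
  proof (rule SUP_mono)
    fix P assume P: "P \<in> packings \<delta> (f ` A)"
    define g where "g = inv_into A f"
    have g: "g y \<in> A" "f (g y) = y" if "y \<in> f ` A" for y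
      using that by (auto simp: g_def inv_into_into f_inv_into_f)
    define h where "h = (\<lambda>(y, r::real). (g y, r))"
    have PA: "y \<in> f ` A" "0 < r" "r \<le> \<delta>" if "(y, r) \<in> P" for y r
      using P that by (auto simp: packings_def)
    have inj: "inj_on h P"
      by (rule inj_onI) (use g PA in \<open>auto simp: h_def split: prod.splits, metis\<close>)
    have "h ` P \<in> packings \<delta> A"
    proof -
      have "disjoint_family_on (\<lambda>(x, r). cball x r) (h ` P)"
        unfolding disjoint_family_on_def
      proof (intro ballI impI)
        fix p q assume "p \<in> h ` P" "q \<in> h ` P" "p \<noteq> q"
        then obtain y r y' r' where *: "(y, r) \<in> P" "(y', r') \<in> P" "(y, r) \<noteq> (y', r')"
          and pq: "p = (g y, r)" "q = (g y', r')"
          by (auto simp: h_def)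
        then have "cball y r \<inter> cball y' r' = {}"
          using P unfolding packings_def disjoint_family_on_def by force
        moreover have "f z \<in> cball y r \<inter> cball y' r'" if "z \<in> cball (g y) r \<inter> cball (g y') r'" for z
          using that f[of "g y" z] f[of "g y'" z] g[OF PA(1)[OF *(1)]] g[OF PA(1)[OF *(2)]] by auto
        ultimately show "(case p of (x, r) \<Rightarrow> cball x r) \<inter> (case q of (x, r) \<Rightarrow> cball x r) = {}"
          unfolding pq by blast
      qed
      moreover have "h ` P \<subseteq> A \<times> {0<..\<delta>}" using PA g by (auto simp: h_def)
      ultimately show ?thesis using P by (auto simp: packings_def)
    qed
    moreover have "packing_sum s P = packing_sum s (h ` P)"
      unfolding packing_sum_def
      by (subst infsum_reindex[OF inj]) (auto simp: h_def o_def case_prod_beta')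
    ultimately show "\<exists>Q\<in>packings \<delta> A. packing_sum s P \<le> packing_sum s Q" by auto
  qed
  then show "\<exists>\<epsilon>\<in>{0<..}. (SUP P\<in>packings \<epsilon> (f ` A). packing_sum s P) \<le> (SUP P\<in>packings \<delta> A. packing_sum s P)"
    using \<delta> by blast
qed

lemma packing_measure_zeroI:
  assumes "\<And>i::nat. packing_premeasure s (C i) = 0" "A \<subseteq> (\<Union>i. C i)"
  shows "packing_measure s A = 0"
proof -
  have "packing_measure s A \<le> (\<Sum>i. packing_premeasure s (C i))"
    unfolding packing_measure_def using assms(2) by (intro INF_lower) auto
  then show ?thesis by (simp add: assms(1))
qed

lemma packing_measure_zeroD:
  assumes "packing_measure s A = 0"
  obtains C :: "nat \<Rightarrow> 'a::metric_space set"
  where "A \<subseteq> (\<Union>i. C i)" "\<And>i. packing_premeasure s (C i) < \<infinity>"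
proof -
  have "packing_measure s A < 1" using assms by simp
  then obtain C :: "nat \<Rightarrow> 'a set" where C: "A \<subseteq> (\<Union>i. C i)" "(\<Sum>i. packing_premeasure s (C i)) < 1"
    unfolding packing_measure_def INF_less_iff by auto
  have "packing_premeasure s (C i) < \<infinity>" for i
  proof -
    have "packing_premeasure s (C i) \<le> (\<Sum>i. packing_premeasure s (C i))"
      using sum_le_suminf[of "\<lambda>i. packing_premeasure s (C i)" "{i}"] by simp
    also have "\<dots> < \<infinity>" using C(2) by (rule order.strict_trans) simp
    finally show ?thesis .
  qed
  then show ?thesis using C(1) that by blast
qed

lemma packing_dim_le: "0 \<le> s \<Longrightarrow> packing_measure s A = 0 \<Longrightarrow> packing_dim A \<le> ennreal s"
  unfolding packing_dim_def by (intro Inf_lower) auto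

lemma packing_measure_antimono_exponent:
  "s \<le> t \<Longrightarrow> packing_measure t A \<le> packing_measure s A"
  unfolding packing_measure_def
  by (intro INF_mono) (auto intro!: suminf_le packing_premeasure_antimono_exponent)

lemma packing_dim_ge:
  assumes "packing_measure s A \<noteq> 0"
  shows "ennreal s \<le> packing_dim A"
  unfolding packing_dim_def
proof (rule Inf_greatest, clarify)
  fix t assume "0 \<le> t" "packing_measure t A = 0"
  then have "s \<le> t"
    using packing_measure_antimono_exponent[of t s A] assms by (cases "s \<le> t") auto
  then show "ennreal s \<le> ennreal t" by (rule ennreal_leI)
qed

lemma packing_measure_mono: "A \<subseteq> B \<Longrightarrow> packing_measure s A \<le> packing_measure s B"
  unfolding packing_measure_def by (intro INF_superset_mono) auto

lemma packing_measure_image_le: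
  fixes f :: "'a::metric_space \<Rightarrow> 'b::metric_space"
  assumes f: "\<And>x y. dist (f x) (f y) \<le> dist x y"
  shows "packing_measure s (f ` A) \<le> packing_measure s A"
  unfolding packing_measure_def[of s A]
proof (rule INF_greatest)
  fix C :: "nat \<Rightarrow> 'a set" assume "C \<in> {C. A \<subseteq> (\<Union>i. C i)}"
  then have "packing_measure s (f ` A) \<le> (\<Sum>i. packing_premeasure s (f ` C i))"
    unfolding packing_measure_def by (intro INF_lower) fastforce
  also have "\<dots> \<le> (\<Sum>i. packing_premeasure s (C i))"
    by (intro suminf_le packing_premeasure_image_le f) auto
  finally show "packing_measure s (f ` A) \<le> (\<Sum>i. packing_premeasure s (C i))" .
qed

text \<open>Ball covering argument: by Vitali, the outer measure of the set is at most \<open>\<epsilon>\<close> times a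
  packing sum. Nothing is assumed about doubling, so the five-fold ball has to appear in the
  density condition.\<close>

lemma finite_packing_premeasure_null:
  fixes C G :: "'a::euclidean_space set" and \<mu> :: "'a measure"
  assumes fin: "packing_premeasure s C < \<infinity>" and sets: "sets \<mu> = sets borel"
    and G: "\<And>x \<epsilon> \<delta>. x \<in> G \<Longrightarrow> \<epsilon> > 0 \<Longrightarrow> \<delta> > 0 \<Longrightarrow>
              \<exists>r. 0 < r \<and> r \<le> \<delta> \<and> emeasure \<mu> (cball x (5 * r)) \<le> ennreal (\<epsilon> * (2 * r) powr s)"
  shows "\<exists>N\<in>null_sets \<mu>. C \<inter> G \<subseteq> N"
proof -
  obtain \<delta> where \<delta>: "\<delta> > 0" "(SUP P\<in>packings \<delta> C. packing_sum s P) < \<infinity>"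
    using fin unfolding packing_premeasure_alt INF_less_iff by auto
  define B where "B = (SUP P\<in>packings \<delta> C. packing_sum s P)"
  have "\<exists>U\<in>sets \<mu>. C \<inter> G \<subseteq> U \<and> emeasure \<mu> U \<le> ennreal \<epsilon> * B" if \<epsilon>: "\<epsilon> > 0" for \<epsilon>
  proof -
    obtain r where r: "\<And>x. x \<in> G \<Longrightarrow> 0 < r x \<and> r x \<le> \<delta> \<and>
        emeasure \<mu> (cball x (5 * r x)) \<le> ennreal (\<epsilon> * (2 * r x) powr s)"
      using G[OF _ \<epsilon> \<delta>(1)] by metis
    have "C \<inter> G \<subseteq> (\<Union>x\<in>C \<inter> G. cball (id x) (r x))"
      using r by (fastforce intro: less_imp_le)
    then obtain T where T: "countable T" "T \<subseteq> C \<inter> G"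
      "pairwise (\<lambda>i j. disjnt (cball (id i) (r i)) (cball (id j) (r j))) T"
      "C \<inter> G \<subseteq> (\<Union>i\<in>T. cball (id i) (5 * r i))"
      by (rule Vitali_covering_lemma_cballs[where K = "C \<inter> G" and a = id and r = r and B = \<delta>]) (use r in auto)
    define P where "P = (\<lambda>x. (x, r x)) ` T"
    have inj: "inj_on (\<lambda>x. (x, r x)) T" by (auto intro: inj_onI)
    have "P \<in> packings \<delta> C"
      using T r by (auto simp: P_def packings_def disjoint_family_on_def pairwise_def disjnt_def)
    then have PB: "packing_sum s P \<le> B" unfolding B_def by (rule SUP_upper)
    have "emeasure \<mu> (\<Union>i\<in>T. cball i (5 * r i)) \<le> infsum (\<lambda>i. emeasure \<mu> (cball i (5 * r i))) T"
      using T(1) by (intro emeasure_UN_le_infsum) (auto simp: sets)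
    also have "\<dots> \<le> infsum (\<lambda>i. ennreal \<epsilon> * ennreal ((2 * r i) powr s)) T"
      using r T(2) \<epsilon> by (intro infsum_mono nonneg_summable_on_complete) (auto simp: ennreal_mult'[symmetric])
    also have "\<dots> = ennreal \<epsilon> * infsum (\<lambda>i. ennreal ((2 * r i) powr s)) T"
      by (simp add: infsum_ennreal_SUP SUP_mult_left_ennreal sum_distrib_left del: sum_ennreal)
    also have "infsum (\<lambda>i. ennreal ((2 * r i) powr s)) T = packing_sum s P"
      unfolding packing_sum_def P_def by (subst infsum_reindex[OF inj]) (auto simp: o_def)
    also have "ennreal \<epsilon> * packing_sum s P \<le> ennreal \<epsilon> * B" using PB by (rule mult_left_mono) simp
    finally show ?thesis
      using T(1,4) by (intro bexI[of _ "\<Union>i\<in>T. cball i (5 * r i)"]) (auto simp: sets intro!: sets.countable_UN')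
  qed
  then have "\<exists>U. \<forall>n. U n \<in> sets \<mu> \<and> C \<inter> G \<subseteq> U n \<and> emeasure \<mu> (U n) \<le> ennreal (1 / real (Suc n)) * B"
    by (intro choice allI) (metis divide_pos_pos of_nat_0_less_iff zero_less_Suc zero_less_one)
  then obtain U where U: "\<And>n::nat. U n \<in> sets \<mu>" "\<And>n. C \<inter> G \<subseteq> U n"
    "\<And>n. emeasure \<mu> (U n) \<le> ennreal (1 / real (Suc n)) * B" by blast
  have le: "emeasure \<mu> (\<Inter>n. U n) \<le> ennreal (1 / real (Suc n)) * B" for n
    using U(1) by (intro order_trans[OF emeasure_mono U(3)[of n]]) auto
  have "B < \<top>" using \<delta>(2) by (simp add: B_def)
  then have "(\<lambda>n. B * ennreal (1 / real (Suc n))) \<longlonglongrightarrow> B * ennreal 0"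
    using LIMSEQ_inverse_real_of_nat
    by (intro ennreal_tendsto_cmult tendsto_ennrealI) (simp_all only: inverse_eq_divide)
  then have "(\<lambda>n. ennreal (1 / real (Suc n)) * B) \<longlonglongrightarrow> ennreal 0 * B"
    by (simp only: mult.commute)
  then have "emeasure \<mu> (\<Inter>n. U n) \<le> ennreal 0 * B"
    using le by (intro LIMSEQ_le_const) auto
  then have "(\<Inter>n. U n) \<in> null_sets \<mu>" using U(1) by (auto simp: null_sets_def)
  then show ?thesis using U(2) by blast
qed

lemma packing_premeasure_eq_0_if_sausage_summable:
  fixes A :: "'a::euclidean_space set"
  assumes fin: "(\<Sum>k. ennreal (((1/2) ^ k) powr (s - real DIM('a))) * emeasure lborel (\<Union>x\<in>A. ball x ((1/2) ^ k))) < \<infinity>"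
    and s: "0 \<le> s"
  shows "packing_premeasure s A = 0"
proof -
  define n where "n = DIM('a)"
  define v where "v = unit_ball_vol (real n)"
  have v: "v > 0" by (simp add: v_def)
  define S where "S = (\<lambda>k::nat. ennreal (((1/2) ^ k) powr (s - real n)) * emeasure lborel (\<Union>x\<in>A. ball x ((1/2) ^ k)))"
  define c where "c = 4 powr s / v"
  have c: "c \<ge> 0" using v by (simp add: c_def)
  text \<open>Sort the balls of a packing by the dyadic size of their radii; those in one class contain
    disjoint concentric balls of equal radius inside the neighbourhood of \<open>A\<close>.\<close>
  have dyadic_class: "(\<Sum>(x,r)\<in>F. ennreal ((2 * r) powr s)) \<le> ennreal c * S (Suc k)"
    if P: "P \<in> packings \<delta> A" and F: "finite F" "F \<subseteq> P" "\<And>x r. (x, r) \<in> F \<Longrightarrow> (1/2)^Suc k < r \<and> r \<le> (1/2)^k"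
    for P F k \<delta>
  proof -
    define \<rho> :: real where "\<rho> = (1/2)^Suc k"
    have \<rho>: "\<rho> > 0" by (simp add: \<rho>_def)
    have each: "ennreal ((2 * r) powr s) \<le> ennreal (c * \<rho> powr (s - real n)) * emeasure lborel (ball x \<rho>)" if "(x, r) \<in> F" for x r
    proof -
      have r: "\<rho> < r" "r \<le> 2 * \<rho>" using F(3)[OF that] by (auto simp: \<rho>_def)
      have "(2 * r) powr s \<le> (4 * \<rho>) powr s"
        using r \<rho> s by (intro powr_mono2) auto
      also have "\<dots> = 4 powr s * \<rho> powr s" using \<rho> by (simp add: powr_mult)
      also have "\<rho> powr s = \<rho> powr (s - real n) * \<rho> ^ n"
        using \<rho> by (simp add: powr_diff powr_realpow)
      also have "4 powr s * (\<rho> powr (s - real n) * \<rho> ^ n) = c * \<rho> powr (s - real n) * (v * \<rho> ^ n)"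
        using v by (simp add: c_def)
      finally have "ennreal ((2 * r) powr s) \<le> ennreal (c * \<rho> powr (s - real n) * (v * \<rho> ^ n))"
        by (rule ennreal_leI)
      also have "\<dots> = ennreal (c * \<rho> powr (s - real n)) * emeasure lborel (ball x \<rho>)"
        using \<rho> v c by (subst ennreal_mult) (auto simp: emeasure_ball v_def n_def)
      finally show ?thesis .
    qed
    have FA: "fst p \<in> A" if "p \<in> F" for p
      using that P F(2) by (auto simp: packings_def)
    have disj: "disjoint_family_on (\<lambda>(x, r). ball x \<rho>) F"
      unfolding disjoint_family_on_def
    proof (intro ballI impI)
      fix p q assume pq: "p \<in> F" "q \<in> F" "p \<noteq> q"
      then have "(case p of (x, r) \<Rightarrow> cball x r) \<inter> (case q of (x, r) \<Rightarrow> cball x r) = {}"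
        using P F(2) unfolding packings_def disjoint_family_on_def by blast
      moreover have "ball (fst p) \<rho> \<subseteq> cball (fst p) (snd p)" if "p \<in> F" for p
        using F(3)[of "fst p" "snd p"] that by (auto simp: \<rho>_def)
      ultimately show "(case p of (x, r) \<Rightarrow> ball x \<rho>) \<inter> (case q of (x, r) \<Rightarrow> ball x \<rho>) = {}"
        using pq by (fastforce simp: case_prod_beta')
    qed
    have "(\<Sum>(x,r)\<in>F. ennreal ((2 * r) powr s)) \<le> (\<Sum>(x,r)\<in>F. ennreal (c * \<rho> powr (s - real n)) * emeasure lborel (ball x \<rho>))"
      using each by (intro sum_mono) auto
    also have "\<dots> = ennreal (c * \<rho> powr (s - real n)) * (\<Sum>(x,r)\<in>F. emeasure lborel (ball x \<rho>))"
      by (simp add: sum_distrib_left case_prod_beta')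
    also have "(\<Sum>(x,r)\<in>F. emeasure lborel (ball x \<rho>)) = (\<Sum>p\<in>F. emeasure lborel (case p of (x,r) \<Rightarrow> ball x \<rho>))"
      by (intro sum.cong) auto
    also have "\<dots> = emeasure lborel (\<Union>p\<in>F. case p of (x,r) \<Rightarrow> ball x \<rho>)"
      by (intro sum_emeasure disj F(1)) auto
    also have "\<dots> \<le> emeasure lborel (\<Union>x\<in>A. ball x \<rho>)"
    proof (rule emeasure_mono)
      show "(\<Union>p\<in>F. case p of (x,r) \<Rightarrow> ball x \<rho>) \<subseteq> (\<Union>x\<in>A. ball x \<rho>)"
        using FA by (intro UN_least) (force simp: case_prod_beta')
    qed (auto intro!: borel_open)
    also have "ennreal (c * \<rho> powr (s - real n)) * emeasure lborel (\<Union>x\<in>A. ball x \<rho>) = ennreal c * S (Suc k)"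
      using c by (simp add: S_def \<rho>_def ennreal_mult' mult.assoc)
    finally show ?thesis by (simp add: mult_left_mono)
  qed
  have tail: "packing_sum s P \<le> ennreal c * (\<Sum>k. S (k + Suc m))" if P: "P \<in> packings ((1/2)^m) A" for P m
    unfolding packing_sum_def infsum_ennreal_SUP
  proof (rule SUP_least, clarify)
    fix F assume F: "finite F" "F \<subseteq> P"
    define cl where "cl = (\<lambda>r::real. LEAST k. (1/2)^Suc k < r)"
    have cl: "(1/2)^Suc (cl r) < r \<and> r \<le> (1/2)^cl r \<and> m \<le> cl r" if "(x, r) \<in> F" for x r
    proof -
      have r: "0 < r" "r \<le> (1/2)^m" using that F(2) P by (auto simp: packings_def)
      obtain k where "(1/2)^k < r" using real_arch_pow_inv[OF r(1), of "1/2"] by auto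
      then have "(1/2)^Suc k < r" by (rule order.strict_trans[rotated]) simp
      then have 1: "(1/2)^Suc (cl r) < r" unfolding cl_def by (rule LeastI)
      have "\<not> m > cl r"
      proof
        assume "m > cl r"
        then have "(1/2::real)^m \<le> (1/2)^Suc (cl r)" by (intro power_decreasing) auto
        then show False using 1 r by simp
      qed
      moreover have "r \<le> (1/2)^cl r"
      proof (cases "cl r")
        case 0
        have "(1/2::real)^m \<le> 1" by (simp add: power_le_one)
        then show ?thesis using r 0 by simp
      next
        case (Suc j)
        then have "\<not> (1/2)^Suc j < r" using not_less_Least[of j "\<lambda>k. (1/2)^Suc k < r"] by (simp add: cl_def)
        then show ?thesis using Suc by simp
      qed
      ultimately show ?thesis using 1 by simp
    qed
    define K where "K = (cl \<circ> snd) ` F"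
    have K: "finite K" "\<And>k. k \<in> K \<Longrightarrow> m \<le> k" using F(1) cl by (auto simp: K_def)
    have "(\<Sum>(x,r)\<in>F. ennreal ((2 * r) powr s)) = (\<Sum>k\<in>K. \<Sum>(x,r)\<in>{p\<in>F. (cl \<circ> snd) p = k}. ennreal ((2 * r) powr s))"
      unfolding K_def using F(1) by (rule sum.image_gen)
    also have "\<dots> \<le> (\<Sum>k\<in>K. ennreal c * S (Suc k))"
      using F cl by (intro sum_mono dyadic_class[OF P]) auto
    also have "\<dots> = ennreal c * (\<Sum>k\<in>K. S (Suc k))" by (simp add: sum_distrib_left)
    also have "(\<Sum>k\<in>K. S (Suc k)) = (\<Sum>j\<in>(\<lambda>k. k - m) ` K. S (j + Suc m))"
      using K(2) by (subst sum.reindex) (auto intro!: inj_onI sum.cong simp: eq_diff_iff)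
    also have "\<dots> \<le> (\<Sum>j. S (j + Suc m))"
      using K(1) by (intro sum_le_suminf) auto
    finally show "(\<Sum>(x,r)\<in>F. ennreal ((2 * r) powr s)) \<le> ennreal c * (\<Sum>k. S (k + Suc m))"
      by (simp add: mult_left_mono)
  qed
  have fin': "(\<Sum>k. S k) < \<infinity>" using fin by (simp add: S_def n_def)
  have "(\<lambda>m. \<Sum>k. S (k + m)) \<longlonglongrightarrow> 0"
  proof -
    define g where "g = (\<lambda>k. enn2real (S k))"
    have Sg: "S k = ennreal (g k)" for k
    proof -
      have "S k \<le> (\<Sum>k. S k)" using sum_le_suminf[of S "{k}"] by simp
      then have "S k < \<infinity>" using fin' by (rule order.strict_trans1)
      then show ?thesis by (simp add: g_def)
    qed
    have g: "summable g" using fin' unfolding Sg by (intro summable_suminf_not_top) (auto simp: g_def)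
    have "(\<lambda>m. \<Sum>k. g (k + m)) \<longlonglongrightarrow> 0" using suminf_exist_split2[OF g] by simp
    then have "(\<lambda>m. ennreal (\<Sum>k. g (k + m))) \<longlonglongrightarrow> ennreal 0" by (rule tendsto_ennrealI)
    moreover have "ennreal (\<Sum>k. g (k + m)) = (\<Sum>k. S (k + m))" for m
      unfolding Sg using summable_ignore_initial_segment[OF g, of m]
      by (intro suminf_ennreal2[symmetric]) (auto simp: g_def)
    ultimately show ?thesis by simp
  qed
  then have "(\<lambda>m. \<Sum>k. S (k + Suc m)) \<longlonglongrightarrow> 0" by (rule LIMSEQ_Suc)
  then have "(\<lambda>m. ennreal c * (\<Sum>k. S (k + Suc m))) \<longlonglongrightarrow> ennreal c * 0"
    by (intro ennreal_tendsto_cmult) auto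
  moreover have "packing_premeasure s A \<le> ennreal c * (\<Sum>k. S (k + Suc m))" for m
  proof -
    have "packing_premeasure s A \<le> (SUP P\<in>packings ((1/2)^m) A. packing_sum s P)"
      unfolding packing_premeasure_alt by (intro INF_lower) auto
    also have "\<dots> \<le> ennreal c * (\<Sum>k. S (k + Suc m))" by (intro SUP_least tail)
    finally show ?thesis .
  qed
  ultimately have "packing_premeasure s A \<le> ennreal c * 0"
    by (intro LIMSEQ_le_const) auto
  then show ?thesis by simp
qed

lemma packing_premeasure_unit_interval:
  assumes s: "1 < s"
  shows "packing_premeasure s {0..1::real} = 0"
proof (rule packing_premeasure_eq_0_if_sausage_summable)
  have p: "(1/2::real) powr (s - 1) < 1"
  proof -
    have "(1/2::real) powr (s - 1) < 1 powr (s - 1)" using s by (intro powr_less_mono2) auto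
    then show ?thesis by simp
  qed
  have "(\<Sum>k. ennreal (((1/2) ^ k) powr (s - real DIM(real))) * emeasure lborel (\<Union>x\<in>{0..1::real}. ball x ((1/2) ^ k))) \<le> (\<Sum>k. ennreal (3 * ((1/2) powr (s - 1)) ^ k))"
  proof (intro suminf_le)
    fix k
    have "emeasure lborel (\<Union>x\<in>{0..1::real}. ball x ((1/2) ^ k)) \<le> emeasure lborel {-1..2::real}"
    proof (rule emeasure_mono)
      have "(1/2::real) ^ k \<le> 1" by (simp add: power_le_one)
      then show "(\<Union>x\<in>{0..1::real}. ball x ((1/2) ^ k)) \<subseteq> {-1..2}" by (auto simp: dist_real_def)
    qed simp
    then have "ennreal (((1/2) ^ k) powr (s - 1)) * emeasure lborel (\<Union>x\<in>{0..1::real}. ball x ((1/2) ^ k)) \<le> ennreal (((1/2) ^ k) powr (s - 1)) * ennreal 3"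
      by (intro mult_left_mono) auto
    also have "\<dots> = ennreal (((1/2) ^ k) powr (s - 1) * 3)"
      by (rule ennreal_mult[symmetric]) auto
    also have "((1/2::real) ^ k) powr (s - 1) * 3 = 3 * ((1/2) powr (s - 1)) ^ k"
      by (simp add: powr_power powr_powr mult.commute flip: powr_realpow)
    finally show "ennreal (((1/2) ^ k) powr (s - real DIM(real))) * emeasure lborel (\<Union>x\<in>{0..1::real}. ball x ((1/2) ^ k)) \<le> ennreal (3 * ((1/2) powr (s - 1)) ^ k)"
      by simp
  qed auto
  also have "\<dots> < \<infinity>"
    using p by (subst suminf_ennreal2) (auto intro!: summable_mult summable_geometric)
  finally show "(\<Sum>k. ennreal (((1/2) ^ k) powr (s - real DIM(real))) * emeasure lborel (\<Union>x\<in>{0..1::real}. ball x ((1/2) ^ k))) < \<infinity>" .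
qed (use s in simp)

lemma packing_measure_unit_interval:
  assumes s: "s < 1"
  shows "packing_measure s {0..1::real} \<noteq> 0"
proof
  assume "packing_measure s {0..1::real} = 0"
  then obtain A :: "nat \<Rightarrow> real set" where A: "{0..1} \<subseteq> (\<Union>i. A i)" "\<And>i. packing_premeasure s (A i) < \<infinity>"
    using packing_measure_zeroD by blast
  have "\<exists>N\<in>null_sets lborel. A i \<inter> UNIV \<subseteq> N" for i
  proof (rule finite_packing_premeasure_null[OF A(2)])
    fix x \<epsilon> \<delta> :: real assume \<epsilon>: "\<epsilon> > 0" and \<delta>: "\<delta> > 0"
    have "((\<lambda>r::real. 10 * r / (2 * r) powr s) \<longlongrightarrow> 0) (at_right 0)" using s by real_asymp
    then have "eventually (\<lambda>r. 10 * r / (2 * r) powr s < \<epsilon>) (at_right 0)" using \<epsilon> by (rule order_tendstoD)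
    moreover have "eventually (\<lambda>r. 0 < r \<and> r < \<delta>) (at_right 0)"
      using \<delta> by (intro eventually_at_rightI[of 0 \<delta>]) auto
    ultimately have "eventually (\<lambda>r. 10 * r / (2 * r) powr s < \<epsilon> \<and> 0 < r \<and> r < \<delta>) (at_right 0)"
      by eventually_elim simp
    then obtain r where r: "10 * r / (2 * r) powr s < \<epsilon>" "0 < r" "r < \<delta>"
      using eventually_happens[of _ "at_right (0::real)"] by (auto simp: trivial_limit_at_right_real)
    have "cball x (5 * r) = {x - 5 * r..x + 5 * r}" by (auto simp: dist_real_def abs_le_iff)
    then have "emeasure lborel (cball x (5 * r)) = ennreal (10 * r)" using r(2) by simp
    also have "\<dots> \<le> ennreal (\<epsilon> * (2 * r) powr s)"
      using r by (intro ennreal_leI) (simp add: pos_divide_less_eq)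
    finally show "\<exists>r>0. r \<le> \<delta> \<and> emeasure lborel (cball x (5 * r)) \<le> ennreal (\<epsilon> * (2 * r) powr s)"
      using r by (intro exI[of _ r]) auto
  qed simp
  then obtain N where N: "\<And>i. N i \<in> null_sets lborel" "\<And>i. A i \<subseteq> N i" by (metis inf_top_right)
  have null: "(\<Union>i. N i) \<in> null_sets lborel" using N(1) by (intro null_sets_UN) auto
  have "{0..1} \<subseteq> (\<Union>i. N i)" using A(1) N(2) by blast
  then have "emeasure lborel {0..1::real} \<le> emeasure lborel (\<Union>i. N i)"
    using null by (intro emeasure_mono) auto
  then show False using null by (simp add: null_setsD1)
qed

lemma packing_dim_eqI:
  assumes "\<And>s. I < ennreal s \<Longrightarrow> packing_measure s A = 0"
    and "\<And>s. 0 \<le> s \<Longrightarrow> ennreal s < I \<Longrightarrow> packing_measure s A \<noteq> 0"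
  shows "packing_dim A = I"
proof (rule antisym)
  show "packing_dim A \<le> I"
  proof (rule dense_ge)
    fix x assume x: "I < x"
    show "packing_dim A \<le> x"
    proof (cases x rule: ennreal_cases)
      case (real s)
      then show ?thesis using assms(1)[of s] x packing_dim_le[of s A] by simp
    qed simp
  qed
  show "I \<le> packing_dim A"
  proof (rule dense_le)
    fix x assume x: "x < I"
    then obtain s where s: "x = ennreal s" "0 \<le> s" by (cases x rule: ennreal_cases) auto
    then show "x \<le> packing_dim A" using assms(2)[of s] x packing_dim_ge[of s A] by simp
  qed
qed

section \<open>The Fourier transform of the Cauchy kernel\<close>

lemma integrable_exponential_density:
  assumes "0 < l"
  shows "integrable lborel (exponential_density l)"
proof -
  interpret prob_space "density lborel (exponential_density l)"
    using assms by (rule prob_space_exponential_density)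
  have "(\<integral>\<^sup>+x. ennreal (exponential_density l x) \<partial>lborel) = 1"
    using emeasure_space_1 by (simp add: emeasure_density)
  then show ?thesis
    by (intro integrableI_nonneg) (auto intro!: AE_I2 exponential_density_nonneg assms)
qed

lemma has_bochner_integral_exp_half_line:
  assumes z: "Re z > 0"
  shows "has_bochner_integral lborel (\<lambda>t. indicator {0<..} t *\<^sub>R exp (- (of_real t * z))) (1 / z)"
proof -
  have half: "einterval 0 \<infinity> = {0<..}" by (auto simp: einterval_def zero_ereal_def)
  have int: "integrable lborel (\<lambda>t. indicator {0<..} t *\<^sub>R exp (- (of_real t * z)))"
  proof (rule Bochner_Integration.integrable_bound[OF integrable_mult_right[OF integrable_exponential_density[OF z], of "1 / Re z"]])
    show "AE t in lborel. norm (indicator {0<..} t *\<^sub>R exp (- (of_real t * z))) \<le> norm (1 / Re z * exponential_density (Re z) t)"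
      using z by (auto simp: exponential_density_def indicator_def mult.commute)
  qed simp
  have "(LBINT t=0..\<infinity>. exp (- (of_real t * z))) = 0 - (- 1 / z)"
  proof (rule interval_integral_FTC_integrable[where F = "\<lambda>t. - exp (- (of_real t * z)) / z"])
    have "((\<lambda>w. - exp (- (w * z)) / z) has_field_derivative exp (- (of_real t * z))) (at (of_real t))" for t
      using z by (auto intro!: derivative_eq_intros)
    then show "((\<lambda>t. - exp (- (of_real t * z)) / z) has_vector_derivative exp (- (of_real t * z))) (at t)" for t
      by (rule has_vector_derivative_real_field)
    show "isCont (\<lambda>t. exp (- (of_real t * z))) t" for t by (intro continuous_intros)
    show "set_integrable lborel (einterval 0 \<infinity>) (\<lambda>t. exp (- (of_real t * z)))"
      using int by (simp add: set_integrable_def half)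
    have "((\<lambda>t. - exp (- (of_real t * z)) / z) \<longlongrightarrow> - 1 / z) (at_right 0)"
      by (rule tendsto_eq_intros | simp add: z | use z in force)+
    then show "(((\<lambda>t. - exp (- (of_real t * z)) / z) \<circ> real_of_ereal) \<longlongrightarrow> - 1 / z) (at_right 0)"
      by (simp add: zero_ereal_def ereal_tendsto_simps)
    have "((\<lambda>t. - exp (- (of_real t * z)) / z) \<longlongrightarrow> 0) at_top"
    proof (rule tendsto_norm_zero_cancel)
      have "((\<lambda>t. exp (- (t * Re z)) / norm z) \<longlongrightarrow> 0) at_top"
        using z by (auto intro!: tendsto_divide_zero filterlim_compose[OF exp_at_bot] filterlim_at_top_mult_tendsto_pos
            simp: filterlim_uminus_at_bot intro: filterlim_tendsto_pos_mult_at_top filterlim_ident)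
      then show "((\<lambda>t. norm (- exp (- (of_real t * z)) / z)) \<longlongrightarrow> 0) at_top"
        by (simp add: norm_divide)
    qed
    then show "(((\<lambda>t. - exp (- (of_real t * z)) / z) \<circ> real_of_ereal) \<longlongrightarrow> 0) (at_left \<infinity>)"
      by (simp add: ereal_tendsto_simps)
  qed simp
  then have "(\<integral>t. indicator {0<..} t *\<^sub>R exp (- (of_real t * z)) \<partial>lborel) = 1 / z"
    by (simp add: interval_lebesgue_integral_0_infty set_lebesgue_integral_def)
  then show ?thesis using int by (simp add: has_bochner_integral_iff)
qed

lemma has_bochner_integral_laplace_fourier:
  "has_bochner_integral lborel (\<lambda>y. of_real (exp (- \<bar>y\<bar>)) * iexp (y * x)) (of_real (2 / (1 + x\<^sup>2)))"
proof -
  have 1: "has_bochner_integral lborel (\<lambda>t. indicator {0<..} t *\<^sub>R exp (- (of_real t * (1 - \<i> * x)))) (1 / (1 - \<i> * x))" for x :: real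
    by (rule has_bochner_integral_exp_half_line) simp
  have 2: "has_bochner_integral lborel (\<lambda>t. indicator {0<..} (- t) *\<^sub>R exp (- (of_real (- t) * (1 - \<i> * (- x))))) (1 / (1 - \<i> * (-x)))"
    using lborel_has_bochner_integral_real_affine_iff[of "-1" "\<lambda>t. indicator {0<..} t *\<^sub>R exp (- (of_real t * (1 - \<i> * (- x))))" "1 / (1 - \<i> * (-x))" 0]
      1[of "-x"] by simp
  have pos: "1 + x * x \<noteq> 0" "1 + x\<^sup>2 \<noteq> 0"
    by (auto simp: add_nonneg_eq_0_iff)
  have nz: "1 - \<i> * x \<noteq> 0" "1 + \<i> * x \<noteq> 0" by (auto simp: complex_eq_iff)
  have "1 / (1 - \<i> * x) + 1 / (1 - \<i> * (- x)) = of_real (2 / (1 + x\<^sup>2))"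
    using nz pos by (simp add: divide_simps) (auto simp: complex_eq_iff power2_eq_square algebra_simps)
  then have sum: "has_bochner_integral lborel (\<lambda>t. indicator {0<..} t *\<^sub>R exp (- (of_real t * (1 - \<i> * x)))
      + indicator {0<..} (- t) *\<^sub>R exp (- (of_real (- t) * (1 - \<i> * (- x))))) (of_real (2 / (1 + x\<^sup>2)))"
    using has_bochner_integral_add[OF 1[of x] 2] by simp
  have "AE t in lborel. t \<noteq> (0::real)" by (rule AE_lborel_singleton)
  then have ae: "AE t in lborel. indicator {0<..} t *\<^sub>R exp (- (of_real t * (1 - \<i> * x)))
      + indicator {0<..} (- t) *\<^sub>R exp (- (of_real (- t) * (1 - \<i> * (- x)))) = of_real (exp (- \<bar>t\<bar>)) * iexp (t * x)"
    by eventually_elim (auto simp: exp_of_real[symmetric] exp_add[symmetric] indicator_def algebra_simps)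
  show ?thesis
    by (rule iffD1[OF has_bochner_integral_cong_AE[OF _ _ ae] sum]) measurable
qed

lemma integrable_cauchy: "integrable lborel (\<lambda>x::real. 1 / (1 + x\<^sup>2))"
proof -
  have "einterval (-\<infinity>) \<infinity> = UNIV" by (auto simp: einterval_def)
  then show ?thesis
    using integrable_inverse_1_plus_square by (simp add: set_integrable_def inverse_eq_divide)
qed

lemma norm_cauchy_fourier:
  "norm (of_real (1 / (1 + \<xi>\<^sup>2)) * iexp (\<xi> * x)) = 1 / (1 + \<xi>\<^sup>2)"
  by (simp add: norm_mult del: of_real_divide)

lemma integrable_cauchy_fourier:
  "integrable lborel (\<lambda>\<xi>. of_real (1 / (1 + \<xi>\<^sup>2)) * iexp (\<xi> * x))"
  by (rule Bochner_Integration.integrable_bound[OF integrable_cauchy])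
     (simp_all only: norm_cauchy_fourier, auto)

text \<open>Fourier inversion for \<open>exp (- \<bar>x\<bar>)\<close>: damp the integrand by a Gaussian of width \<open>1 / h\<close>,
  apply Fubini, and let \<open>h\<close> tend to \<open>0\<close>.\<close>

lemma cauchy_fourier:
  "(\<integral>\<xi>. of_real (1 / (1 + \<xi>\<^sup>2)) * iexp (\<xi> * x) \<partial>lborel) = of_real (pi * exp (- \<bar>x\<bar>))"
proof -
  define g where "g h \<xi> = of_real (exp (- (h * \<xi>)\<^sup>2 / 2)) * (of_real (1 / (1 + \<xi>\<^sup>2)) * iexp (\<xi> * x))" for h \<xi> :: real
  have gauss: "has_bochner_integral lborel (\<lambda>\<xi>. of_real (exp (- (h * \<xi>)\<^sup>2 / 2)) * iexp (t * \<xi>)) (of_real (sqrt (2 * pi) / h * exp (- (t / h)\<^sup>2 / 2)))"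
    if "h > 0" for h t :: real
  proof -
    have "(\<integral>\<xi>. std_normal_density \<xi> *\<^sub>R iexp (s * \<xi>) \<partial>lborel) = of_real (exp (- s\<^sup>2 / 2))" for s
      using fun_cong[OF char_std_normal_distribution, of s]
      by (simp add: char_def integral_density normal_density_nonneg)
    moreover have "integrable lborel (\<lambda>\<xi>. std_normal_density \<xi> *\<^sub>R iexp (s * \<xi>))" for s
      by (rule Bochner_Integration.integrable_bound[OF integrable_normal_density[of 1 0]]) auto
    ultimately have "has_bochner_integral lborel (\<lambda>\<xi>. std_normal_density \<xi> *\<^sub>R iexp (t / h * \<xi>)) (of_real (exp (- (t / h)\<^sup>2 / 2)))"
      unfolding has_bochner_integral_iff by blast
    then have "has_bochner_integral lborel (\<lambda>\<xi>. std_normal_density (0 + h * \<xi>) *\<^sub>R iexp (t / h * (0 + h * \<xi>))) (of_real (exp (- (t / h)\<^sup>2 / 2)) /\<^sub>R \<bar>h\<bar>)"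
      using that by (subst (asm) lborel_has_bochner_integral_real_affine_iff[of h _ _ 0]) auto
    then have "has_bochner_integral lborel (\<lambda>\<xi>. of_real (sqrt (2 * pi)) * (std_normal_density (0 + h * \<xi>) *\<^sub>R iexp (t / h * (0 + h * \<xi>)))) (of_real (sqrt (2 * pi)) * (of_real (exp (- (t / h)\<^sup>2 / 2)) /\<^sub>R \<bar>h\<bar>))"
      by (rule has_bochner_integral_mult_right)
    then show ?thesis
      using that by (simp add: std_normal_density_def scaleR_conv_of_real field_simps)
  qed
  have lim1: "(\<lambda>n. \<integral>\<xi>. g (1 / Suc n) \<xi> \<partial>lborel) \<longlonglongrightarrow> (\<integral>\<xi>. of_real (1 / (1 + \<xi>\<^sup>2)) * iexp (\<xi> * x) \<partial>lborel)"
  proof (rule integral_dominated_convergence[OF _ _ integrable_cauchy])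
    show "AE \<xi> in lborel. norm (g (1 / Suc n) \<xi>) \<le> 1 / (1 + \<xi>\<^sup>2)" for n
      unfolding g_def norm_mult[of "of_real (exp _)"] norm_cauchy_fourier by (auto intro!: AE_I2 divide_right_mono)
    have "(\<lambda>n. g (1 / Suc n) \<xi>) \<longlonglongrightarrow> of_real (exp (- (0 * \<xi>)\<^sup>2 / 2)) * (of_real (1 / (1 + \<xi>\<^sup>2)) * iexp (\<xi> * x))" for \<xi>
      unfolding g_def using LIMSEQ_inverse_real_of_nat by (intro tendsto_intros) (simp_all add: inverse_eq_divide)
    then show "AE \<xi> in lborel. (\<lambda>n. g (1 / Suc n) \<xi>) \<longlonglongrightarrow> of_real (1 / (1 + \<xi>\<^sup>2)) * iexp (\<xi> * x)" by simp
  qed (auto simp: g_def)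
  have eq: "(\<integral>\<xi>. g h \<xi> \<partial>lborel) = of_real (pi * (\<integral>u. std_normal_density u * exp (- \<bar>h * u - x\<bar>) \<partial>lborel))" if h: "h > 0" for h
  proof -
    define k where "k = (\<lambda>\<xi> y. of_real (exp (- (h * \<xi>)\<^sup>2 / 2)) * iexp (x * \<xi>) * (of_real (exp (- \<bar>y\<bar>)) * iexp (y * \<xi>)) :: complex)"
    have kint: "integrable (lborel \<Otimes>\<^sub>M lborel) (\<lambda>(\<xi>, y). k \<xi> y)"
    proof (rule Bochner_Integration.integrable_bound)
      have "integrable lborel (\<lambda>\<xi>. exp (- (h * \<xi>)\<^sup>2 / 2))"
        using integrable_norm[OF has_bochner_integral_iff[THEN iffD1, OF gauss[OF h, of 0], THEN conjunct1]] by simp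
      moreover have "integrable lborel (\<lambda>y::real. exp (- \<bar>y\<bar>))"
        using integrable_norm[OF has_bochner_integral_iff[THEN iffD1, OF has_bochner_integral_laplace_fourier[of 0], THEN conjunct1]] by simp
      ultimately show "integrable (lborel \<Otimes>\<^sub>M lborel) (\<lambda>(\<xi>, y). exp (- (h * \<xi>)\<^sup>2 / 2) * exp (- \<bar>y\<bar>))"
        by (intro lborel_pair.Fubini_integrable) (auto simp: abs_mult)
    qed (auto simp: k_def norm_mult split: prod.split)
    have "(\<integral>\<xi>. g h \<xi> \<partial>lborel) = (\<integral>\<xi>. (\<integral>y. k \<xi> y \<partial>lborel) / 2 \<partial>lborel)"
    proof (rule Bochner_Integration.integral_cong[OF refl])
      fix \<xi>
      have "(\<integral>y. k \<xi> y \<partial>lborel) = of_real (exp (- (h * \<xi>)\<^sup>2 / 2)) * iexp (x * \<xi>) * of_real (2 / (1 + \<xi>\<^sup>2))"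
        unfolding k_def
        by (intro has_bochner_integral_integral_eq has_bochner_integral_mult_right has_bochner_integral_laplace_fourier)
      moreover have "complex_of_real (2 / (1 + \<xi>\<^sup>2)) = 2 * of_real (1 / (1 + \<xi>\<^sup>2))" by simp
      ultimately show "g h \<xi> = (\<integral>y. k \<xi> y \<partial>lborel) / 2"
        by (simp add: g_def mult_ac del: of_real_divide)
    qed
    also have "\<dots> = (\<integral>y. (\<integral>\<xi>. k \<xi> y \<partial>lborel) \<partial>lborel) / 2"
      using lborel_pair.Fubini_integral[OF kint] by simp
    also have "(\<integral>y. (\<integral>\<xi>. k \<xi> y \<partial>lborel) \<partial>lborel) = (\<integral>y. of_real (exp (- \<bar>y\<bar>) * (sqrt (2 * pi) / h * exp (- ((x + y) / h)\<^sup>2 / 2))) \<partial>lborel)"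
    proof (rule Bochner_Integration.integral_cong[OF refl])
      fix y
      have "k \<xi> y = of_real (exp (- \<bar>y\<bar>)) * (of_real (exp (- (h * \<xi>)\<^sup>2 / 2)) * iexp ((x + y) * \<xi>))" for \<xi>
        by (simp add: k_def exp_add ring_distribs)
      then show "(\<integral>\<xi>. k \<xi> y \<partial>lborel) = of_real (exp (- \<bar>y\<bar>) * (sqrt (2 * pi) / h * exp (- ((x + y) / h)\<^sup>2 / 2)))"
        using has_bochner_integral_integral_eq[OF has_bochner_integral_mult_right[OF gauss[OF h, of "x + y"], of "of_real (exp (- \<bar>y\<bar>))"]]
        by simp
    qed
    also have "\<dots> = of_real (\<integral>y. exp (- \<bar>y\<bar>) * (sqrt (2 * pi) / h * exp (- ((x + y) / h)\<^sup>2 / 2)) \<partial>lborel)"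
      by (rule integral_complex_of_real)
    also have "(\<integral>y. exp (- \<bar>y\<bar>) * (sqrt (2 * pi) / h * exp (- ((x + y) / h)\<^sup>2 / 2)) \<partial>lborel)
        = \<bar>h\<bar> *\<^sub>R (\<integral>u. exp (- \<bar>- x + h * u\<bar>) * (sqrt (2 * pi) / h * exp (- ((x + (- x + h * u)) / h)\<^sup>2 / 2)) \<partial>lborel)"
      using h by (intro lborel_integral_real_affine) simp
    also have "\<dots> = (\<integral>u. 2 * pi * (std_normal_density u * exp (- \<bar>h * u - x\<bar>)) \<partial>lborel)"
    proof -
      have "sqrt (2 * pi) * sqrt (2 * pi) = 2 * pi" by simp
      then have "2 * pi * std_normal_density u = sqrt (2 * pi) * exp (- u\<^sup>2 / 2)" for u
        by (simp add: std_normal_density_def field_simps)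
      then have "h * (exp (- \<bar>- x + h * u\<bar>) * (sqrt (2 * pi) / h * exp (- ((x + (- x + h * u)) / h)\<^sup>2 / 2)))
          = 2 * pi * (std_normal_density u * exp (- \<bar>h * u - x\<bar>))" for u
        using h by (simp add: mult.assoc[symmetric])
      then show ?thesis
        unfolding real_scaleR_def abs_of_pos[OF h] integral_mult_right_zero[symmetric]
        by (intro Bochner_Integration.integral_cong refl)
    qed
    also have "\<dots> = 2 * pi * (\<integral>u. std_normal_density u * exp (- \<bar>h * u - x\<bar>) \<partial>lborel)"
      by (rule integral_mult_right_zero)
    finally show ?thesis by simp
  qed
  have "(\<lambda>n. \<integral>u. std_normal_density u * exp (- \<bar>1 / Suc n * u - x\<bar>) \<partial>lborel) \<longlonglongrightarrow> (\<integral>u. std_normal_density u * exp (- \<bar>x\<bar>) \<partial>lborel)"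
  proof (rule integral_dominated_convergence[OF _ _ integrable_normal_density[of 1 0]])
    have "(\<lambda>n. std_normal_density u * exp (- \<bar>1 / Suc n * u - x\<bar>)) \<longlonglongrightarrow> std_normal_density u * exp (- \<bar>0 * u - x\<bar>)" for u
      using LIMSEQ_inverse_real_of_nat by (intro tendsto_intros) (simp_all add: inverse_eq_divide)
    then show "AE u in lborel. (\<lambda>n. std_normal_density u * exp (- \<bar>1 / Suc n * u - x\<bar>)) \<longlonglongrightarrow> std_normal_density u * exp (- \<bar>x\<bar>)" by simp
  qed (auto simp: mult_left_le normal_density_nonneg)
  then have "(\<lambda>n. \<integral>\<xi>. g (1 / Suc n) \<xi> \<partial>lborel) \<longlonglongrightarrow> of_real (pi * (\<integral>u. std_normal_density u * exp (- \<bar>x\<bar>) \<partial>lborel))"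
    by (subst eq) (auto intro!: tendsto_intros simp del: of_real_mult)
  also have "(\<integral>u. std_normal_density u * exp (- \<bar>x\<bar>) \<partial>lborel) = exp (- \<bar>x\<bar>)" by simp
  finally show ?thesis by (rule LIMSEQ_unique[OF lim1])
qed


definition cauchy_kernel :: "'a::euclidean_space \<Rightarrow> real" where
  "cauchy_kernel \<xi> = (\<Prod>b\<in>Basis. 1 / (1 + (\<xi> \<bullet> b)\<^sup>2))"

lemma cauchy_kernel_nonneg: "0 \<le> cauchy_kernel \<xi>"
  by (auto simp: cauchy_kernel_def intro!: prod_nonneg)

lemma borel_measurable_cauchy_kernel [measurable]: "cauchy_kernel \<in> borel_measurable borel"
  unfolding cauchy_kernel_def by measurable

lemma has_bochner_integral_cauchy_kernel_fourier:
  fixes x :: "'a::euclidean_space"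
  shows "has_bochner_integral lborel (\<lambda>\<xi>. of_real (cauchy_kernel \<xi>) * iexp (\<xi> \<bullet> x))
           (of_real (pi ^ DIM('a) * (\<Prod>b\<in>Basis. exp (- \<bar>x \<bullet> b\<bar>))))"
proof -
  interpret product_sigma_finite "\<lambda>b::'a. lborel :: real measure"
    by standard
  define f where "f b t = (of_real (1 / (1 + t\<^sup>2)) * iexp (t * (x \<bullet> b)) :: complex)" for b t
  have f: "integrable lborel (f b)" for b
    unfolding f_def by (rule integrable_cauchy_fourier)
  have [measurable]: "f b \<in> borel_measurable borel" for b unfolding f_def by measurable
  have coord: "(\<Sum>c\<in>Basis. w c *\<^sub>R c) \<bullet> b = w b" if "b \<in> Basis" for b :: 'a and w
    using that by (simp add: inner_sum_left inner_Basis if_distrib sum.delta cong: if_cong)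
  have eq: "of_real (cauchy_kernel \<xi>) * iexp (\<xi> \<bullet> x) = (\<Prod>b\<in>Basis. f b (\<xi> \<bullet> b))" for \<xi>
    unfolding f_def cauchy_kernel_def prod.distrib
    by (subst euclidean_inner) (simp add: exp_sum sum_distrib_left)
  have "has_bochner_integral (distr (\<Pi>\<^sub>M b\<in>Basis. lborel) borel (\<lambda>w. \<Sum>b\<in>Basis. w b *\<^sub>R b)) (\<lambda>\<xi>. \<Prod>b\<in>Basis. f b (\<xi> \<bullet> b))
      (\<Prod>b\<in>Basis. integral\<^sup>L lborel (f b))"
  proof (rule has_bochner_integral_distr)
    have "has_bochner_integral (\<Pi>\<^sub>M b\<in>Basis. lborel) (\<lambda>w. \<Prod>b\<in>Basis. f b (w b)) (\<Prod>b\<in>(Basis :: 'a set). integral\<^sup>L lborel (f b))"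
      using f by (auto simp: has_bochner_integral_iff intro!: product_integrable_prod product_integral_prod)
    then show "has_bochner_integral (\<Pi>\<^sub>M b\<in>Basis. lborel) (\<lambda>w. \<Prod>b\<in>Basis. f b ((\<Sum>b\<in>Basis. w b *\<^sub>R b) \<bullet> b)) (\<Prod>b\<in>(Basis :: 'a set). integral\<^sup>L lborel (f b))"
      by (simp add: coord cong: prod.cong)
  qed measurable
  also have "(\<Prod>b\<in>Basis. integral\<^sup>L lborel (f b)) = of_real (pi ^ DIM('a) * (\<Prod>b\<in>Basis. exp (- \<bar>x \<bullet> b\<bar>)))"
    unfolding f_def cauchy_fourier by (simp add: prod.distrib)
  finally show ?thesis unfolding eq lborel_eq[symmetric] .
qed

lemma integrable_cauchy_kernel: "integrable lborel (cauchy_kernel :: 'a::euclidean_space \<Rightarrow> real)"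
proof -
  have "complex_integrable lborel (\<lambda>\<xi>::'a. of_real (cauchy_kernel \<xi>))"
    using has_bochner_integral_cauchy_kernel_fourier[of "0::'a"] by (auto simp: has_bochner_integral_iff)
  then have "integrable lborel (\<lambda>\<xi>::'a. Re (of_real (cauchy_kernel \<xi>)))" by (rule integrable_Re)
  then show ?thesis by simp
qed

section \<open>Levy processes with regular paths\<close>

lemma (in prob_space) levy_process_measurable:
  "levy_process X \<Longrightarrow> t \<ge> 0 \<Longrightarrow> X t \<in> borel_measurable M"
  by (auto simp: levy_process_def)

lemma (in prob_space) levy_process_start: "levy_process X \<Longrightarrow> AE \<omega> in M. X 0 \<omega> = 0"
  by (auto simp: levy_process_def)

lemma (in prob_space) levy_process_stationary:
  assumes X: "levy_process X" and "s \<ge> 0" "t \<ge> 0"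
  shows "distr M borel (\<lambda>\<omega>. X (s + t) \<omega> - X s \<omega>) = distr M borel (X t)"
proof -
  have [measurable]: "X t \<in> borel_measurable M" "X 0 \<in> borel_measurable M"
    using levy_process_measurable[OF X] assms(3) by auto
  have "distr M borel (\<lambda>\<omega>. X (s + t) \<omega> - X s \<omega>) = distr M borel (\<lambda>\<omega>. X t \<omega> - X 0 \<omega>)"
    using assms unfolding levy_process_def by blast
  also have "\<dots> = distr M borel (X t)"
    using levy_process_start[OF X] by (intro distr_cong_AE) auto
  finally show ?thesis .
qed

lemma (in prob_space) levy_process_markov:
  fixes X :: "real \<Rightarrow> 'a \<Rightarrow> 'b::euclidean_space"
  assumes X: "levy_process X" and h: "h > 0"
    and B[measurable]: "\<And>j. B j \<in> sets borel" and C[measurable]: "C \<in> sets borel"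
  shows "prob {\<omega>\<in>space M. (\<forall>j\<le>i. X (real j * h) \<omega> \<in> B j) \<and> X (real (i + k) * h) \<omega> - X (real i * h) \<omega> \<in> C}
       = prob {\<omega>\<in>space M. \<forall>j\<le>i. X (real j * h) \<omega> \<in> B j} * prob {\<omega>\<in>space M. X (real k * h) \<omega> \<in> C}"
proof -
  have meas[measurable]: "X (real j * h) \<in> borel_measurable M" for j
    using levy_process_measurable[OF X] h by simp
  have start: "AE \<omega> in M. X 0 \<omega> = 0" by (rule levy_process_start[OF X])
  have stat: "prob {\<omega>\<in>space M. X (real (i + k) * h) \<omega> - X (real i * h) \<omega> \<in> C} = prob {\<omega>\<in>space M. X (real k * h) \<omega> \<in> C}"
  proof -
    have "measure (distr M borel (\<lambda>\<omega>. X (real i * h + real k * h) \<omega> - X (real i * h) \<omega>)) C = measure (distr M borel (X (real k * h))) C"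
      using levy_process_stationary[OF X, of "real i * h" "real k * h"] h by simp
    moreover have "X (real i * h + real k * h) \<in> borel_measurable M"
      using meas[of "i + k"] by (simp add: ring_distribs)
    ultimately show ?thesis
      by (simp add: measure_distr vimage_def Int_def conj_commute ring_distribs)
  qed
  show ?thesis
  proof (cases "k = 0")
    case True
    have "prob {\<omega>\<in>space M. X (real k * h) \<omega> \<in> C} = (if 0 \<in> C then 1 else 0)"
    proof -
      have [measurable]: "X 0 \<in> borel_measurable M" using levy_process_measurable[OF X] by simp
      have "prob {\<omega>\<in>space M. X (real k * h) \<omega> \<in> C} = prob {\<omega>\<in>space M. 0 \<in> C}"
        using start True by (intro measure_eq_AE) auto
      then show ?thesis by (simp add: prob_space)
    qed
    then show ?thesis using True by auto
  next
    case False
    define t where "t j = (if j \<le> i then real j * h else real (k + j - 1) * h)" for j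
    have t: "t j = real (if j \<le> i then j else k + j - 1) * h" for j by (simp add: t_def)
    have mono: "strict_mono_on {..Suc i} t"
      using False h by (intro strict_mono_onI) (auto simp: t intro!: mult_strict_right_mono)
    define I where "I j \<omega> = X (t (Suc j)) \<omega> - X (t j) \<omega>" for j \<omega>
    have ind: "indep_vars (\<lambda>_. borel) I {..<Suc i}"
    proof -
      have "0 \<le> t 0 \<and> strict_mono_on {..Suc i} t \<longrightarrow> indep_vars (\<lambda>_. borel) (\<lambda>j \<omega>. X (t (Suc j)) \<omega> - X (t j) \<omega>) {..<Suc i}"
        using X unfolding levy_process_def by blast
      then show ?thesis using mono unfolding I_def by (simp add: t_def)
    qed
    have [measurable]: "I j \<in> borel_measurable M" for j
      unfolding I_def t using meas by measurable
    have iv: "indep_var (PiM {..<i} (\<lambda>_. borel)) (\<lambda>\<omega>. restrict (\<lambda>j. I j \<omega>) {..<i}) (PiM {i} (\<lambda>_. borel)) (\<lambda>\<omega>. restrict (\<lambda>j. I j \<omega>) {i})"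
      by (rule indep_var_restrict[OF ind]) auto
    define P where "P = {x \<in> space (PiM {..<i} (\<lambda>_. borel)). \<forall>j\<le>i. (\<Sum>l<j. x l) \<in> B j}"
    define Q where "Q = {x \<in> space (PiM {i} (\<lambda>_. borel)). x i \<in> C}"
    have PQ: "P \<in> sets (PiM {..<i} (\<lambda>_. borel))" "Q \<in> sets (PiM {i} (\<lambda>_. borel))"
    proof -
      have "(\<lambda>x. \<Sum>l<j. x l) \<in> borel_measurable (PiM {..<i} (\<lambda>_. borel :: 'b measure))" if "j \<le> i" for j
        using that by (intro borel_measurable_sum measurable_component_singleton) auto
      then have *: "{x \<in> space (PiM {..<i} (\<lambda>_. borel)). (\<Sum>l<j. x l) \<in> B j} \<in> sets (PiM {..<i} (\<lambda>_. borel))" if "j \<le> i" for j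
        using measurable_sets[of "\<lambda>x. \<Sum>l<j. x l" "PiM {..<i} (\<lambda>_. borel)" borel "B j"] that
        by (simp add: vimage_def Int_def conj_commute)
      have "{x \<in> space (PiM {..<i} (\<lambda>_. borel)). j \<le> i \<longrightarrow> (\<Sum>l<j. x l) \<in> B j} \<in> sets (PiM {..<i} (\<lambda>_. borel))" for j
        using *[of j] by (cases "j \<le> i") auto
      then show "P \<in> sets (PiM {..<i} (\<lambda>_. borel))"
        unfolding P_def by (rule sets.sets_Collect_countable_All)
      show "Q \<in> sets (PiM {i} (\<lambda>_. borel))" unfolding Q_def by measurable
    qed
    have sumI: "(\<Sum>l<j. I l \<omega>) = X (real j * h) \<omega>" if "X 0 \<omega> = 0" "j \<le> i" for j \<omega>
    proof -
      have "(\<Sum>l<j. I l \<omega>) = X (t j) \<omega> - X (t 0) \<omega>" unfolding I_def by (rule sum_lessThan_telescope)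
      then show ?thesis using that by (simp add: t_def)
    qed
    have Ii: "I i \<omega> = X (real (i + k) * h) \<omega> - X (real i * h) \<omega>" for \<omega>
      using False by (simp add: I_def t_def add.commute)
    have E1: "prob {\<omega>\<in>space M. \<forall>j\<le>i. X (real j * h) \<omega> \<in> B j} = prob {\<omega>\<in>space M. \<forall>j\<le>i. (\<Sum>l<j. I l \<omega>) \<in> B j}"
      using start by (intro measure_eq_AE) (auto simp: sumI)
    have E2: "prob {\<omega>\<in>space M. (\<forall>j\<le>i. X (real j * h) \<omega> \<in> B j) \<and> X (real (i + k) * h) \<omega> - X (real i * h) \<omega> \<in> C}
        = prob {\<omega>\<in>space M. (\<forall>j\<le>i. (\<Sum>l<j. I l \<omega>) \<in> B j) \<and> I i \<omega> \<in> C}"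
    proof (rule measure_eq_AE)
      show "AE \<omega> in M. (\<omega> \<in> {\<omega>\<in>space M. (\<forall>j\<le>i. X (real j * h) \<omega> \<in> B j) \<and> X (real (i + k) * h) \<omega> - X (real i * h) \<omega> \<in> C})
        = (\<omega> \<in> {\<omega>\<in>space M. (\<forall>j\<le>i. (\<Sum>l<j. I l \<omega>) \<in> B j) \<and> I i \<omega> \<in> C})"
        using start by eventually_elim (simp add: sumI Ii)
    qed measurable
    have R: "(\<Sum>l<j. restrict (\<lambda>j. I j \<omega>) {..<i} l) = (\<Sum>l<j. I l \<omega>)" if "j \<le> i" for j \<omega>
      using that by (intro sum.cong) auto
    have "prob ((\<lambda>\<omega>. (restrict (\<lambda>j. I j \<omega>) {..<i}, restrict (\<lambda>j. I j \<omega>) {i})) -` (P \<times> Q) \<inter> space M)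
        = prob ((\<lambda>\<omega>. restrict (\<lambda>j. I j \<omega>) {..<i}) -` P \<inter> space M) * prob ((\<lambda>\<omega>. restrict (\<lambda>j. I j \<omega>) {i}) -` Q \<inter> space M)"
      by (rule indep_varD[OF iv PQ])
    also have "(\<lambda>\<omega>. (restrict (\<lambda>j. I j \<omega>) {..<i}, restrict (\<lambda>j. I j \<omega>) {i})) -` (P \<times> Q) \<inter> space M = {\<omega>\<in>space M. (\<forall>j\<le>i. (\<Sum>l<j. I l \<omega>) \<in> B j) \<and> I i \<omega> \<in> C}"
      by (auto simp: P_def Q_def space_PiM R)
    also have "(\<lambda>\<omega>. restrict (\<lambda>j. I j \<omega>) {..<i}) -` P \<inter> space M = {\<omega>\<in>space M. \<forall>j\<le>i. (\<Sum>l<j. I l \<omega>) \<in> B j}"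
      by (auto simp: P_def space_PiM R)
    also have "(\<lambda>\<omega>. restrict (\<lambda>j. I j \<omega>) {i}) -` Q \<inter> space M = {\<omega>\<in>space M. X (real (i + k) * h) \<omega> - X (real i * h) \<omega> \<in> C}"
      by (auto simp: Q_def space_PiM Ii)
    finally show ?thesis unfolding E1 E2 stat .
  qed
qed

definition dyadic_above :: "nat \<Rightarrow> real \<Rightarrow> real" where
  "dyadic_above m t = of_int (\<lfloor>t * 2 ^ m\<rfloor> + 1) / 2 ^ m"

lemma dyadic_above_bounds: "t < dyadic_above m t" "dyadic_above m t \<le> t + (1/2) ^ m"
proof -
  have "t * 2 ^ m < of_int (\<lfloor>t * 2 ^ m\<rfloor> + 1)" "of_int (\<lfloor>t * 2 ^ m\<rfloor> + 1) \<le> t * 2 ^ m + 1"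
    by linarith+
  then show "t < dyadic_above m t" "dyadic_above m t \<le> t + (1/2) ^ m"
    by (simp_all add: dyadic_above_def field_simps)
qed

lemma filterlim_dyadic_above: "filterlim (\<lambda>m. dyadic_above m t) (at_right t) sequentially"
  unfolding filterlim_at
proof (intro conjI)
  show "(\<lambda>m. dyadic_above m t) \<longlonglongrightarrow> t"
  proof (rule tendsto_sandwich[where f = "\<lambda>_. t" and h = "\<lambda>m. t + (1/2) ^ m"])
    have "(\<lambda>m. t + (1/2) ^ m) \<longlonglongrightarrow> t + 0" by (intro tendsto_intros) auto
    then show "(\<lambda>m. t + (1/2) ^ m) \<longlonglongrightarrow> t" by simp
  qed (auto intro!: dyadic_above_bounds(2) less_imp_le[OF dyadic_above_bounds(1)] always_eventually)
qed (use dyadic_above_bounds in \<open>auto simp: less_imp_neq[symmetric]\<close>)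

locale regular_levy = prob_space M
  for M :: "'a measure" and Z :: "real \<Rightarrow> 'a \<Rightarrow> 'b::euclidean_space" and \<Phi> :: "'b \<Rightarrow> complex" +
  assumes measurable_Z[measurable]: "(\<lambda>(t, \<omega>). Z t \<omega>) \<in> borel_measurable (borel \<Otimes>\<^sub>M M)"
    and right_continuous: "\<And>\<omega> t. \<omega> \<in> space M \<Longrightarrow> t \<ge> 0 \<Longrightarrow> ((\<lambda>s. Z s \<omega>) \<longlongrightarrow> Z t \<omega>) (at_right t)"
    and stationary: "\<And>s t. s \<ge> 0 \<Longrightarrow> t \<ge> 0 \<Longrightarrow> distr M borel (\<lambda>\<omega>. Z (s + t) \<omega> - Z s \<omega>) = distr M borel (Z t)"
    and markov: "\<And>h B C i k. h > 0 \<Longrightarrow> (\<And>j. B j \<in> sets borel) \<Longrightarrow> C \<in> sets borel \<Longrightarrow>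
      prob {\<omega>\<in>space M. (\<forall>j\<le>i. Z (real j * h) \<omega> \<in> B j) \<and> Z (real (i + k) * h) \<omega> - Z (real i * h) \<omega> \<in> C}
       = prob {\<omega>\<in>space M. \<forall>j\<le>i. Z (real j * h) \<omega> \<in> B j} * prob {\<omega>\<in>space M. Z (real k * h) \<omega> \<in> C}"
    and exponent: "characteristic_exponent Z \<Phi>"

lemma (in prob_space) levy_process_regular_version:
  fixes X :: "real \<Rightarrow> 'a \<Rightarrow> 'b::euclidean_space"
  assumes X: "levy_process X" and \<Phi>: "characteristic_exponent X \<Phi>"
  obtains Z where "regular_levy M Z \<Phi>" "AE \<omega> in M. \<forall>t\<ge>0. Z t \<omega> = X t \<omega>"
proof -
  have "AE \<omega> in M. cadlag (\<lambda>t. X t \<omega>)" using X by (simp add: levy_process_def)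
  then obtain N where N: "{\<omega>\<in>space M. \<not> cadlag (\<lambda>t. X t \<omega>)} \<subseteq> N" "N \<in> null_sets M"
    by (auto elim!: AE_E simp: null_sets_def)
  then have [measurable]: "N \<in> sets M" by auto
  define Z where "Z t \<omega> = (if \<omega> \<in> N then 0 else X (max 0 t) \<omega>)" for t \<omega>
  have meas[measurable]: "Z t \<in> borel_measurable M" for t
  proof -
    have [measurable]: "X (max 0 t) \<in> borel_measurable M" by (rule levy_process_measurable[OF X]) simp
    show ?thesis unfolding Z_def by measurable
  qed
  have Xmeas: "X t \<in> borel_measurable M" if "t \<ge> 0" for t by (rule levy_process_measurable[OF X that])
  have eq: "AE \<omega> in M. \<forall>t\<ge>0. Z t \<omega> = X t \<omega>"
    using AE_not_in[OF N(2)] by eventually_elim (auto simp: Z_def)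
  then have eq': "AE \<omega> in M. Z t \<omega> = X t \<omega>" if "t \<ge> 0" for t
    by eventually_elim (use that in auto)
  have rc: "((\<lambda>s. Z s \<omega>) \<longlongrightarrow> Z t \<omega>) (at_right t)" if "\<omega> \<in> space M" "t \<ge> 0" for \<omega> t
  proof (cases "\<omega> \<in> N")
    case False
    then have "((\<lambda>s. X s \<omega>) \<longlongrightarrow> X t \<omega>) (at_right t)" using N(1) that by (auto simp: cadlag_def)
    moreover have "eventually (\<lambda>s. X s \<omega> = Z s \<omega>) (at_right t)"
      using that False by (auto simp: Z_def eventually_at_filter)
    ultimately show ?thesis using False that by (simp add: Z_def tendsto_cong)
  qed (simp add: Z_def)
  have "(\<lambda>(t, \<omega>). Z t \<omega>) \<in> borel_measurable (borel \<Otimes>\<^sub>M M)"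
  proof (rule borel_measurable_LIMSEQ_metric)
    show "(\<lambda>(t, \<omega>). Z (dyadic_above m (max 0 t)) \<omega>) \<in> borel_measurable (borel \<Otimes>\<^sub>M M)" for m
    proof -
      have "(\<lambda>x::real \<times> 'a. (\<lambda>j x. Z (of_int (j + 1) / 2 ^ m) (snd x)) (\<lfloor>max 0 (fst x) * 2 ^ m\<rfloor>) x) \<in> borel_measurable (borel \<Otimes>\<^sub>M M)"
        by (rule measurable_compose_countable[where g = "\<lambda>x. \<lfloor>max 0 (fst x) * 2 ^ m\<rfloor>"]) measurable
      then show ?thesis by (simp add: dyadic_above_def case_prod_beta')
    qed
    fix x assume "x \<in> space (borel \<Otimes>\<^sub>M M :: (real \<times> 'a) measure)"
    then have "snd x \<in> space M" by (auto simp: space_pair_measure)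
    then have "(\<lambda>m. Z (dyadic_above m (max 0 (fst x))) (snd x)) \<longlonglongrightarrow> Z (max 0 (fst x)) (snd x)"
      by (intro filterlim_compose[OF rc filterlim_dyadic_above]) auto
    moreover have "Z (max 0 (fst x)) = Z (fst x)" by (simp add: Z_def fun_eq_iff)
    ultimately show "(\<lambda>m. (\<lambda>(t, \<omega>). Z (dyadic_above m (max 0 t)) \<omega>) x) \<longlonglongrightarrow> (\<lambda>(t, \<omega>). Z t \<omega>) x"
      by (simp add: case_prod_beta')
  qed
  moreover have "distr M borel (\<lambda>\<omega>. Z (s + t) \<omega> - Z s \<omega>) = distr M borel (Z t)" if "s \<ge> 0" "t \<ge> 0" for s t
  proof -
    have "distr M borel (\<lambda>\<omega>. Z (s + t) \<omega> - Z s \<omega>) = distr M borel (\<lambda>\<omega>. X (s + t) \<omega> - X s \<omega>)"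
      using eq that by (intro distr_cong_AE borel_measurable_diff Xmeas meas) auto
    also have "\<dots> = distr M borel (X t)" by (rule levy_process_stationary[OF X that])
    also have "\<dots> = distr M borel (Z t)"
      using eq that by (intro distr_cong_AE Xmeas meas) auto
    finally show ?thesis .
  qed
  moreover have "prob {\<omega>\<in>space M. (\<forall>j\<le>i. Z (real j * h) \<omega> \<in> B j) \<and> Z (real (i + k) * h) \<omega> - Z (real i * h) \<omega> \<in> C}
       = prob {\<omega>\<in>space M. \<forall>j\<le>i. Z (real j * h) \<omega> \<in> B j} * prob {\<omega>\<in>space M. Z (real k * h) \<omega> \<in> C}"
    if h: "h > 0" and [measurable]: "\<And>j. B j \<in> sets borel" "C \<in> sets borel" for h B C i k
  proof -
    have [measurable]: "X (real j * h) \<in> borel_measurable M" for j using h by (intro Xmeas) auto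
    have "prob {\<omega>\<in>space M. (\<forall>j\<le>i. Z (real j * h) \<omega> \<in> B j) \<and> Z (real (i + k) * h) \<omega> - Z (real i * h) \<omega> \<in> C}
      = prob {\<omega>\<in>space M. (\<forall>j\<le>i. X (real j * h) \<omega> \<in> B j) \<and> X (real (i + k) * h) \<omega> - X (real i * h) \<omega> \<in> C}"
    proof (rule measure_eq_AE)
      show "AE \<omega> in M. (\<omega> \<in> {\<omega>\<in>space M. (\<forall>j\<le>i. Z (real j * h) \<omega> \<in> B j) \<and> Z (real (i + k) * h) \<omega> - Z (real i * h) \<omega> \<in> C})
        = (\<omega> \<in> {\<omega>\<in>space M. (\<forall>j\<le>i. X (real j * h) \<omega> \<in> B j) \<and> X (real (i + k) * h) \<omega> - X (real i * h) \<omega> \<in> C})"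
        using eq by eventually_elim (use h in simp)
    qed measurable
    moreover have "prob {\<omega>\<in>space M. \<forall>j\<le>i. Z (real j * h) \<omega> \<in> B j} = prob {\<omega>\<in>space M. \<forall>j\<le>i. X (real j * h) \<omega> \<in> B j}"
      using eq h by (intro measure_eq_AE) auto
    moreover have "prob {\<omega>\<in>space M. Z (real k * h) \<omega> \<in> C} = prob {\<omega>\<in>space M. X (real k * h) \<omega> \<in> C}"
      using eq h by (intro measure_eq_AE) auto
    ultimately show ?thesis using levy_process_markov[OF X h, of B C i k] by simp
  qed
  moreover have "characteristic_exponent Z \<Phi>"
    unfolding characteristic_exponent_def
  proof (intro allI impI)
    fix \<xi> and x :: real assume x: "x \<ge> 0"
    have [measurable]: "X x \<in> borel_measurable M" using x by (rule Xmeas)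
    have "expectation (\<lambda>\<omega>. iexp (\<xi> \<bullet> Z x \<omega>)) = expectation (\<lambda>\<omega>. iexp (\<xi> \<bullet> X x \<omega>))"
      using eq'[OF x] by (intro integral_cong_AE) auto
    then show "expectation (\<lambda>\<omega>. iexp (\<xi> \<bullet> Z x \<omega>)) = exp (- (of_real x * \<Phi> \<xi>))"
      using \<Phi> x by (simp add: characteristic_exponent_def)
  qed
  ultimately have "regular_levy M Z \<Phi>"
    using rc by (intro regular_levy.intro regular_levy_axioms.intro prob_space_axioms) auto
  then show ?thesis using eq that by blast
qed

section \<open>The resolvent\<close>

lemma LIMSEQ_exp_quotient:
  fixes z :: complex
  shows "(\<lambda>n. of_nat (Suc n) * (1 - exp (- (z / of_nat (Suc n))))) \<longlonglongrightarrow> z"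
proof -
  have "((\<lambda>w. exp (- (w * z))) has_field_derivative - z) (at 0)"
    by (auto intro!: derivative_eq_intros)
  then have "((\<lambda>w. (exp (- (w * z)) - 1) / w) \<longlongrightarrow> - z) (at 0)"
    by (simp add: has_field_derivative_iff)
  then have lim: "((\<lambda>w. - ((exp (- (w * z)) - 1) / w)) \<longlongrightarrow> - (- z)) (at 0)" by (rule tendsto_minus)
  have "filterlim (\<lambda>n. inverse (of_nat (Suc n)) :: complex) (at 0) sequentially"
    unfolding filterlim_at using LIMSEQ_Suc[OF lim_inverse_n] by (auto simp del: of_nat_Suc)
  from filterlim_compose[OF lim this] show ?thesis
    by (simp add: field_simps)
qed

definition exponent_index_fun :: "('b::euclidean_space \<Rightarrow> complex) \<Rightarrow> real \<Rightarrow> real" where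
  "exponent_index_fun \<Phi> r = (\<integral>\<xi>. Re (1 / (1 + \<Phi> (\<xi> /\<^sub>R r))) * cauchy_kernel \<xi> \<partial>lborel)"

definition exp_time :: "real measure" where
  "exp_time = density lborel (exponential_density 1)"

lemma prob_space_exp_time: "prob_space exp_time"
  unfolding exp_time_def by (rule prob_space_exponential_density) simp

lemma sets_exp_time [measurable_cong]: "sets exp_time = sets borel"
  by (simp add: exp_time_def)

lemma nn_integral_exp_time:
  assumes [measurable]: "f \<in> borel_measurable borel"
  shows "(\<integral>\<^sup>+t. f t \<partial>exp_time) = (\<integral>\<^sup>+t. ennreal (exp (- t)) * indicator {0..} t * f t \<partial>lborel)"
  unfolding exp_time_def
  by (subst nn_integral_density) (auto intro!: nn_integral_cong simp: exponential_density_def indicator_def)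

context regular_levy
begin

lemma Z_measurable [measurable]: "Z t \<in> borel_measurable M"
proof -
  have "(\<lambda>\<omega>. (\<lambda>(t, \<omega>). Z t \<omega>) (t, \<omega>)) \<in> borel_measurable M" by measurable
  then show ?thesis by simp
qed

lemma Z_measurable' [measurable (raw)]:
  assumes "f \<in> N \<rightarrow>\<^sub>M borel" "g \<in> N \<rightarrow>\<^sub>M M"
  shows "(\<lambda>x. Z (f x) (g x)) \<in> N \<rightarrow>\<^sub>M borel"
  using measurable_compose[OF measurable_Pair[OF assms] measurable_Z] by simp

lemma expectation_iexp: "t \<ge> 0 \<Longrightarrow> expectation (\<lambda>\<omega>. iexp (\<xi> \<bullet> Z t \<omega>)) = exp (- (of_real t * \<Phi> \<xi>))"
  using exponent by (simp add: characteristic_exponent_def)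

lemma Re_exponent_nonneg: "0 \<le> Re (\<Phi> \<xi>)"
proof -
  have "norm (expectation (\<lambda>\<omega>. iexp (\<xi> \<bullet> Z 1 \<omega>))) \<le> expectation (\<lambda>\<omega>. norm (iexp (\<xi> \<bullet> Z 1 \<omega>)))"
    by (rule integral_norm_bound)
  then have "norm (exp (- \<Phi> \<xi>)) \<le> 1" by (simp add: expectation_iexp prob_space)
  then show ?thesis by simp
qed

lemma borel_measurable_exponent [measurable]: "\<Phi> \<in> borel_measurable borel"
proof (rule borel_measurable_LIMSEQ_metric)
  show "(\<lambda>\<xi>. of_nat (Suc n) * (1 - expectation (\<lambda>\<omega>. iexp (\<xi> \<bullet> Z (1 / Suc n) \<omega>)))) \<in> borel_measurable borel" for n
    by measurable
  show "(\<lambda>n. of_nat (Suc n) * (1 - expectation (\<lambda>\<omega>. iexp (\<xi> \<bullet> Z (1 / Suc n) \<omega>)))) \<longlonglongrightarrow> \<Phi> \<xi>" for \<xi>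
    using LIMSEQ_exp_quotient[of "\<Phi> \<xi>"] by (simp add: expectation_iexp del: of_nat_Suc)
qed

definition resolvent :: "'b measure" where
  "resolvent = distr (exp_time \<Otimes>\<^sub>M M) borel (\<lambda>(t, \<omega>). Z t \<omega>)"

lemma sets_resolvent [measurable_cong, simp]: "sets resolvent = sets borel"
  by (simp add: resolvent_def)

sublocale ET: prob_space exp_time by (rule prob_space_exp_time)

sublocale ETM: pair_prob_space exp_time M ..

lemma prob_space_resolvent: "prob_space resolvent"
  unfolding resolvent_def by (rule ETM.prob_space_distr) measurable

lemma nn_integral_resolvent:
  assumes [measurable]: "f \<in> borel_measurable borel"
  shows "(\<integral>\<^sup>+x. f x \<partial>resolvent) = (\<integral>\<^sup>+t. (\<integral>\<^sup>+\<omega>. f (Z t \<omega>) \<partial>M) \<partial>exp_time)"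
  unfolding resolvent_def
  by (subst nn_integral_distr) (simp_all add: nn_integral_fst[symmetric])

lemma emeasure_resolvent:
  assumes [measurable]: "B \<in> sets borel"
  shows "emeasure resolvent B = (\<integral>\<^sup>+t. emeasure M {\<omega>\<in>space M. Z t \<omega> \<in> B} \<partial>exp_time)"
proof -
  have "emeasure resolvent B = (\<integral>\<^sup>+t. (\<integral>\<^sup>+\<omega>. indicator B (Z t \<omega>) \<partial>M) \<partial>exp_time)"
    using nn_integral_resolvent[of "indicator B"] by simp
  also have "(\<lambda>t. \<integral>\<^sup>+\<omega>. indicator B (Z t \<omega>) \<partial>M) = (\<lambda>t. emeasure M {\<omega>\<in>space M. Z t \<omega> \<in> B})"
  proof
    fix t
    have "(\<integral>\<^sup>+\<omega>. indicator B (Z t \<omega>) \<partial>M) = (\<integral>\<^sup>+\<omega>. indicator {\<omega>\<in>space M. Z t \<omega> \<in> B} \<omega> \<partial>M)"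
      by (intro nn_integral_cong) (auto simp: indicator_def)
    then show "(\<integral>\<^sup>+\<omega>. indicator B (Z t \<omega>) \<partial>M) = emeasure M {\<omega>\<in>space M. Z t \<omega> \<in> B}" by simp
  qed
  finally show ?thesis .
qed

lemma resolvent_fourier: "(\<integral>x. iexp (\<xi> \<bullet> x) \<partial>resolvent) = 1 / (1 + \<Phi> \<xi>)"
proof -
  have "(\<integral>x. iexp (\<xi> \<bullet> x) \<partial>resolvent) = (\<integral>p. iexp (\<xi> \<bullet> Z (fst p) (snd p)) \<partial>(exp_time \<Otimes>\<^sub>M M))"
    unfolding resolvent_def by (subst integral_distr) (auto simp: case_prod_beta')
  also have "\<dots> = (\<integral>t. expectation (\<lambda>\<omega>. iexp (\<xi> \<bullet> Z t \<omega>)) \<partial>exp_time)"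
    by (subst ETM.integral_fst'[symmetric]) (auto intro!: ETM.integrable_const_bound[of _ 1])
  also have "\<dots> = (\<integral>t. exponential_density 1 t *\<^sub>R expectation (\<lambda>\<omega>. iexp (\<xi> \<bullet> Z t \<omega>)) \<partial>lborel)"
    unfolding exp_time_def by (subst integral_density) (auto simp: exponential_density_nonneg)
  also have "\<dots> = (\<integral>t. indicator {0<..} t *\<^sub>R exp (- (of_real t * (1 + \<Phi> \<xi>))) \<partial>lborel)"
  proof (rule integral_cong_AE)
    have "AE t in lborel. t \<noteq> (0::real)" by (rule AE_lborel_singleton)
    then show "AE t in lborel. exponential_density 1 t *\<^sub>R expectation (\<lambda>\<omega>. iexp (\<xi> \<bullet> Z t \<omega>)) = indicator {0<..} t *\<^sub>R exp (- (of_real t * (1 + \<Phi> \<xi>)))"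
      by eventually_elim
        (auto simp: exponential_density_def expectation_iexp indicator_def ring_distribs exp_add exp_diff exp_minus exp_of_real scaleR_conv_of_real divide_inverse)
  qed measurable
  also have "\<dots> = 1 / (1 + \<Phi> \<xi>)"
    using Re_exponent_nonneg[of \<xi>] by (intro has_bochner_integral_integral_eq has_bochner_integral_exp_half_line) simp
  finally show ?thesis .
qed

lemma exponent_index_fun_resolvent:
  assumes r: "r > 0"
  shows "exponent_index_fun \<Phi> r = pi ^ DIM('b) * (\<integral>x. (\<Prod>b\<in>Basis. exp (- \<bar>x \<bullet> b\<bar> / r)) \<partial>resolvent)"
proof -
  interpret R: prob_space resolvent by (rule prob_space_resolvent)
  interpret LR: pair_sigma_finite "lborel :: 'b measure" resolvent ..
  define f where "f \<xi> x = of_real (cauchy_kernel \<xi>) * iexp ((\<xi> /\<^sub>R r) \<bullet> x)" for \<xi> x :: 'b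
  have f: "integrable (lborel \<Otimes>\<^sub>M resolvent) (case_prod f)"
  proof (rule LR.Fubini_integrable)
    show "case_prod f \<in> borel_measurable (lborel \<Otimes>\<^sub>M resolvent)" unfolding f_def by measurable
    show "integrable lborel (\<lambda>\<xi>. \<integral>x. norm (case (\<xi>, x) of (\<xi>, x) \<Rightarrow> f \<xi> x) \<partial>resolvent)"
      using integrable_cauchy_kernel by (simp add: f_def norm_mult cauchy_kernel_nonneg R.prob_space)
    show "AE \<xi> in lborel. integrable resolvent (\<lambda>x. case (\<xi>, x) of (\<xi>, x) \<Rightarrow> f \<xi> x)"
      by (auto simp: f_def intro!: AE_I2 integrable_mult_right R.integrable_const_bound[of _ 1])
  qed
  have inner1: "(\<integral>x. f \<xi> x \<partial>resolvent) = of_real (cauchy_kernel \<xi>) * (1 / (1 + \<Phi> (\<xi> /\<^sub>R r)))" for \<xi>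
    using resolvent_fourier[of "\<xi> /\<^sub>R r"] by (simp add: f_def)
  have inner2: "(\<integral>\<xi>. f \<xi> x \<partial>lborel) = of_real (pi ^ DIM('b) * (\<Prod>b\<in>Basis. exp (- \<bar>x \<bullet> b\<bar> / r)))" for x
  proof -
    have "f \<xi> x = of_real (cauchy_kernel \<xi>) * iexp (\<xi> \<bullet> (x /\<^sub>R r))" for \<xi> by (simp add: f_def)
    then show ?thesis
      using has_bochner_integral_integral_eq[OF has_bochner_integral_cauchy_kernel_fourier[of "x /\<^sub>R r"]] r
      by (simp add: abs_mult divide_inverse mult.commute)
  qed
  have "integrable lborel (\<lambda>\<xi>. \<integral>x. f \<xi> x \<partial>resolvent)" using LR.integrable_fst[OF f] .
  then have "complex_integrable lborel (\<lambda>\<xi>. of_real (cauchy_kernel \<xi>) * (1 / (1 + \<Phi> (\<xi> /\<^sub>R r))))"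
    by (simp add: inner1)
  then have "Re (\<integral>\<xi>. of_real (cauchy_kernel \<xi>) * (1 / (1 + \<Phi> (\<xi> /\<^sub>R r))) \<partial>lborel) = (\<integral>\<xi>. Re (of_real (cauchy_kernel \<xi>) * (1 / (1 + \<Phi> (\<xi> /\<^sub>R r)))) \<partial>lborel)"
    by (rule integral_Re[symmetric])
  also have "\<dots> = exponent_index_fun \<Phi> r"
  proof -
    have "Re (of_real c * w) = Re w * c" for c w by simp
    then show ?thesis unfolding exponent_index_fun_def by (intro Bochner_Integration.integral_cong refl)
  qed
  finally have "exponent_index_fun \<Phi> r = Re (\<integral>\<xi>. (\<integral>x. f \<xi> x \<partial>resolvent) \<partial>lborel)" by (simp add: inner1)
  also have "(\<integral>\<xi>. (\<integral>x. f \<xi> x \<partial>resolvent) \<partial>lborel) = (\<integral>x. (\<integral>\<xi>. f \<xi> x \<partial>lborel) \<partial>resolvent)"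
    by (rule LR.Fubini_integral[OF f, symmetric])
  also have "\<dots> = of_real (\<integral>x. pi ^ DIM('b) * (\<Prod>b\<in>Basis. exp (- \<bar>x \<bullet> b\<bar> / r)) \<partial>resolvent)"
    unfolding inner2 by (rule integral_complex_of_real)
  finally show ?thesis by simp
qed

end

section \<open>Neighbourhoods of the path\<close>

lemma exp_neg_powr_le_powr:
  fixes a b c :: real
  assumes "a < 0" "c > 0"
  shows "eventually (\<lambda>r. exp (- (r powr a)) \<le> c * r powr b) (at_right 0)"
proof -
  have "((\<lambda>r. exp (- (r powr a)) / r powr b) \<longlongrightarrow> 0) (at_right 0)"
    using assms by real_asymp
  then have "eventually (\<lambda>r. exp (- (r powr a)) / r powr b < c) (at_right 0)"
    using assms(2) by (rule order_tendstoD)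
  then show ?thesis
    using eventually_at_right_less[of "0::real"] by eventually_elim (simp add: pos_divide_less_eq)
qed

lemma suminf_shift_le_ennreal:
  fixes g :: "nat \<Rightarrow> ennreal"
  shows "(\<Sum>k. g (i + k)) \<le> (\<Sum>j. g j)"
  unfolding suminf_eq_SUP[of "\<lambda>k. g (i + k)"]
proof (rule SUP_least)
  fix n
  have "(\<Sum>k<n. g (i + k)) = sum g ((\<lambda>k. i + k) ` {..<n})" by (simp add: sum.reindex)
  also have "\<dots> \<le> (\<Sum>j. g j)" by (intro sum_le_suminf) auto
  finally show "(\<Sum>k<n. g (i + k)) \<le> (\<Sum>j. g j)" .
qed

lemma pred_in_ball [measurable (raw)]:
  fixes f :: "'a \<Rightarrow> 'b::euclidean_space"
  shows "f \<in> borel_measurable N \<Longrightarrow> Measurable.pred N (\<lambda>x. f x \<in> ball c \<rho>)"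
  unfolding mem_ball by measurable

context regular_levy
begin

lemma grid_hitting_bound:
  assumes h: "h > 0" and a: "real J * h \<le> a"
  shows "ennreal (exp (- a)) * emeasure M {\<omega>\<in>space M. \<exists>j\<le>J. Z (real j * h) \<omega> \<in> ball x r}
           * (\<Sum>k. ennreal (exp (- (real k * h))) * emeasure M {\<omega>\<in>space M. Z (real k * h) \<omega> \<in> ball 0 r})
       \<le> (\<Sum>j. ennreal (exp (- (real j * h))) * emeasure M {\<omega>\<in>space M. Z (real j * h) \<omega> \<in> ball x (2 * r)})"
proof -
  define F where "F i = {\<omega>\<in>space M. (\<forall>j<i. Z (real j * h) \<omega> \<notin> ball x r) \<and> Z (real i * h) \<omega> \<in> ball x r}" for i
  define G where "G j = {\<omega>\<in>space M. Z (real j * h) \<omega> \<in> ball x (2 * r)}" for j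
  define p where "p k = emeasure M {\<omega>\<in>space M. Z (real k * h) \<omega> \<in> ball 0 r}" for k
  define e where "e j = ennreal (exp (- (real j * h)))" for j
  have Fs[measurable]: "F i \<in> sets M" and Gs[measurable]: "G i \<in> sets M" for i
    unfolding F_def G_def mem_ball by measurable
  have disj: "disjoint_family F"
  proof -
    have "F i \<inter> F j = {}" if "i < j" for i j using that by (auto simp: F_def)
    then show ?thesis unfolding disjoint_family_on_def by (metis inf_commute linorder_neqE_nat)
  qed
  have union: "{\<omega>\<in>space M. \<exists>j\<le>J. Z (real j * h) \<omega> \<in> ball x r} = (\<Union>i\<le>J. F i)"
  proof (intro equalityI subsetI)
    fix \<omega> assume "\<omega> \<in> {\<omega>\<in>space M. \<exists>j\<le>J. Z (real j * h) \<omega> \<in> ball x r}"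
    then obtain j where j: "\<omega> \<in> space M" "j \<le> J" "Z (real j * h) \<omega> \<in> ball x r" by blast
    define i where "i = (LEAST j. Z (real j * h) \<omega> \<in> ball x r)"
    have "\<omega> \<in> F i"
      using LeastI[of "\<lambda>j. Z (real j * h) \<omega> \<in> ball x r", OF j(3)] not_less_Least[of _ "\<lambda>j. Z (real j * h) \<omega> \<in> ball x r"] j(1)
      unfolding F_def i_def by blast
    moreover have "i \<le> J" unfolding i_def using Least_le[of "\<lambda>j. Z (real j * h) \<omega> \<in> ball x r", OF j(3)] j(2) by simp
    ultimately show "\<omega> \<in> (\<Union>i\<le>J. F i)" by blast
  qed (auto simp: F_def)
  have step: "emeasure M (F i) * p k \<le> emeasure M (F i \<inter> G (i + k))" for i k
  proof -
    define B where "B j = (if j < i then - ball x r else ball x r)" for j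
    have F_alt: "F i = {\<omega>\<in>space M. \<forall>j\<le>i. Z (real j * h) \<omega> \<in> B j}"
      by (auto simp: F_def B_def le_less)
    have "prob {\<omega>\<in>space M. (\<forall>j\<le>i. Z (real j * h) \<omega> \<in> B j) \<and> Z (real (i + k) * h) \<omega> - Z (real i * h) \<omega> \<in> ball 0 r}
       = prob (F i) * prob {\<omega>\<in>space M. Z (real k * h) \<omega> \<in> ball 0 r}"
      unfolding F_alt by (rule markov[OF h]) (auto simp: B_def)
    then have "emeasure M (F i) * p k = emeasure M {\<omega>\<in>space M. (\<forall>j\<le>i. Z (real j * h) \<omega> \<in> B j) \<and> Z (real (i + k) * h) \<omega> - Z (real i * h) \<omega> \<in> ball 0 r}"
      by (simp add: p_def emeasure_eq_measure ennreal_mult')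
    also have "\<dots> \<le> emeasure M (F i \<inter> G (i + k))"
    proof (rule emeasure_mono, safe)
      fix \<omega> assume \<omega>: "\<omega> \<in> space M" "\<forall>j\<le>i. Z (real j * h) \<omega> \<in> B j" "Z (real (i + k) * h) \<omega> - Z (real i * h) \<omega> \<in> ball 0 r"
      then show "\<omega> \<in> F i" by (auto simp: F_alt)
      have "dist x (Z (real i * h) \<omega>) < r" using \<omega>(2) by (auto simp: B_def)
      moreover have "dist (Z (real i * h) \<omega>) (Z (real (i + k) * h) \<omega>) < r"
        using \<omega>(3) by (simp add: dist_norm norm_minus_commute)
      ultimately have "dist x (Z (real (i + k) * h) \<omega>) < 2 * r"
        using dist_triangle[of x "Z (real (i + k) * h) \<omega>" "Z (real i * h) \<omega>"] by simp
      then show "\<omega> \<in> G (i + k)" using \<omega>(1) by (simp add: G_def)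
    qed (intro sets.Int Fs Gs)
    finally show ?thesis .
  qed
  have each: "ennreal (exp (- a)) * emeasure M (F i) * (\<Sum>k. e k * p k) \<le> (\<Sum>j. e j * emeasure M (F i \<inter> G j))" if "i \<le> J" for i
  proof -
    have "ennreal (exp (- a)) \<le> e i"
    proof -
      have "real i * h \<le> real J * h" using that h by simp
      then show ?thesis using a by (auto simp: e_def intro!: ennreal_leI)
    qed
    then have "ennreal (exp (- a)) * emeasure M (F i) * (\<Sum>k. e k * p k) \<le> e i * emeasure M (F i) * (\<Sum>k. e k * p k)"
      by (intro mult_right_mono) auto
    also have "\<dots> = (\<Sum>k. (e i * e k) * (emeasure M (F i) * p k))"
      by (simp add: ennreal_suminf_cmult[symmetric] mult_ac)
    also have "\<dots> \<le> (\<Sum>k. e (i + k) * emeasure M (F i \<inter> G (i + k)))"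
    proof (intro suminf_le mult_mono step)
      show "e i * e k \<le> e (i + k)" for k
        by (simp add: e_def ennreal_mult'[symmetric] exp_add[symmetric] ring_distribs)
    qed auto
    also have "\<dots> \<le> (\<Sum>j. e j * emeasure M (F i \<inter> G j))" by (rule suminf_shift_le_ennreal)
    finally show ?thesis .
  qed
  have "ennreal (exp (- a)) * emeasure M (\<Union>i\<le>J. F i) * (\<Sum>k. e k * p k)
      = (\<Sum>i\<le>J. ennreal (exp (- a)) * emeasure M (F i) * (\<Sum>k. e k * p k))"
  proof -
    have "emeasure M (\<Union>i\<le>J. F i) = (\<Sum>i\<le>J. emeasure M (F i))"
      using disj by (intro sum_emeasure[symmetric]) (auto simp: disjoint_family_on_def)
    then show ?thesis by (simp add: sum_distrib_left sum_distrib_right)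
  qed
  also have "\<dots> \<le> (\<Sum>i\<le>J. \<Sum>j. e j * emeasure M (F i \<inter> G j))"
    by (intro sum_mono each) auto
  also have "\<dots> = (\<Sum>j. \<Sum>i\<le>J. e j * emeasure M (F i \<inter> G j))"
    by (intro suminf_sum[symmetric]) auto
  also have "\<dots> \<le> (\<Sum>j. e j * emeasure M (G j))"
  proof (intro suminf_le)
    fix j
    have "(\<Sum>i\<le>J. emeasure M (F i \<inter> G j)) = emeasure M (\<Union>i\<le>J. F i \<inter> G j)"
      using disj by (intro sum_emeasure) (auto simp: disjoint_family_on_def)
    also have "\<dots> \<le> emeasure M (G j)" by (intro emeasure_mono) auto
    finally show "(\<Sum>i\<le>J. e j * emeasure M (F i \<inter> G j)) \<le> e j * emeasure M (G j)"
      by (simp add: sum_distrib_left[symmetric] mult_left_mono)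
  qed auto
  finally show ?thesis unfolding union e_def p_def G_def .
qed

definition grid_sausage :: "nat \<Rightarrow> real \<Rightarrow> nat \<Rightarrow> 'a \<Rightarrow> 'b set" where
  "grid_sausage a r m \<omega> = (\<Union>j\<le>a * 2 ^ m. ball (Z (real j * (1/2) ^ m) \<omega>) r)"

lemma grid_sausage_bound:
  assumes r: "r > 0"
  shows "(\<integral>\<^sup>+\<omega>. emeasure lborel (grid_sausage a r m \<omega>) \<partial>M)
           * (\<Sum>k. ennreal (exp (- (real k * (1/2) ^ m))) * emeasure M {\<omega>\<in>space M. Z (real k * (1/2) ^ m) \<omega> \<in> ball 0 r})
       \<le> ennreal (exp (real a)) * emeasure lborel (ball (0 :: 'b) (2 * r)) * (\<Sum>j. ennreal (exp (- (real j * (1/2) ^ m))))"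
proof -
  define h :: real where "h = (1/2) ^ m"
  define S where "S = (\<Sum>k. ennreal (exp (- (real k * h))) * emeasure M {\<omega>\<in>space M. Z (real k * h) \<omega> \<in> ball 0 r})"
  define J where "J = a * 2 ^ m"
  have h: "h > 0" "real J * h \<le> real a" by (auto simp: h_def J_def power_one_over)
  have swap: "(\<integral>\<^sup>+\<omega>. emeasure lborel (\<Union>j\<in>K. ball (Z (t j) \<omega>) \<rho>) \<partial>M) = (\<integral>\<^sup>+x. emeasure M {\<omega>\<in>space M. \<exists>j\<in>K. Z (t j) \<omega> \<in> ball x \<rho>} \<partial>lborel)"
    if "finite K" for K :: "nat set" and t :: "nat \<Rightarrow> real" and \<rho>
  proof -
    interpret P: pair_sigma_finite "lborel :: 'b measure" M ..
    have "(\<integral>\<^sup>+\<omega>. emeasure lborel (\<Union>j\<in>K. ball (Z (t j) \<omega>) \<rho>) \<partial>M) = (\<integral>\<^sup>+\<omega>. (\<integral>\<^sup>+x. indicator {p. \<exists>j\<in>K. dist (Z (t j) (snd p)) (fst p) < \<rho>} (x, \<omega>) \<partial>lborel) \<partial>M)"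
    proof (intro nn_integral_cong)
      fix \<omega>
      have "emeasure lborel (\<Union>j\<in>K. ball (Z (t j) \<omega>) \<rho>) = (\<integral>\<^sup>+x. indicator (\<Union>j\<in>K. ball (Z (t j) \<omega>) \<rho>) x \<partial>lborel)"
        by (rule nn_integral_indicator[symmetric]) (auto intro!: borel_open)
      also have "\<dots> = (\<integral>\<^sup>+x. indicator {p. \<exists>j\<in>K. dist (Z (t j) (snd p)) (fst p) < \<rho>} (x, \<omega>) \<partial>lborel)"
        by (intro nn_integral_cong) (auto simp: indicator_def)
      finally show "emeasure lborel (\<Union>j\<in>K. ball (Z (t j) \<omega>) \<rho>) = (\<integral>\<^sup>+x. indicator {p. \<exists>j\<in>K. dist (Z (t j) (snd p)) (fst p) < \<rho>} (x, \<omega>) \<partial>lborel)" .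
    qed
    also have "\<dots> = (\<integral>\<^sup>+x. (\<integral>\<^sup>+\<omega>. indicator {p. \<exists>j\<in>K. dist (Z (t j) (snd p)) (fst p) < \<rho>} (x, \<omega>) \<partial>M) \<partial>lborel)"
    proof (rule P.Fubini')
      have "{p \<in> space (lborel \<Otimes>\<^sub>M M). \<exists>j\<in>K. dist (Z (t j) (snd p)) (fst p) < \<rho>} \<in> sets (lborel \<Otimes>\<^sub>M M)"
        using that by measurable
      then have "(indicator {p \<in> space (lborel \<Otimes>\<^sub>M M). \<exists>j\<in>K. dist (Z (t j) (snd p)) (fst p) < \<rho>} :: _ \<Rightarrow> ennreal) \<in> borel_measurable (lborel \<Otimes>\<^sub>M M)"
        by (rule borel_measurable_indicator)
      then show "(\<lambda>(x, \<omega>). indicator {p. \<exists>j\<in>K. dist (Z (t j) (snd p)) (fst p) < \<rho>} (x, \<omega>) :: ennreal) \<in> borel_measurable (lborel \<Otimes>\<^sub>M M)"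
        by (rule measurable_cong[THEN iffD1, rotated]) (auto simp: indicator_def)
    qed
    also have "\<dots> = (\<integral>\<^sup>+x. emeasure M {\<omega>\<in>space M. \<exists>j\<in>K. Z (t j) \<omega> \<in> ball x \<rho>} \<partial>lborel)"
    proof (intro nn_integral_cong)
      fix x :: 'b
      have "(\<integral>\<^sup>+\<omega>. indicator {p. \<exists>j\<in>K. dist (Z (t j) (snd p)) (fst p) < \<rho>} (x, \<omega>) \<partial>M) = (\<integral>\<^sup>+\<omega>. indicator {\<omega>\<in>space M. \<exists>j\<in>K. Z (t j) \<omega> \<in> ball x \<rho>} \<omega> \<partial>M)"
        by (intro nn_integral_cong) (auto simp: indicator_def dist_commute)
      also have "\<dots> = emeasure M {\<omega>\<in>space M. \<exists>j\<in>K. Z (t j) \<omega> \<in> ball x \<rho>}"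
      proof (rule nn_integral_indicator)
        have "{\<omega>\<in>space M. \<exists>j\<in>K. dist x (Z (t j) \<omega>) < \<rho>} \<in> sets M" using that by measurable
        then show "{\<omega>\<in>space M. \<exists>j\<in>K. Z (t j) \<omega> \<in> ball x \<rho>} \<in> sets M" by simp
      qed
      finally show "(\<integral>\<^sup>+\<omega>. indicator {p. \<exists>j\<in>K. dist (Z (t j) (snd p)) (fst p) < \<rho>} (x, \<omega>) \<partial>M) = emeasure M {\<omega>\<in>space M. \<exists>j\<in>K. Z (t j) \<omega> \<in> ball x \<rho>}" .
    qed
    finally show ?thesis .
  qed
  have meas: "(\<lambda>x. emeasure M {\<omega>\<in>space M. \<exists>j\<in>K. Z (t j) \<omega> \<in> ball x \<rho>}) \<in> borel_measurable borel"
    if "finite K" for K :: "nat set" and t :: "nat \<Rightarrow> real" and \<rho>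
  proof -
    have "(\<lambda>x::'b. emeasure M {\<omega>\<in>space M. \<exists>j\<in>K. dist x (Z (t j) \<omega>) < \<rho>}) \<in> borel_measurable borel"
      using that by measurable
    then show ?thesis by simp
  qed
  have "ennreal (exp (- real a)) * (\<integral>\<^sup>+\<omega>. emeasure lborel (grid_sausage a r m \<omega>) \<partial>M) * S
      = (\<integral>\<^sup>+x. ennreal (exp (- real a)) * emeasure M {\<omega>\<in>space M. \<exists>j\<le>J. Z (real j * h) \<omega> \<in> ball x r} * S \<partial>lborel)"
    unfolding grid_sausage_def swap[OF finite_atMost] J_def[symmetric] h_def[symmetric]
    using meas[OF finite_atMost[of J], of "\<lambda>j. real j * h" r]
    by (subst nn_integral_multc, simp, subst nn_integral_cmult) (auto simp: Bex_def)
  also have "\<dots> \<le> (\<integral>\<^sup>+x. (\<Sum>j. ennreal (exp (- (real j * h))) * emeasure M {\<omega>\<in>space M. Z (real j * h) \<omega> \<in> ball x (2 * r)}) \<partial>lborel)"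
    unfolding S_def by (intro nn_integral_mono grid_hitting_bound h)
  also have "\<dots> = (\<Sum>j. ennreal (exp (- (real j * h))) * (\<integral>\<^sup>+x. emeasure M {\<omega>\<in>space M. Z (real j * h) \<omega> \<in> ball x (2 * r)} \<partial>lborel))"
    using meas[of "{_}"] by (subst nn_integral_suminf) (auto simp: nn_integral_cmult)
  also have "(\<lambda>j. \<integral>\<^sup>+x. emeasure M {\<omega>\<in>space M. Z (real j * h) \<omega> \<in> ball x (2 * r)} \<partial>lborel) = (\<lambda>j. emeasure lborel (ball (0 :: 'b) (2 * r)))"
  proof
    fix j
    have "(\<integral>\<^sup>+x. emeasure M {\<omega>\<in>space M. Z (real j * h) \<omega> \<in> ball x (2 * r)} \<partial>lborel) = (\<integral>\<^sup>+\<omega>. emeasure lborel (ball (Z (real j * h) \<omega>) (2 * r)) \<partial>M)"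
      using swap[of "{j}" "\<lambda>j. real j * h" "2 * r"] by simp
    also have "\<dots> = emeasure lborel (ball (0 :: 'b) (2 * r))"
      using r by (simp add: emeasure_ball emeasure_space_1)
    finally show "(\<integral>\<^sup>+x. emeasure M {\<omega>\<in>space M. Z (real j * h) \<omega> \<in> ball x (2 * r)} \<partial>lborel) = emeasure lborel (ball (0 :: 'b) (2 * r))" .
  qed
  also have "(\<Sum>j. ennreal (exp (- (real j * h))) * emeasure lborel (ball (0 :: 'b) (2 * r))) = emeasure lborel (ball (0 :: 'b) (2 * r)) * (\<Sum>j. ennreal (exp (- (real j * h))))"
    by (simp add: mult.commute)
  finally have "ennreal (exp (real a)) * (ennreal (exp (- real a)) * (\<integral>\<^sup>+\<omega>. emeasure lborel (grid_sausage a r m \<omega>) \<partial>M) * S)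
      \<le> ennreal (exp (real a)) * (emeasure lborel (ball (0 :: 'b) (2 * r)) * (\<Sum>j. ennreal (exp (- (real j * h)))))"
    by (rule mult_left_mono) simp
  moreover have "ennreal (exp (real a)) * ennreal (exp (- real a)) = 1"
    by (simp add: ennreal_mult'[symmetric] exp_minus)
  ultimately show ?thesis
    by (simp add: mult.assoc[symmetric] S_def h_def)
qed

lemma resolvent_ball_le_grid:
  assumes m: "\<And>m. c m = (\<Sum>k. ennreal (exp (- (real k * (1/2) ^ m))) * emeasure M {\<omega>\<in>space M. Z (real k * (1/2) ^ m) \<omega> \<in> ball 0 r})"
  shows "emeasure resolvent (ball 0 r) \<le> liminf (\<lambda>m. ennreal (exp 1 * (1/2) ^ m) * c m)"
proof -
  define f :: "nat \<Rightarrow> real \<Rightarrow> ennreal" where "f m t = emeasure M {\<omega>\<in>space M. Z (dyadic_above m t) \<omega> \<in> ball 0 r}" for m t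
  have [measurable]: "dyadic_above m \<in> borel_measurable borel" for m
    unfolding dyadic_above_def by measurable
  have bound: "(\<integral>\<^sup>+t. f m t \<partial>exp_time) \<le> ennreal (exp 1 * (1/2) ^ m) * c m" for m
  proof -
    define h :: real where "h = (1/2) ^ m"
    have h: "0 < h" "h \<le> 1" by (auto simp: h_def power_le_one)
    have hh: "h * 2 ^ m = 1" by (simp add: h_def power_one_over)
    define p where "p k = emeasure M {\<omega>\<in>space M. Z (real k * h) \<omega> \<in> ball 0 r}" for k
    have fm[measurable]: "f m \<in> borel_measurable borel"
      unfolding f_def mem_ball by measurable
    have "(\<integral>\<^sup>+t. f m t \<partial>exp_time) = (\<integral>\<^sup>+t. ennreal (exp (- t)) * indicator {0..} t * f m t \<partial>lborel)"
      by (rule nn_integral_exp_time) measurable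
    also have "\<dots> \<le> (\<integral>\<^sup>+t. (\<Sum>k. indicator {real k * h..real (Suc k) * h} t * (ennreal (exp (- (real k * h))) * p (Suc k))) \<partial>lborel)"
    proof (rule nn_integral_mono)
      fix t :: real
      show "ennreal (exp (- t)) * indicator {0..} t * f m t \<le> (\<Sum>k. indicator {real k * h..real (Suc k) * h} t * (ennreal (exp (- (real k * h))) * p (Suc k)))"
      proof (cases "t \<ge> 0")
        case True
        define k where "k = nat \<lfloor>t * 2 ^ m\<rfloor>"
        have k: "real k \<le> t * 2 ^ m" "t * 2 ^ m \<le> real (Suc k)" "dyadic_above m t = real (Suc k) * h"
          using True unfolding k_def dyadic_above_def h_def by (simp_all add: power_one_over field_simps) linarith+
        have "t * 2 ^ m * h = t" using hh by (simp add: mult.assoc mult.commute[of _ h])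
        moreover have "real k * h \<le> t * 2 ^ m * h" "t * 2 ^ m * h \<le> real (Suc k) * h"
          using k h by (auto intro!: mult_right_mono)
        ultimately have kt: "real k * h \<le> t" "t \<le> real (Suc k) * h" by linarith+
        have "ennreal (exp (- t)) * indicator {0..} t * f m t \<le> ennreal (exp (- (real k * h))) * p (Suc k)"
          using True kt k(3) unfolding f_def p_def by (auto intro!: mult_mono ennreal_leI)
        also have "\<dots> = (\<Sum>k\<in>{k}. indicator {real k * h..real (Suc k) * h} t * (ennreal (exp (- (real k * h))) * p (Suc k)))"
          using kt by simp
        also have "\<dots> \<le> (\<Sum>k. indicator {real k * h..real (Suc k) * h} t * (ennreal (exp (- (real k * h))) * p (Suc k)))"
          by (intro sum_le_suminf) auto
        finally show ?thesis .
      qed simp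
    qed
    also have "\<dots> = (\<Sum>k. ennreal h * (ennreal (exp (- (real k * h))) * p (Suc k)))"
      using h by (subst nn_integral_suminf) (auto simp: nn_integral_multc ring_distribs)
    also have "\<dots> \<le> (\<Sum>k. ennreal (exp 1 * h) * (ennreal (exp (- (real (1 + k) * h))) * p (1 + k)))"
    proof (intro suminf_le)
      fix k
      have "h * exp (- (real k * h)) \<le> exp 1 * h * exp (- (real (1 + k) * h))"
        using h by (simp add: ring_distribs exp_add[symmetric] exp_minus[symmetric] mult.commute[of _ h] mult.assoc)
      then have "ennreal (h * exp (- (real k * h))) * p (Suc k) \<le> ennreal (exp 1 * h * exp (- (real (1 + k) * h))) * p (Suc k)"
        by (intro mult_right_mono ennreal_leI) auto
      then show "ennreal h * (ennreal (exp (- (real k * h))) * p (Suc k)) \<le> ennreal (exp 1 * h) * (ennreal (exp (- (real (1 + k) * h))) * p (1 + k))"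
        using h by (simp add: ennreal_mult' mult.assoc)
    qed auto
    also have "\<dots> = ennreal (exp 1 * h) * (\<Sum>k. ennreal (exp (- (real (1 + k) * h))) * p (1 + k))"
      by (rule ennreal_suminf_cmult)
    also have "\<dots> \<le> ennreal (exp 1 * h) * c m"
      unfolding m h_def[symmetric] p_def[symmetric]
      by (intro mult_left_mono suminf_shift_le_ennreal[where g = "\<lambda>k. ennreal (exp (- (real k * h))) * p k"]) auto
    finally show ?thesis by (simp add: h_def)
  qed
  have "emeasure resolvent (ball 0 r) = (\<integral>\<^sup>+t. (\<integral>\<^sup>+\<omega>. indicator (ball 0 r) (Z t \<omega>) \<partial>M) \<partial>exp_time)"
  proof -
    have "(indicator (ball 0 r) :: 'b \<Rightarrow> ennreal) \<in> borel_measurable borel"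
      by (rule borel_measurable_indicator) simp
    from nn_integral_resolvent[OF this] show ?thesis by simp
  qed
  also have "\<dots> \<le> (\<integral>\<^sup>+t. liminf (\<lambda>m. f m t) \<partial>exp_time)"
  proof (rule nn_integral_mono_AE)
    have "AE t in exp_time. 0 \<le> t"
      unfolding exp_time_def by (subst AE_density) (auto simp: exponential_density_def not_less)
    then show "AE t in exp_time. (\<integral>\<^sup>+\<omega>. indicator (ball 0 r) (Z t \<omega>) \<partial>M) \<le> liminf (\<lambda>m. f m t)"
    proof eventually_elim
      fix t :: real assume t: "0 \<le> t"
      have "(\<integral>\<^sup>+\<omega>. indicator (ball 0 r) (Z t \<omega>) \<partial>M) \<le> (\<integral>\<^sup>+\<omega>. liminf (\<lambda>m. indicator (ball 0 r) (Z (dyadic_above m t) \<omega>)) \<partial>M)"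
      proof (rule nn_integral_mono)
        fix \<omega> assume \<omega>: "\<omega> \<in> space M"
        show "(indicator (ball 0 r) (Z t \<omega>) :: ennreal) \<le> liminf (\<lambda>m. indicator (ball 0 r) (Z (dyadic_above m t) \<omega>))"
        proof (cases "Z t \<omega> \<in> ball 0 r")
          case True
          have "eventually (\<lambda>m. Z (dyadic_above m t) \<omega> \<in> ball 0 r) sequentially"
            using filterlim_compose[OF right_continuous[OF \<omega> t] filterlim_dyadic_above] open_ball True
            by (rule topological_tendstoD)
          then have "1 \<le> liminf (\<lambda>m. indicator (ball 0 r) (Z (dyadic_above m t) \<omega>) :: ennreal)"
            by (intro Liminf_bounded) (auto elim: eventually_mono)
          then show ?thesis using True by simp
        qed simp
      qed
      also have "\<dots> \<le> liminf (\<lambda>m. \<integral>\<^sup>+\<omega>. indicator (ball 0 r) (Z (dyadic_above m t) \<omega>) \<partial>M)"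
        by (intro nn_integral_liminf) measurable
      also have "(\<lambda>m. \<integral>\<^sup>+\<omega>. indicator (ball 0 r) (Z (dyadic_above m t) \<omega>) \<partial>M) = (\<lambda>m. f m t)"
      proof
        fix m
        have "(\<integral>\<^sup>+\<omega>. indicator (ball 0 r) (Z (dyadic_above m t) \<omega>) \<partial>M) = (\<integral>\<^sup>+\<omega>. indicator {\<omega>\<in>space M. Z (dyadic_above m t) \<omega> \<in> ball 0 r} \<omega> \<partial>M)"
          by (intro nn_integral_cong) (auto simp: indicator_def)
        moreover have "{\<omega>\<in>space M. Z (dyadic_above m t) \<omega> \<in> ball 0 r} \<in> sets M" unfolding mem_ball by measurable
        ultimately show "(\<integral>\<^sup>+\<omega>. indicator (ball 0 r) (Z (dyadic_above m t) \<omega>) \<partial>M) = f m t"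
          by (simp add: f_def)
      qed
      finally show "(\<integral>\<^sup>+\<omega>. indicator (ball 0 r) (Z t \<omega>) \<partial>M) \<le> liminf (\<lambda>m. f m t)" .
    qed
  qed
  also have "\<dots> \<le> liminf (\<lambda>m. \<integral>\<^sup>+t. f m t \<partial>exp_time)"
    unfolding f_def mem_ball by (intro nn_integral_liminf) measurable
  also have "\<dots> \<le> liminf (\<lambda>m. ennreal (exp 1 * (1/2) ^ m) * c m)"
    by (intro Liminf_mono always_eventually allI bound)
  finally show ?thesis .
qed

definition sausage :: "nat \<Rightarrow> real \<Rightarrow> 'a \<Rightarrow> 'b set" where
  "sausage a r \<omega> = (\<Union>m. grid_sausage a r m \<omega>)"

lemma grid_sausage_mono: "m \<le> m' \<Longrightarrow> grid_sausage a r m \<omega> \<subseteq> grid_sausage a r m' \<omega>"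
proof (induction m' rule: dec_induct)
  case (step m')
  have "grid_sausage a r m' \<omega> \<subseteq> grid_sausage a r (Suc m') \<omega>"
    unfolding grid_sausage_def
  proof (rule UN_least)
    fix j assume j: "j \<in> {..a * 2 ^ m'}"
    have "real j * (1/2) ^ m' = real (2 * j) * (1/2) ^ Suc m'" by simp
    moreover have "2 * j \<in> {..a * 2 ^ Suc m'}" using j by simp
    ultimately show "ball (Z (real j * (1/2) ^ m') \<omega>) r \<subseteq> (\<Union>j\<le>a * 2 ^ Suc m'. ball (Z (real j * (1/2) ^ Suc m') \<omega>) r)"
      by (metis (no_types, lifting) UN_upper)
  qed
  then show ?case using step by blast
qed simp

lemma open_grid_sausage: "open (grid_sausage a r m \<omega>)"
  by (auto simp: grid_sausage_def)

lemma emeasure_grid_sausage_measurable: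
  "(\<lambda>\<omega>. emeasure lborel (grid_sausage a r m \<omega>)) \<in> borel_measurable M"
proof -
  have eq: "emeasure lborel (grid_sausage a r m \<omega>) = (\<integral>\<^sup>+x. (if \<exists>j\<in>{..a * 2 ^ m}. dist (Z (real j * (1/2) ^ m) \<omega>) x < r then 1 else 0) \<partial>lborel)" for \<omega>
  proof -
    have "emeasure lborel (grid_sausage a r m \<omega>) = (\<integral>\<^sup>+x. indicator (grid_sausage a r m \<omega>) x \<partial>lborel)"
      by (rule nn_integral_indicator[symmetric]) (use open_grid_sausage in auto)
    also have "\<dots> = (\<integral>\<^sup>+x. (if \<exists>j\<in>{..a * 2 ^ m}. dist (Z (real j * (1/2) ^ m) \<omega>) x < r then 1 else 0) \<partial>lborel)"
      by (intro nn_integral_cong) (auto simp: indicator_def grid_sausage_def)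
    finally show ?thesis .
  qed
  show ?thesis unfolding eq by measurable
qed

lemma emeasure_sausage: "emeasure lborel (sausage a r \<omega>) = (SUP m. emeasure lborel (grid_sausage a r m \<omega>))"
  unfolding sausage_def
  by (rule SUP_emeasure_incseq[symmetric]) (use open_grid_sausage grid_sausage_mono in \<open>auto simp: incseq_def\<close>)

lemma sausage_expectation:
  assumes r: "r > 0"
  shows "(\<integral>\<^sup>+\<omega>. emeasure lborel (sausage a r \<omega>) \<partial>M) * emeasure resolvent (ball 0 r)
     \<le> ennreal (exp (real a + 2)) * emeasure lborel (ball (0 :: 'b) (2 * r))"
proof -
  define c where "c m = (\<Sum>k. ennreal (exp (- (real k * (1/2) ^ m))) * emeasure M {\<omega>\<in>space M. Z (real k * (1/2) ^ m) \<omega> \<in> ball 0 r})" for m :: nat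
  define V where "V m = (\<integral>\<^sup>+\<omega>. emeasure lborel (grid_sausage a r m \<omega>) \<partial>M)" for m
  define R where "R = ennreal (exp (real a + 2)) * emeasure lborel (ball (0 :: 'b) (2 * r))"
  have geo: "ennreal (exp 1 * (1/2) ^ m) * (\<Sum>j. ennreal (exp (- (real j * (1/2) ^ m)))) \<le> ennreal (exp 2)" for m :: nat
  proof -
    define h :: real where "h = (1/2) ^ m"
    have h: "0 < h" "h \<le> 1" by (auto simp: h_def power_le_one)
    have eh: "0 < exp (- h)" "exp (- h) < 1" using h by auto
    have pow: "exp (- (real j * h)) = exp (- h) ^ j" for j
      by (simp add: exp_of_nat_mult[symmetric])
    have "(\<Sum>j. ennreal (exp (- (real j * h)))) = ennreal (\<Sum>j. exp (- h) ^ j)"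
      unfolding pow using eh by (intro suminf_ennreal2) (auto intro!: summable_geometric)
    also have "(\<Sum>j. exp (- h) ^ j) = 1 / (1 - exp (- h))"
      using eh by (intro suminf_geometric) auto
    finally have "ennreal (exp 1 * h) * (\<Sum>j. ennreal (exp (- (real j * h)))) = ennreal (exp 1 * h) * ennreal (1 / (1 - exp (- h)))"
      by (rule arg_cong)
    also have "\<dots> = ennreal (exp 1 * h * (1 / (1 - exp (- h))))"
      using h eh by (intro ennreal_mult[symmetric]) auto
    also have "exp 1 * h * (1 / (1 - exp (- h))) = exp 1 * (h / (1 - exp (- h)))" by simp
    also have "\<dots> \<le> ennreal (exp 2)"
    proof (rule ennreal_leI)
      have "1 + h \<le> exp h" by (rule exp_ge_add_one_self)
      then have "h * exp (- h) \<le> 1 - exp (- h)"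
        using mult_right_mono[of "1 + h" "exp h" "exp (- h)"] by (simp add: ring_distribs exp_add[symmetric])
      then have "h / (1 - exp (- h)) \<le> exp h"
      proof -
        have "h = exp h * (h * exp (- h))" by (simp add: exp_minus)
        also have "\<dots> \<le> exp h * (1 - exp (- h))" using \<open>h * exp (- h) \<le> 1 - exp (- h)\<close> by (intro mult_left_mono) auto
        finally show ?thesis using eh by (simp add: pos_divide_le_eq)
      qed
      also have "exp h \<le> exp 1" using h by simp
      finally have "exp 1 * (h / (1 - exp (- h))) \<le> exp 1 * exp 1" by (intro mult_left_mono) auto
      then show "exp 1 * (h / (1 - exp (- h))) \<le> exp 2" by (simp add: exp_add[symmetric])
    qed
    finally show ?thesis by (simp add: h_def)
  qed
  have "V m0 * emeasure resolvent (ball 0 r) \<le> R" for m0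
  proof -
    have "V m0 * emeasure resolvent (ball 0 r) \<le> V m0 * liminf (\<lambda>m. ennreal (exp 1 * (1/2) ^ m) * c m)"
      by (intro mult_left_mono resolvent_ball_le_grid c_def) auto
    also have "\<dots> = (SUP n. V m0 * (INF m\<in>{n..}. ennreal (exp 1 * (1/2) ^ m) * c m))"
      by (simp add: liminf_SUP_INF SUP_mult_left_ennreal)
    also have "\<dots> \<le> R"
    proof (rule SUP_least)
      have le: "V m0 * (ennreal (exp 1 * (1/2) ^ m) * c m) \<le> R" if "m0 \<le> m" for m
      proof -
        have "V m0 \<le> V m"
          unfolding V_def by (intro nn_integral_mono emeasure_mono grid_sausage_mono that) (use open_grid_sausage in auto)
        then have "V m0 * (ennreal (exp 1 * (1/2) ^ m) * c m) \<le> ennreal (exp 1 * (1/2) ^ m) * (V m * c m)"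
          by (simp add: mult_mono mult.left_commute)
        also have "\<dots> \<le> ennreal (exp 1 * (1/2) ^ m) * (ennreal (exp (real a)) * emeasure lborel (ball (0 :: 'b) (2 * r)) * (\<Sum>j. ennreal (exp (- (real j * (1/2) ^ m)))))"
          unfolding V_def c_def by (intro mult_left_mono grid_sausage_bound r) auto
        also have "\<dots> = ennreal (exp (real a)) * emeasure lborel (ball (0 :: 'b) (2 * r)) * (ennreal (exp 1 * (1/2) ^ m) * (\<Sum>j. ennreal (exp (- (real j * (1/2) ^ m)))))"
          by (simp only: mult_ac)
        also have "\<dots> \<le> ennreal (exp (real a)) * emeasure lborel (ball (0 :: 'b) (2 * r)) * ennreal (exp 2)"
          by (intro mult_left_mono geo) auto
        also have "\<dots> = R"
          by (simp add: R_def exp_add ennreal_mult' mult_ac)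
        finally show ?thesis .
      qed
      fix n
      have "V m0 * (INF m\<in>{n..}. ennreal (exp 1 * (1/2) ^ m) * c m) \<le> V m0 * (ennreal (exp 1 * (1/2) ^ max n m0) * c (max n m0))"
        by (intro mult_left_mono INF_lower) auto
      also have "\<dots> \<le> R" by (rule le) simp
      finally show "V m0 * (INF m\<in>{n..}. ennreal (exp 1 * (1/2) ^ m) * c m) \<le> R" .
    qed
    finally show ?thesis .
  qed
  then have "(SUP m. V m) * emeasure resolvent (ball 0 r) \<le> R"
    by (simp add: SUP_mult_right_ennreal SUP_least)
  moreover have "(\<integral>\<^sup>+\<omega>. emeasure lborel (sausage a r \<omega>) \<partial>M) = (SUP m. V m)"
    unfolding emeasure_sausage V_def
  proof (rule nn_integral_monotone_convergence_SUP)
    show "incseq (\<lambda>m \<omega>. emeasure lborel (grid_sausage a r m \<omega>))"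
      unfolding incseq_def le_fun_def
      by (intro allI impI emeasure_mono grid_sausage_mono) (use open_grid_sausage in auto)
  qed (rule emeasure_grid_sausage_measurable)
  ultimately show ?thesis by (simp add: R_def)
qed

lemma sausage_superset:
  assumes \<omega>: "\<omega> \<in> space M"
  shows "(\<Union>x\<in>(\<lambda>t. Z t \<omega>) ` {0..<real a}. ball x r) \<subseteq> sausage a r \<omega>"
proof clarify
  fix y t assume t: "t \<in> {0..<real a}" and y: "y \<in> ball (Z t \<omega>) r"
  have "eventually (\<lambda>m. Z (dyadic_above m t) \<omega> \<in> ball y r) sequentially"
    using filterlim_compose[OF right_continuous[OF \<omega>] filterlim_dyadic_above] open_ball
    by (rule topological_tendstoD) (use t y in \<open>auto simp: dist_commute\<close>)
  then obtain m where m: "Z (dyadic_above m t) \<omega> \<in> ball y r"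
    by (auto simp: eventually_sequentially)
  define j where "j = nat (\<lfloor>t * 2 ^ m\<rfloor> + 1)"
  have "dyadic_above m t = real j * (1/2) ^ m"
    using t unfolding dyadic_above_def j_def by (simp add: power_one_over field_simps)
  moreover have "j \<le> a * 2 ^ m"
  proof -
    have "t * 2 ^ m < real (a * 2 ^ m)" using t by simp
    then have "\<lfloor>t * 2 ^ m\<rfloor> < int (a * 2 ^ m)" by linarith
    then show ?thesis unfolding j_def by linarith
  qed
  ultimately have "y \<in> grid_sausage a r m \<omega>"
    using m by (auto simp: grid_sausage_def dist_commute intro!: bexI[of _ j])
  then show "y \<in> sausage a r \<omega>" by (auto simp: sausage_def)
qed

lemma exponent_index_fun_le_ball:
  assumes u: "u > 0"
  shows "exponent_index_fun \<Phi> u \<le> pi ^ DIM('b) * (measure resolvent (ball 0 r) + exp (- (r / u)))"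
proof -
  interpret R: prob_space resolvent by (rule prob_space_resolvent)
  have "(\<integral>x. (\<Prod>b\<in>Basis. exp (- \<bar>x \<bullet> b\<bar> / u)) \<partial>resolvent) \<le> (\<integral>x. indicator (ball 0 r) x + exp (- (r / u)) \<partial>resolvent)"
  proof (rule integral_mono)
    show "integrable resolvent (\<lambda>x. \<Prod>b\<in>Basis. exp (- \<bar>x \<bullet> b\<bar> / u))"
      using u by (intro R.integrable_const_bound[of _ 1] AE_I2) (auto simp: abs_prod intro!: prod_le_1)
    show "integrable resolvent (\<lambda>x. indicator (ball 0 r) x + exp (- (r / u)))"
      by (intro Bochner_Integration.integrable_add R.integrable_const integrable_real_indicator) (auto simp: R.emeasure_eq_measure)
    fix x :: 'b
    have e: "(\<Prod>b\<in>Basis. exp (- \<bar>x \<bullet> b\<bar> / u)) = exp (- ((\<Sum>b\<in>Basis. \<bar>x \<bullet> b\<bar>) / u))"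
      by (simp add: exp_sum[symmetric] sum_negf sum_divide_distrib)
    show "(\<Prod>b\<in>Basis. exp (- \<bar>x \<bullet> b\<bar> / u)) \<le> indicator (ball 0 r) x + exp (- (r / u))"
    proof (cases "x \<in> ball 0 r")
      case True
      have "(\<Prod>b\<in>Basis. exp (- \<bar>x \<bullet> b\<bar> / u)) \<le> 1"
        unfolding e using u by (simp add: sum_nonneg)
      then show ?thesis using True by (simp add: add_increasing2)
    next
      case False
      then have "r \<le> (\<Sum>b\<in>Basis. \<bar>x \<bullet> b\<bar>)" using norm_le_l1[of x] by simp
      then have "r / u \<le> (\<Sum>b\<in>Basis. \<bar>x \<bullet> b\<bar>) / u" using u by (simp add: divide_right_mono)
      then show ?thesis using False unfolding e by simp
    qed
  qed
  also have "\<dots> = measure resolvent (ball 0 r) + exp (- (r / u))"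
    by (subst Bochner_Integration.integral_add) (auto simp: R.prob_space R.emeasure_eq_measure intro!: integrable_real_indicator)
  finally show ?thesis by (simp add: exponent_index_fun_resolvent[OF u] mult_left_mono)
qed

lemma ball_le_exponent_index_fun:
  assumes r: "r > 0"
  shows "measure resolvent (cball 0 r) \<le> exp DIM('b) / pi ^ DIM('b) * exponent_index_fun \<Phi> r"
proof -
  interpret R: prob_space resolvent by (rule prob_space_resolvent)
  have "(\<integral>x. exp (- DIM('b)) * indicator (cball 0 r) x \<partial>resolvent) \<le> (\<integral>x. (\<Prod>b\<in>Basis. exp (- \<bar>x \<bullet> b\<bar> / r)) \<partial>resolvent)"
  proof (rule integral_mono)
    show "integrable resolvent (\<lambda>x. \<Prod>b\<in>Basis. exp (- \<bar>x \<bullet> b\<bar> / r))"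
      using r by (intro R.integrable_const_bound[of _ 1] AE_I2) (auto simp: abs_prod intro!: prod_le_1)
    show "integrable resolvent (\<lambda>x. exp (- DIM('b)) * indicator (cball 0 r) x)"
      by (intro integrable_mult_right integrable_real_indicator) (auto simp: R.emeasure_eq_measure)
    fix x :: 'b
    show "exp (- DIM('b)) * indicator (cball 0 r) x \<le> (\<Prod>b\<in>Basis. exp (- \<bar>x \<bullet> b\<bar> / r))"
    proof (cases "x \<in> cball 0 r")
      case True
      have "(\<Prod>b\<in>(Basis :: 'b set). exp (- 1)) \<le> (\<Prod>b\<in>Basis. exp (- \<bar>x \<bullet> b\<bar> / r))"
        using r True by (intro prod_mono) (auto simp: divide_le_eq intro: order_trans[OF Basis_le_norm])
      then show ?thesis using True by (simp add: exp_of_nat_mult[symmetric])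
    qed (auto intro!: prod_nonneg)
  qed
  then have "exp (- DIM('b)) * measure resolvent (cball 0 r) \<le> exponent_index_fun \<Phi> r / pi ^ DIM('b)"
    by (simp add: exponent_index_fun_resolvent[OF r])
  then have "exp DIM('b) * (exp (- DIM('b)) * measure resolvent (cball 0 r)) \<le> exp DIM('b) * (exponent_index_fun \<Phi> r / pi ^ DIM('b))"
    by (rule mult_left_mono) simp
  then show ?thesis by (simp add: exp_minus mult.assoc[symmetric])
qed

lemma resolvent_ball_lower_bound:
  assumes c: "c > 0" "eventually (\<lambda>r. c * r powr g0 \<le> exponent_index_fun \<Phi> r) (at_right 0)"
    and g: "0 < g0" "g0 < g1"
  obtains c' where "c' > 0" "\<And>r. 0 < r \<Longrightarrow> r \<le> 1 \<Longrightarrow> c' * r powr g1 \<le> measure resolvent (ball 0 r)"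
proof -
  interpret R: prob_space resolvent by (rule prob_space_resolvent)
  define \<theta> where "\<theta> = g1 / g0"
  have \<theta>: "\<theta> > 1" "\<theta> * g0 = g1" using g by (auto simp: \<theta>_def)
  define K where "K = pi ^ DIM('b)"
  have K: "K > 0" by (simp add: K_def)
  have "filterlim (\<lambda>r::real. r powr \<theta>) (at_right 0) (at_right 0)"
    using \<theta> by real_asymp
  then have "eventually (\<lambda>r. c * (r powr \<theta>) powr g0 \<le> exponent_index_fun \<Phi> (r powr \<theta>)) (at_right 0)"
    using c(2) by (rule filterlim_iff[THEN iffD1, rule_format])
  moreover have "eventually (\<lambda>r. exp (- (r powr (1 - \<theta>))) \<le> c / (2 * K) * r powr g1) (at_right 0)"
    using \<theta> c(1) K by (intro exp_neg_powr_le_powr) auto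
  ultimately have "eventually (\<lambda>r. c / (2 * K) * r powr g1 \<le> measure resolvent (ball 0 r)) (at_right 0)"
    using eventually_at_right_less[of "0::real"]
  proof eventually_elim
    case (elim r)
    have "c * r powr g1 \<le> K * (measure resolvent (ball 0 r) + exp (- (r / r powr \<theta>)))"
      using elim(1) exponent_index_fun_le_ball[of "r powr \<theta>" r] elim(3) \<theta> by (simp add: K_def powr_powr)
    also have "r / r powr \<theta> = r powr (1 - \<theta>)" using elim(3) by (simp add: powr_diff)
    finally have "c * r powr g1 \<le> K * measure resolvent (ball 0 r) + K * (c / (2 * K) * r powr g1)"
      using mult_left_mono[OF elim(2), of K] K by (simp add: ring_distribs)
    then show ?case using K by (simp add: field_simps)
  qed
  then obtain r0 where r0: "r0 > 0" "\<And>r. 0 < r \<Longrightarrow> r < r0 \<Longrightarrow> c / (2 * K) * r powr g1 \<le> measure resolvent (ball 0 r)"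
    unfolding eventually_at_right_field by blast
  define q where "q = min (r0 / 2) 1"
  have q: "0 < q" "q < r0" "q \<le> 1" using r0(1) by (auto simp: q_def)
  show ?thesis
  proof
    show "c / (2 * K) * q powr g1 > 0" using c(1) K q by simp
    fix r :: real assume r: "0 < r" "r \<le> 1"
    have "c / (2 * K) * q powr g1 * r powr g1 = c / (2 * K) * (q * r) powr g1"
      using q r by (simp add: powr_mult)
    also have "\<dots> \<le> measure resolvent (ball 0 (q * r))"
      using q r by (intro r0(2)) (auto intro: order.strict_trans1[OF mult_left_le])
    also have "\<dots> \<le> measure resolvent (ball 0 r)"
      using q r by (intro R.finite_measure_mono subset_ball) (auto simp: mult_le_cancel_right1)
    finally show "c / (2 * K) * q powr g1 * r powr g1 \<le> measure resolvent (ball 0 r)" .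
  qed
qed

lemma AE_packing_premeasure_zero:
  assumes c: "c > 0" "eventually (\<lambda>r. c * r powr g0 \<le> exponent_index_fun \<Phi> r) (at_right 0)"
    and g: "0 < g0" "g0 < s"
  shows "AE \<omega> in M. \<forall>a::nat. packing_premeasure s ((\<lambda>t. Z t \<omega>) ` {0..<real a}) = 0"
  unfolding AE_all_countable
proof
  fix a :: nat
  interpret R: prob_space resolvent by (rule prob_space_resolvent)
  define n where "n = DIM('b)"
  define g1 where "g1 = (g0 + s) / 2"
  have g1: "g0 < g1" "g1 < s" using g by (auto simp: g1_def)
  obtain c' where c': "c' > 0" "\<And>r. 0 < r \<Longrightarrow> r \<le> 1 \<Longrightarrow> c' * r powr g1 \<le> measure resolvent (ball 0 r)"
    using resolvent_ball_lower_bound[OF c g(1) g1(1)] by blast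
  define Q where "Q = exp (real a + 2) * (unit_ball_vol (real n) * 2 ^ n) / c'"
  have Q: "Q \<ge> 0" using c'(1) by (simp add: Q_def)
  have V: "(\<integral>\<^sup>+\<omega>. ennreal (r powr (s - real n)) * emeasure lborel (sausage a r \<omega>) \<partial>M) \<le> ennreal (Q * r powr (s - g1))"
    if r: "0 < r" "r \<le> 1" for r
  proof -
    define E where "E = (\<integral>\<^sup>+\<omega>. emeasure lborel (sausage a r \<omega>) \<partial>M)"
    define \<kappa> where "\<kappa> = c' * r powr g1"
    have \<kappa>: "\<kappa> > 0" using c'(1) r by (simp add: \<kappa>_def)
    have "E * ennreal \<kappa> \<le> E * emeasure resolvent (ball 0 r)"
      using c'(2)[OF r] by (auto simp: R.emeasure_eq_measure \<kappa>_def intro!: mult_left_mono ennreal_leI)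
    also have "\<dots> \<le> ennreal (exp (real a + 2)) * emeasure lborel (ball (0 :: 'b) (2 * r))"
      unfolding E_def by (rule sausage_expectation[OF r(1)])
    also have "\<dots> = ennreal (exp (real a + 2) * (unit_ball_vol (real n) * (2 * r) ^ n))"
      using r by (simp add: emeasure_ball n_def ennreal_mult')
    finally have *: "E * ennreal \<kappa> \<le> ennreal (exp (real a + 2) * (unit_ball_vol (real n) * (2 * r) ^ n))" .
    have "ennreal (r powr (s - real n)) * E = ennreal (r powr (s - real n) / \<kappa>) * (E * ennreal \<kappa>)"
    proof -
      have "ennreal (r powr (s - real n)) = ennreal (r powr (s - real n) / \<kappa>) * ennreal \<kappa>"
        using \<kappa> by (subst ennreal_mult'[symmetric]) auto
      then show ?thesis by (simp add: mult_ac)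
    qed
    also have "\<dots> \<le> ennreal (r powr (s - real n) / \<kappa>) * ennreal (exp (real a + 2) * (unit_ball_vol (real n) * (2 * r) ^ n))"
      using * by (rule mult_left_mono) simp
    also have "\<dots> = ennreal (r powr (s - real n) / \<kappa> * (exp (real a + 2) * (unit_ball_vol (real n) * (2 * r) ^ n)))"
      using \<kappa> r by (intro ennreal_mult[symmetric]) auto
    also have "r powr (s - real n) / \<kappa> * (exp (real a + 2) * (unit_ball_vol (real n) * (2 * r) ^ n)) = Q * r powr (s - g1)"
      using c'(1) r by (simp add: Q_def \<kappa>_def powr_diff powr_realpow power_mult_distrib field_simps)
    finally show ?thesis
      unfolding E_def using emeasure_grid_sausage_measurable unfolding emeasure_sausage
      by (subst nn_integral_cmult) auto
  qed
  have meas: "(\<lambda>\<omega>. emeasure lborel (sausage a r \<omega>)) \<in> borel_measurable M" for r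
    unfolding emeasure_sausage using emeasure_grid_sausage_measurable by (intro borel_measurable_SUP) auto
  define S where "S \<omega> = (\<Sum>k. ennreal (((1/2) ^ k) powr (s - real n)) * emeasure lborel (sausage a ((1/2) ^ k) \<omega>))" for \<omega>
  have [measurable]: "S \<in> borel_measurable M" unfolding S_def using meas by measurable
  have "(\<integral>\<^sup>+\<omega>. S \<omega> \<partial>M) = (\<Sum>k. \<integral>\<^sup>+\<omega>. ennreal (((1/2) ^ k) powr (s - real n)) * emeasure lborel (sausage a ((1/2) ^ k) \<omega>) \<partial>M)"
    unfolding S_def by (intro nn_integral_suminf borel_measurable_times_ennreal borel_measurable_const meas)
  also have "\<dots> \<le> (\<Sum>k. ennreal (Q * ((1/2) powr (s - g1)) ^ k))"
  proof (intro suminf_le)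
    fix k
    have "((1/2::real) ^ k) powr (s - g1) = ((1/2) powr (s - g1)) ^ k"
      by (simp add: powr_power powr_powr mult.commute flip: powr_realpow)
    then show "(\<integral>\<^sup>+\<omega>. ennreal (((1/2) ^ k) powr (s - real n)) * emeasure lborel (sausage a ((1/2) ^ k) \<omega>) \<partial>M) \<le> ennreal (Q * ((1/2) powr (s - g1)) ^ k)"
      using V[of "(1/2) ^ k"] by (simp add: power_le_one)
  qed auto
  also have "\<dots> < \<infinity>"
  proof -
    have "(1/2::real) powr (s - g1) < 1 powr (s - g1)" using g1 by (intro powr_less_mono2) auto
    then have "summable (\<lambda>k. Q * ((1/2) powr (s - g1)) ^ k)"
      by (intro summable_mult summable_geometric) simp
    then show ?thesis using Q by (subst suminf_ennreal2) auto
  qed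
  finally have "AE \<omega> in M. S \<omega> \<noteq> \<infinity>"
    by (intro nn_integral_PInf_AE) auto
  then show "AE \<omega> in M. packing_premeasure s ((\<lambda>t. Z t \<omega>) ` {0..<real a}) = 0"
    using AE_space
  proof eventually_elim
    case (elim \<omega>)
    show ?case
    proof (rule packing_premeasure_eq_0_if_sausage_summable)
      have "(\<Sum>k. ennreal (((1/2) ^ k) powr (s - real n)) * emeasure lborel (\<Union>x\<in>(\<lambda>t. Z t \<omega>) ` {0..<real a}. ball x ((1/2) ^ k))) \<le> S \<omega>"
        unfolding S_def
        by (intro suminf_le mult_left_mono emeasure_mono sausage_superset elim)
           (use open_grid_sausage in \<open>auto simp: sausage_def\<close>)
      also have "\<dots> < \<infinity>" using elim(1) by (simp add: top.not_eq_extremum)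
      finally show "(\<Sum>k. ennreal (((1/2) ^ k) powr (s - real DIM('b))) * emeasure lborel (\<Union>x\<in>(\<lambda>t. Z t \<omega>) ` {0..<real a}. ball x ((1/2) ^ k))) < \<infinity>"
        by (simp add: n_def)
    qed (use g in simp)
  qed
qed

end

section \<open>The occupation measure\<close>

lemma Liminf_zero_sequence:
  fixes V :: "real \<Rightarrow> real"
  assumes "Liminf (at_right 0) (\<lambda>r. ereal (V r / r powr \<gamma>)) = 0"
  obtains \<rho> :: "nat \<Rightarrow> real" where "\<And>k. 0 < \<rho> k" "\<And>k. \<rho> k \<le> (1/2) ^ k" "\<And>k. V (\<rho> k) \<le> (1/4) ^ k * \<rho> k powr \<gamma>"
proof -
  have "\<exists>r>0. r \<le> (1/2) ^ k \<and> V r \<le> (1/4) ^ k * r powr \<gamma>" for k :: nat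
  proof (rule ccontr)
    assume "\<not> ?thesis"
    then have *: "(1/4) ^ k * r powr \<gamma> < V r" if "0 < r" "r \<le> (1/2) ^ k" for r
      using that by force
    have "eventually (\<lambda>r::real. 0 < r \<and> r < (1/2) ^ k) (at_right 0)"
      by (intro eventually_at_rightI[of 0 "(1/2) ^ k"]) auto
    then have "eventually (\<lambda>r. ereal ((1/4) ^ k) \<le> ereal (V r / r powr \<gamma>)) (at_right 0)"
      by eventually_elim (use * in \<open>auto simp: pos_le_divide_eq intro: less_imp_le\<close>)
    then have "ereal ((1/4) ^ k) \<le> Liminf (at_right 0) (\<lambda>r. ereal (V r / r powr \<gamma>))"
      by (rule Liminf_bounded)
    moreover have "(0::real) < (1/4) ^ k" by simp
    ultimately show False using assms by (simp del: zero_less_power)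
  qed
  then show ?thesis using that by metis
qed

context regular_levy
begin

abbreviation near :: "real \<Rightarrow> real \<Rightarrow> real \<Rightarrow> 'a \<Rightarrow> ennreal" where
  "near r s t \<omega> \<equiv> (if dist (Z s \<omega>) (Z t \<omega>) \<le> r then 1 else 0)"

lemma prob_increment_ball:
  assumes "0 \<le> s" "0 \<le> t"
  shows "(\<integral>\<^sup>+\<omega>. near r s t \<omega> \<partial>M) = emeasure M {\<omega>\<in>space M. Z \<bar>t - s\<bar> \<omega> \<in> cball 0 r}"
proof -
  have le: "(\<integral>\<^sup>+\<omega>. near r s t \<omega> \<partial>M) = emeasure M {\<omega>\<in>space M. Z (t - s) \<omega> \<in> cball 0 r}"
    if "0 \<le> s" "s \<le> t" for s t
  proof -
    have "(\<integral>\<^sup>+\<omega>. near r s t \<omega> \<partial>M) = (\<integral>\<^sup>+\<omega>. indicator {\<omega>\<in>space M. dist (Z s \<omega>) (Z t \<omega>) \<le> r} \<omega> \<partial>M)"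
      by (intro nn_integral_cong) (auto simp: indicator_def)
    also have "\<dots> = emeasure M {\<omega>\<in>space M. dist (Z s \<omega>) (Z t \<omega>) \<le> r}"
      by (intro nn_integral_indicator) measurable
    also have "{\<omega>\<in>space M. dist (Z s \<omega>) (Z t \<omega>) \<le> r} = (\<lambda>\<omega>. Z (s + (t - s)) \<omega> - Z s \<omega>) -` cball 0 r \<inter> space M"
      by (auto simp: dist_norm norm_minus_commute)
    also have "emeasure M \<dots> = emeasure (distr M borel (\<lambda>\<omega>. Z (s + (t - s)) \<omega> - Z s \<omega>)) (cball 0 r)"
      by (intro emeasure_distr[symmetric]) auto
    also have "\<dots> = emeasure (distr M borel (Z (t - s))) (cball 0 r)"
      using that by (subst stationary) auto
    also have "\<dots> = emeasure M {\<omega>\<in>space M. Z (t - s) \<omega> \<in> cball 0 r}"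
      by (subst emeasure_distr) (auto intro!: arg_cong[where f = "emeasure M"])
    finally show ?thesis .
  qed
  show ?thesis
    using le[of s t] le[of t s] assms by (cases "s \<le> t") (auto simp: dist_commute)
qed

lemma occupation_energy_bound:
  assumes a: "0 \<le> a"
  shows "(\<integral>\<^sup>+\<omega>. (\<integral>\<^sup>+s. indicator {0..<a} s * (\<integral>\<^sup>+t. indicator {0..<a} t * near r s t \<omega> \<partial>lborel) \<partial>lborel) \<partial>M)
     \<le> ennreal (2 * a * exp a) * emeasure resolvent (cball 0 r)"
proof -
  interpret P: pair_sigma_finite "lborel :: real measure" M ..
  define q where "q u = emeasure M {\<omega>\<in>space M. Z u \<omega> \<in> cball 0 r}" for u
  define g where "g u = indicator {0..} u * (ennreal (exp a) * (ennreal (exp (- u)) * q u))" for u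
  have q[measurable]: "q \<in> borel_measurable borel" unfolding q_def mem_cball by measurable
  have [measurable]: "g \<in> borel_measurable borel" unfolding g_def by measurable
  have g: "(\<integral>\<^sup>+u. g u \<partial>lborel) = ennreal (exp a) * emeasure resolvent (cball 0 r)"
  proof -
    have "emeasure resolvent (cball 0 r) = (\<integral>\<^sup>+u. ennreal (exp (- u)) * indicator {0..} u * q u \<partial>lborel)"
      using nn_integral_exp_time[OF q] by (simp add: emeasure_resolvent q_def)
    also have "ennreal (exp a) * \<dots> = (\<integral>\<^sup>+u. g u \<partial>lborel)"
      unfolding g_def by (subst nn_integral_cmult[symmetric]) (auto intro!: nn_integral_cong simp: mult_ac)
    finally show ?thesis by simp
  qed
  have inner: "(\<integral>\<^sup>+t. indicator {0..<a} t * (\<integral>\<^sup>+\<omega>. near r s t \<omega> \<partial>M) \<partial>lborel) \<le> 2 * (ennreal (exp a) * emeasure resolvent (cball 0 r))"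
    if s: "s \<in> {0..<a}" for s
  proof -
    have "(\<integral>\<^sup>+t. indicator {0..<a} t * (\<integral>\<^sup>+\<omega>. near r s t \<omega> \<partial>M) \<partial>lborel) \<le> (\<integral>\<^sup>+t. g (- s + 1 * t) + g (s + (-1) * t) \<partial>lborel)"
    proof (rule nn_integral_mono)
      fix t :: real
      show "indicator {0..<a} t * (\<integral>\<^sup>+\<omega>. near r s t \<omega> \<partial>M) \<le> g (- s + 1 * t) + g (s + (-1) * t)"
      proof (cases "t \<in> {0..<a}")
        case True
        have "\<bar>t - s\<bar> \<le> a" using s True by (auto simp: abs_if)
        then have ge1: "1 \<le> ennreal (exp a) * ennreal (exp (- \<bar>t - s\<bar>))"
          by (simp add: ennreal_mult'[symmetric] exp_add[symmetric])
        have "(\<integral>\<^sup>+\<omega>. near r s t \<omega> \<partial>M) = 1 * q \<bar>t - s\<bar>"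
          using s True by (subst prob_increment_ball) (auto simp: q_def)
        also have "\<dots> \<le> (ennreal (exp a) * ennreal (exp (- \<bar>t - s\<bar>))) * q \<bar>t - s\<bar>"
          using ge1 by (rule mult_right_mono) simp
        also have "\<dots> = g \<bar>t - s\<bar>" by (simp add: g_def mult.assoc)
        also have "g \<bar>t - s\<bar> \<le> g (- s + 1 * t) + g (s + (-1) * t)"
          by (cases "s \<le> t") (auto simp: abs_if add_increasing add_increasing2)
        finally show ?thesis using True by simp
      qed simp
    qed
    also have "\<dots> = (\<integral>\<^sup>+t. g (- s + 1 * t) \<partial>lborel) + (\<integral>\<^sup>+t. g (s + (-1) * t) \<partial>lborel)"
      by (intro nn_integral_add) measurable
    also have "\<dots> = (\<integral>\<^sup>+u. g u \<partial>lborel) + (\<integral>\<^sup>+u. g u \<partial>lborel)"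
      using nn_integral_real_affine[of g 1 "- s"] nn_integral_real_affine[of g "-1" s] by simp
    finally show ?thesis by (simp add: g mult_2)
  qed
  have "(\<integral>\<^sup>+\<omega>. (\<integral>\<^sup>+s. indicator {0..<a} s * (\<integral>\<^sup>+t. indicator {0..<a} t * near r s t \<omega> \<partial>lborel) \<partial>lborel) \<partial>M)
      = (\<integral>\<^sup>+s. (\<integral>\<^sup>+\<omega>. indicator {0..<a} s * (\<integral>\<^sup>+t. indicator {0..<a} t * near r s t \<omega> \<partial>lborel) \<partial>M) \<partial>lborel)"
    by (rule P.Fubini') measurable
  also have "\<dots> = (\<integral>\<^sup>+s. indicator {0..<a} s * (\<integral>\<^sup>+\<omega>. (\<integral>\<^sup>+t. indicator {0..<a} t * near r s t \<omega> \<partial>lborel) \<partial>M) \<partial>lborel)"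
    by (intro nn_integral_cong nn_integral_cmult) measurable
  also have "\<dots> = (\<integral>\<^sup>+s. indicator {0..<a} s * (\<integral>\<^sup>+t. indicator {0..<a} t * (\<integral>\<^sup>+\<omega>. near r s t \<omega> \<partial>M) \<partial>lborel) \<partial>lborel)"
  proof (intro nn_integral_cong arg_cong2[where f = "(*)"] refl)
    fix s :: real
    have "(\<integral>\<^sup>+\<omega>. (\<integral>\<^sup>+t. indicator {0..<a} t * near r s t \<omega> \<partial>lborel) \<partial>M) = (\<integral>\<^sup>+t. (\<integral>\<^sup>+\<omega>. indicator {0..<a} t * near r s t \<omega> \<partial>M) \<partial>lborel)"
      by (rule P.Fubini') measurable
    also have "\<dots> = (\<integral>\<^sup>+t. indicator {0..<a} t * (\<integral>\<^sup>+\<omega>. near r s t \<omega> \<partial>M) \<partial>lborel)"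
      by (intro nn_integral_cong nn_integral_cmult) measurable
    finally show "(\<integral>\<^sup>+\<omega>. (\<integral>\<^sup>+t. indicator {0..<a} t * near r s t \<omega> \<partial>lborel) \<partial>M) = (\<integral>\<^sup>+t. indicator {0..<a} t * (\<integral>\<^sup>+\<omega>. near r s t \<omega> \<partial>M) \<partial>lborel)" .
  qed
  also have "\<dots> \<le> (\<integral>\<^sup>+s. indicator {0..<a} s * (2 * (ennreal (exp a) * emeasure resolvent (cball 0 r))) \<partial>lborel)"
    using inner by (intro nn_integral_mono) (auto simp: indicator_def)
  also have "\<dots> = ennreal a * (2 * (ennreal (exp a) * emeasure resolvent (cball 0 r)))"
    using a by (simp add: nn_integral_multc)
  also have "\<dots> = ennreal (2 * a * exp a) * emeasure resolvent (cball 0 r)"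
    using a by (simp add: ennreal_mult' mult_ac)
  finally show ?thesis .
qed

lemma AE_packing_measure_nonzero:
  assumes \<gamma>: "Liminf (at_right 0) (\<lambda>r. ereal (exponent_index_fun \<Phi> r / r powr \<gamma>)) = 0" and a: "0 < a"
  shows "AE \<omega> in M. packing_measure \<gamma> ((\<lambda>t. Z t \<omega>) ` {0..<a}) \<noteq> 0"
proof -
  interpret R: prob_space resolvent by (rule prob_space_resolvent)
  obtain \<rho> :: "nat \<Rightarrow> real" where \<rho>: "\<And>k. 0 < \<rho> k" "\<And>k. \<rho> k \<le> (1/2) ^ k"
    "\<And>k. exponent_index_fun \<Phi> (\<rho> k) \<le> (1/4) ^ k * \<rho> k powr \<gamma>"
    using Liminf_zero_sequence[OF \<gamma>] by blast
  define F where "F k s \<omega> = (\<integral>\<^sup>+t. indicator {0..<a} t * near (\<rho> k) s t \<omega> \<partial>lborel)" for k s \<omega>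
  define w where "w k = 2 ^ k / \<rho> k powr \<gamma>" for k
  define S where "S s \<omega> = (\<Sum>k. ennreal (w k) * F k s \<omega>)" for s \<omega>
  have w: "w k > 0" for k using \<rho>(1)[of k] by (simp add: w_def)
  have Fm[measurable]: "(\<lambda>(s, \<omega>). F k s \<omega>) \<in> borel_measurable (borel \<Otimes>\<^sub>M M)" for k
    unfolding F_def by measurable
  have Fm1[measurable]: "\<omega> \<in> space M \<Longrightarrow> (\<lambda>s. F k s \<omega>) \<in> borel_measurable borel" for k \<omega>
    unfolding F_def by measurable
  have Sm[measurable]: "(\<lambda>(s, \<omega>). S s \<omega>) \<in> borel_measurable (borel \<Otimes>\<^sub>M M)"
    unfolding S_def by measurable
  define C where "C = 2 * a * exp a * (exp DIM('b) / pi ^ DIM('b))"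
  have C: "C \<ge> 0" using a by (simp add: C_def)
  have "(\<integral>\<^sup>+\<omega>. (\<integral>\<^sup>+s. indicator {0..<a} s * S s \<omega> \<partial>lborel) \<partial>M) = (\<integral>\<^sup>+\<omega>. (\<Sum>k. ennreal (w k) * (\<integral>\<^sup>+s. indicator {0..<a} s * F k s \<omega> \<partial>lborel)) \<partial>M)"
  proof (rule nn_integral_cong)
    fix \<omega> assume [measurable]: "\<omega> \<in> space M"
    have "(\<integral>\<^sup>+s. indicator {0..<a} s * S s \<omega> \<partial>lborel) = (\<integral>\<^sup>+s. (\<Sum>k. ennreal (w k) * (indicator {0..<a} s * F k s \<omega>)) \<partial>lborel)"
      unfolding S_def by (intro nn_integral_cong) (simp add: ennreal_suminf_cmult[symmetric] mult.left_commute)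
    also have "\<dots> = (\<Sum>k. \<integral>\<^sup>+s. ennreal (w k) * (indicator {0..<a} s * F k s \<omega>) \<partial>lborel)"
      by (intro nn_integral_suminf) measurable
    also have "\<dots> = (\<Sum>k. ennreal (w k) * (\<integral>\<^sup>+s. indicator {0..<a} s * F k s \<omega> \<partial>lborel))"
      by (intro suminf_cong nn_integral_cmult) measurable
    finally show "(\<integral>\<^sup>+s. indicator {0..<a} s * S s \<omega> \<partial>lborel) = (\<Sum>k. ennreal (w k) * (\<integral>\<^sup>+s. indicator {0..<a} s * F k s \<omega> \<partial>lborel))" .
  qed
  also have "\<dots> = (\<Sum>k. ennreal (w k) * (\<integral>\<^sup>+\<omega>. (\<integral>\<^sup>+s. indicator {0..<a} s * F k s \<omega> \<partial>lborel) \<partial>M))"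
    by (subst nn_integral_suminf) (auto intro!: suminf_cong nn_integral_cmult)
  also have "\<dots> \<le> (\<Sum>k. ennreal (C * (1/2) ^ k))"
  proof (intro suminf_le)
    fix k
    have "ennreal (w k) * (\<integral>\<^sup>+\<omega>. (\<integral>\<^sup>+s. indicator {0..<a} s * F k s \<omega> \<partial>lborel) \<partial>M) \<le> ennreal (w k) * (ennreal (2 * a * exp a) * emeasure resolvent (cball 0 (\<rho> k)))"
      unfolding F_def using a by (intro mult_left_mono occupation_energy_bound) auto
    also have "\<dots> \<le> ennreal (w k) * (ennreal (2 * a * exp a) * ennreal (exp DIM('b) / pi ^ DIM('b) * ((1/4) ^ k * \<rho> k powr \<gamma>)))"
      unfolding R.emeasure_eq_measure
      by (intro mult_left_mono ennreal_leI order_trans[OF ball_le_exponent_index_fun[OF \<rho>(1)]] \<rho>(3)) auto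
    also have "\<dots> = ennreal (w k * (2 * a * exp a * (exp DIM('b) / pi ^ DIM('b) * ((1/4) ^ k * \<rho> k powr \<gamma>))))"
    proof -
      have "ennreal x * (ennreal y * ennreal z) = ennreal (x * (y * z))" if "0 \<le> x" "0 \<le> y" "0 \<le> z" for x y z
        using that by (simp add: ennreal_mult)
      then show ?thesis using a less_imp_le[OF w[of k]] by simp
    qed
    also have "w k * (2 * a * exp a * (exp DIM('b) / pi ^ DIM('b) * ((1/4) ^ k * \<rho> k powr \<gamma>))) = C * (2 ^ k * (1/4) ^ k)"
      using \<rho>(1)[of k] by (simp add: C_def w_def)
    also have "2 ^ k * (1/4) ^ k = (1/2 :: real) ^ k"
      by (simp add: power_mult_distrib[symmetric])
    finally show "ennreal (w k) * (\<integral>\<^sup>+\<omega>. (\<integral>\<^sup>+s. indicator {0..<a} s * F k s \<omega> \<partial>lborel) \<partial>M) \<le> ennreal (C * (1/2) ^ k)" .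
  qed auto
  also have "\<dots> < \<infinity>"
    using C by (subst suminf_ennreal2) (auto intro!: summable_mult summable_geometric)
  finally have "AE \<omega> in M. (\<integral>\<^sup>+s. indicator {0..<a} s * S s \<omega> \<partial>lborel) \<noteq> \<infinity>"
    by (intro nn_integral_PInf_AE) auto
  then show ?thesis
    using AE_space
  proof eventually_elim
    case (elim \<omega>)
    have [measurable]: "(\<lambda>s. Z s \<omega>) \<in> borel_measurable borel" using elim(2) by measurable
    have "(\<lambda>s. S s \<omega>) \<in> borel_measurable borel" using elim(2) by measurable
    then have fin: "AE s in lborel. indicator {0..<a} s * S s \<omega> \<noteq> \<infinity>"
      using elim(1) by (intro nn_integral_PInf_AE) auto
    define \<mu> where "\<mu> = distr (density lborel (indicator {0..<a})) borel (\<lambda>t. Z t \<omega>)"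
    have \<mu>: "sets \<mu> = sets borel" by (simp add: \<mu>_def)
    have \<mu>_eq: "emeasure \<mu> B = (\<integral>\<^sup>+t. indicator {0..<a} t * indicator B (Z t \<omega>) \<partial>lborel)" if [measurable]: "B \<in> sets borel" for B
    proof -
      have "(\<lambda>t. Z t \<omega>) -` B \<in> sets borel"
        using measurable_sets[of "\<lambda>t. Z t \<omega>" borel borel B] by simp
      then show ?thesis
      unfolding \<mu>_def
      by (subst emeasure_distr, simp, simp, subst emeasure_density) (auto intro!: nn_integral_cong simp: indicator_def)
    qed
    define G where "G = {x. \<forall>\<epsilon>>0. \<forall>\<delta>>0. \<exists>r. 0 < r \<and> r \<le> \<delta> \<and> emeasure \<mu> (cball x (5 * r)) \<le> ennreal (\<epsilon> * (2 * r) powr \<gamma>)}"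
    have inG: "Z s \<omega> \<in> G" if "S s \<omega> < \<infinity>" for s
      unfolding G_def
    proof (clarify)
      fix \<epsilon> \<delta> :: real assume \<epsilon>: "\<epsilon> > 0" and \<delta>: "\<delta> > 0"
      define B where "B = enn2real (S s \<omega>)"
      have B: "S s \<omega> = ennreal B" "B \<ge> 0" using that by (simp_all add: B_def)
      have pow: "(\<lambda>k. (1/2::real) ^ k) \<longlonglongrightarrow> 0" by (rule LIMSEQ_power_zero) simp
      then have "eventually (\<lambda>k. (1/2) ^ k < \<delta>) sequentially"
        using \<delta> by (rule order_tendstoD)
      moreover have "(\<lambda>k. B * (1/2::real) ^ k) \<longlonglongrightarrow> B * 0" by (intro tendsto_mult tendsto_const pow)
      then have "eventually (\<lambda>k. B * (1/2) ^ k < \<epsilon> * (2/5) powr \<gamma>) sequentially"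
        using \<epsilon> by (intro order_tendstoD(2)) auto
      ultimately have "eventually (\<lambda>k. (1/2) ^ k < \<delta> \<and> B * (1/2) ^ k < \<epsilon> * (2/5) powr \<gamma>) sequentially"
        by (rule eventually_conj)
      then obtain k where k: "(1/2) ^ k < \<delta>" "B * (1/2) ^ k < \<epsilon> * (2/5) powr \<gamma>"
        by (auto simp: eventually_sequentially)
      have "ennreal (w k) * F k s \<omega> \<le> ennreal B"
        using sum_le_suminf[of "\<lambda>k. ennreal (w k) * F k s \<omega>" "{k}"] B by (simp add: S_def)
      then have "ennreal (1 / w k) * (ennreal (w k) * F k s \<omega>) \<le> ennreal (1 / w k) * ennreal B"
        by (rule mult_left_mono) simp
      moreover have "ennreal (1 / w k) * ennreal (w k) = 1"
        using w[of k] by (simp add: ennreal_mult[symmetric])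
      ultimately have "F k s \<omega> \<le> ennreal (1 / w k * B)"
        using w[of k] B by (simp add: mult.assoc[symmetric] ennreal_mult[symmetric])
      also have "1 / w k * B = B * (1/2) ^ k * \<rho> k powr \<gamma>"
        by (simp add: w_def power_one_over)
      also have "\<dots> \<le> \<epsilon> * (2/5) powr \<gamma> * \<rho> k powr \<gamma>"
        using k(2) by (intro mult_right_mono) auto
      also have "\<epsilon> * (2/5) powr \<gamma> * \<rho> k powr \<gamma> = \<epsilon> * (2 * (\<rho> k / 5)) powr \<gamma>"
        using \<rho>(1)[of k] by (simp add: powr_mult[symmetric])
      finally have "F k s \<omega> \<le> ennreal (\<epsilon> * (2 * (\<rho> k / 5)) powr \<gamma>)"
        by (simp add: ennreal_leI)
      moreover have "emeasure \<mu> (cball (Z s \<omega>) (5 * (\<rho> k / 5))) = F k s \<omega>"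
        by (subst \<mu>_eq) (auto simp: F_def indicator_def intro!: nn_integral_cong)
      ultimately show "\<exists>r>0. r \<le> \<delta> \<and> emeasure \<mu> (cball (Z s \<omega>) (5 * r)) \<le> ennreal (\<epsilon> * (2 * r) powr \<gamma>)"
        using \<rho>(1)[of k] \<rho>(2)[of k] k(1) by (intro exI[of _ "\<rho> k / 5"]) auto
    qed
    show ?case
    proof
      assume "packing_measure \<gamma> ((\<lambda>t. Z t \<omega>) ` {0..<a}) = 0"
      then obtain A :: "nat \<Rightarrow> 'b set" where A: "(\<lambda>t. Z t \<omega>) ` {0..<a} \<subseteq> (\<Union>i. A i)" "\<And>i. packing_premeasure \<gamma> (A i) < \<infinity>"
        using packing_measure_zeroD by blast
      have "\<exists>N\<in>null_sets \<mu>. A i \<inter> G \<subseteq> N" for i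
        by (rule finite_packing_premeasure_null[OF A(2) \<mu>]) (auto simp: G_def)
      then obtain N where N: "\<And>i. N i \<in> null_sets \<mu>" "\<And>i. A i \<inter> G \<subseteq> N i" by metis
      have null: "(\<Union>i. N i) \<in> null_sets \<mu>" using N(1) by (intro null_sets_UN) auto
      then have [measurable]: "(\<Union>i. N i) \<in> sets borel" using \<mu> by auto
      have "(\<integral>\<^sup>+t. indicator {0..<a} t * indicator (\<Union>i. N i) (Z t \<omega>) \<partial>lborel) = 0"
        using null by (simp add: \<mu>_eq[symmetric] null_setsD1)
      then have "AE t in lborel. indicator {0..<a} t * indicator (\<Union>i. N i) (Z t \<omega>) = (0 :: ennreal)"
        by (subst (asm) nn_integral_0_iff_AE) auto
      then have "AE t in lborel. t \<notin> {0..<a}"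
        using fin
      proof eventually_elim
        case (elim t)
        show ?case
        proof
          assume t: "t \<in> {0..<a}"
          then have "Z t \<omega> \<in> G" using elim(2) by (intro inG) (auto simp: top.not_eq_extremum)
          moreover have "Z t \<omega> \<in> (\<Union>i. A i)" using A(1) t by blast
          ultimately have "Z t \<omega> \<in> (\<Union>i. N i)" using N(2) by blast
          then show False using elim(1) t by simp
        qed
      qed
      then have "emeasure lborel {0..<a} = 0"
        using AE_iff_measurable[of "{0..<a}" lborel "\<lambda>t. t \<notin> {0..<a}"]
        by (simp del: atLeastLessThan_iff emeasure_lborel_Ico)
      then show False using a by simp
    qed
  qed
qed

end

section \<open>Subordinators\<close>

lemma (in prob_space) expectation_exp_neg_abs:
  fixes X :: "'a \<Rightarrow> real"
  assumes [measurable]: "X \<in> borel_measurable M"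
  shows "has_bochner_integral lborel (\<lambda>\<xi>. 1 / (1 + \<xi>\<^sup>2) * Re (expectation (\<lambda>\<omega>. iexp (\<xi> * X \<omega>)))) (pi * expectation (\<lambda>\<omega>. exp (- \<bar>X \<omega>\<bar>)))"
proof -
  interpret P: pair_sigma_finite "lborel :: real measure" M ..
  define f where "f \<xi> \<omega> = of_real (1 / (1 + \<xi>\<^sup>2)) * iexp (\<xi> * X \<omega>)" for \<xi> \<omega>
  have nf: "norm (f \<xi> \<omega>) = 1 / (1 + \<xi>\<^sup>2)" for \<xi> \<omega> unfolding f_def by (rule norm_cauchy_fourier)
  have le1: "1 / (1 + \<xi>\<^sup>2) \<le> 1" for \<xi> :: real
    by (intro divide_le_eq_1_pos[THEN iffD2]) (auto intro: add_pos_nonneg)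
  have [measurable]: "case_prod f \<in> borel_measurable (lborel \<Otimes>\<^sub>M M)" unfolding f_def by measurable
  have f: "integrable (lborel \<Otimes>\<^sub>M M) (case_prod f)"
  proof (rule P.Fubini_integrable)
    show "integrable lborel (\<lambda>\<xi>. \<integral>\<omega>. norm (case (\<xi>, \<omega>) of (\<xi>, \<omega>) \<Rightarrow> f \<xi> \<omega>) \<partial>M)"
      using integrable_cauchy by (simp add: nf prob_space)
    show "AE \<xi> in lborel. integrable M (\<lambda>\<omega>. case (\<xi>, \<omega>) of (\<xi>, \<omega>) \<Rightarrow> f \<xi> \<omega>)"
      unfolding case_prod_conv by (intro AE_I2 integrable_const_bound[of _ 1]) (simp add: nf le1, unfold f_def, measurable)
  qed measurable
  have 1: "(\<integral>\<omega>. f \<xi> \<omega> \<partial>M) = of_real (1 / (1 + \<xi>\<^sup>2)) * expectation (\<lambda>\<omega>. iexp (\<xi> * X \<omega>))" for \<xi>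
    unfolding f_def by (rule integral_mult_right_zero)
  have "has_bochner_integral lborel (\<lambda>\<xi>. \<integral>\<omega>. f \<xi> \<omega> \<partial>M) (\<integral>\<omega>. (\<integral>\<xi>. f \<xi> \<omega> \<partial>lborel) \<partial>M)"
    using P.integrable_fst[OF f] P.Fubini_integral[OF f] by (simp add: has_bochner_integral_iff)
  also have "(\<integral>\<omega>. (\<integral>\<xi>. f \<xi> \<omega> \<partial>lborel) \<partial>M) = of_real (pi * expectation (\<lambda>\<omega>. exp (- \<bar>X \<omega>\<bar>)))"
    unfolding f_def cauchy_fourier by simp
  finally have *: "has_bochner_integral lborel (\<lambda>\<xi>. of_real (1 / (1 + \<xi>\<^sup>2)) * expectation (\<lambda>\<omega>. iexp (\<xi> * X \<omega>))) (complex_of_real (pi * expectation (\<lambda>\<omega>. exp (- \<bar>X \<omega>\<bar>))))"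
    unfolding 1 .
  have "Re (of_real c * z) = c * Re z" for c z by simp
  then show ?thesis using has_bochner_integral_Re[OF *] by simp
qed

lemma Levy_measure_Re_exponent:
  assumes \<nu>: "subordinator_drift_levy_measure \<sigma> 0 \<nu>"
  shows "ennreal (Re (\<sigma> \<eta>)) = (\<integral>\<^sup>+y. ennreal (1 - cos (\<eta> * y)) \<partial>\<nu>)"
proof -
  have sets[measurable_cong]: "sets \<nu> = sets borel" and neg: "emeasure \<nu> {..0} = 0"
    and fin: "(\<integral>\<^sup>+ y. ennreal (min 1 y) \<partial>\<nu>) < \<infinity>"
    and \<sigma>: "\<sigma> \<eta> = (\<integral>y. 1 - iexp (\<eta> * y) \<partial>\<nu>)"
    using \<nu> by (auto simp: subordinator_drift_levy_measure_def)
  have pos: "AE y in \<nu>. 0 < y"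
    using neg sets by (intro AE_I[of _ _ "{..0}"]) auto
  have "integrable \<nu> (\<lambda>y::real. min 1 y)"
  proof (rule integrableI_nonneg)
    show "AE y in \<nu>. 0 \<le> min 1 y" using pos by eventually_elim simp
  qed (use fin in auto)
  then have int: "integrable \<nu> (\<lambda>y. 1 - iexp (\<eta> * y))"
  proof (rule Bochner_Integration.integrable_bound[OF integrable_mult_right[of "max 2 \<bar>\<eta>\<bar>"]])
    show "AE y in \<nu>. norm (1 - iexp (\<eta> * y)) \<le> norm (max 2 \<bar>\<eta>\<bar> * min 1 y)"
      using pos
    proof eventually_elim
      case (elim y)
      have 1: "norm (1 - iexp (\<eta> * y)) \<le> \<bar>\<eta>\<bar> * y"
        using iexp_approx1[of "\<eta> * y" 0] elim by (simp add: norm_minus_commute abs_mult)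
      have 2: "norm (1 - iexp (\<eta> * y)) \<le> 2"
        using norm_triangle_ineq4[of 1 "iexp (\<eta> * y)"] by simp
      show ?case
      proof (cases "y \<le> 1")
        case True
        have "\<bar>\<eta>\<bar> * y \<le> max 2 \<bar>\<eta>\<bar> * y" using elim by (intro mult_right_mono) auto
        with 1 have "norm (1 - iexp (\<eta> * y)) \<le> max 2 \<bar>\<eta>\<bar> * y" by (rule order_trans)
        then show ?thesis using True elim by (simp add: abs_mult)
      next
        case False
        then show ?thesis using 2 by simp
      qed
    qed
  qed measurable
  have Re1: "Re (1 - iexp (\<eta> * y)) = 1 - cos (\<eta> * y)" for y by (simp add: Re_exp)
  have "Re (\<sigma> \<eta>) = (\<integral>y. 1 - cos (\<eta> * y) \<partial>\<nu>)"
    unfolding \<sigma> using integral_Re[OF int] unfolding Re1 by simp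
  moreover have "integrable \<nu> (\<lambda>y. 1 - cos (\<eta> * y))"
    using integrable_Re[OF int] unfolding Re1 .
  ultimately show ?thesis by (simp add: nn_integral_eq_integral)
qed

lemma Levy_measure_tail_finite:
  assumes \<nu>: "subordinator_drift_levy_measure \<sigma> a \<nu>"
  shows "emeasure \<nu> {1 / real (Suc k)<..} < \<infinity>"
proof -
  have sets[measurable_cong]: "sets \<nu> = sets borel" and fin: "(\<integral>\<^sup>+ y. ennreal (min 1 y) \<partial>\<nu>) < \<infinity>"
    using \<nu> by (auto simp: subordinator_drift_levy_measure_def)
  have "emeasure \<nu> {1 / real (Suc k)<..} = (\<integral>\<^sup>+y. indicator {1 / real (Suc k)<..} y \<partial>\<nu>)"
    by (rule nn_integral_indicator[symmetric]) (simp add: sets)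
  also have "\<dots> \<le> (\<integral>\<^sup>+y. ennreal (real (Suc k)) * ennreal (min 1 y) \<partial>\<nu>)"
  proof (rule nn_integral_mono)
    fix y :: real
    show "indicator {1 / real (Suc k)<..} y \<le> ennreal (real (Suc k)) * ennreal (min 1 y)"
    proof (cases "y > 1 / real (Suc k)")
      case True
      then have "1 \<le> real (Suc k) * min 1 y" by (auto simp: min_def field_simps)
      then show ?thesis using True by (simp add: ennreal_mult'[symmetric] ennreal_ge_1 del: of_nat_Suc)
    qed simp
  qed
  also have "\<dots> = ennreal (real (Suc k)) * (\<integral>\<^sup>+y. ennreal (min 1 y) \<partial>\<nu>)"
    by (rule nn_integral_cmult) measurable
  also have "\<dots> < \<infinity>" using fin by (simp add: ennreal_mult_less_top)
  finally show ?thesis .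
qed

lemma Levy_measure_cauchy_lower:
  assumes \<nu>: "subordinator_drift_levy_measure \<sigma> 0 \<nu>"
  shows "ennreal (pi / 2) * emeasure \<nu> {1 / real (Suc k)<..} \<le> (\<integral>\<^sup>+\<xi>. ennreal (1 / (1 + \<xi>\<^sup>2)) * ennreal (Re (\<sigma> (real (Suc k) * \<xi>))) \<partial>lborel)"
proof -
  define u where "u = real (Suc k)"
  have u: "u > 0" by (simp add: u_def)
  have sets[measurable_cong]: "sets \<nu> = sets borel"
    using \<nu> by (auto simp: subordinator_drift_levy_measure_def)
  define \<nu>k where "\<nu>k = density \<nu> (indicator {1 / u<..})"
  have setsk[measurable_cong]: "sets \<nu>k = sets borel" by (simp add: \<nu>k_def sets)
  have totk: "emeasure \<nu>k (space \<nu>k) = emeasure \<nu> {1 / u<..}"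
    unfolding \<nu>k_def using sets_eq_imp_space_eq[OF sets] by (simp add: emeasure_density sets)
  interpret \<nu>k: finite_measure \<nu>k
    using Levy_measure_tail_finite[OF \<nu>, of k] totk by (intro finite_measureI) (auto simp: u_def)
  interpret P: pair_sigma_finite "lborel :: real measure" \<nu>k ..
  have inner: "(\<integral>\<^sup>+\<xi>. ennreal (1 / (1 + \<xi>\<^sup>2)) * ennreal (1 - cos (u * \<xi> * y)) \<partial>lborel) = ennreal (pi * (1 - exp (- \<bar>u * y\<bar>)))" for y
  proof -
    have "has_bochner_integral lborel (\<lambda>\<xi>. Re (of_real (1 / (1 + \<xi>\<^sup>2)) * iexp (\<xi> * x))) (pi * exp (- \<bar>x\<bar>))" for x
      using has_bochner_integral_Re[OF has_bochner_integral_integrable[OF integrable_cauchy_fourier[of x]]]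
      unfolding cauchy_fourier by simp
    then have *: "has_bochner_integral lborel (\<lambda>\<xi>. 1 / (1 + \<xi>\<^sup>2) * cos (\<xi> * x)) (pi * exp (- \<bar>x\<bar>))" for x
      by (simp add: Re_exp)
    from has_bochner_integral_diff[OF *[of 0] *[of "u * y"]]
    have "has_bochner_integral lborel (\<lambda>\<xi>. 1 / (1 + \<xi>\<^sup>2) * (1 - cos (u * \<xi> * y))) (pi * (1 - exp (- \<bar>u * y\<bar>)))"
      by (simp add: right_diff_distrib diff_divide_distrib mult_ac)
    then have "(\<integral>\<^sup>+\<xi>. ennreal (1 / (1 + \<xi>\<^sup>2) * (1 - cos (u * \<xi> * y))) \<partial>lborel) = ennreal (pi * (1 - exp (- \<bar>u * y\<bar>)))"
      by (subst nn_integral_eq_integral) (auto simp: has_bochner_integral_iff)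
    then show ?thesis by (simp add: ennreal_mult'[symmetric])
  qed
  have "ennreal (pi / 2) * emeasure \<nu> {1 / u<..} = (\<integral>\<^sup>+y. ennreal (pi / 2) \<partial>\<nu>k)"
    by (simp add: totk)
  also have "\<dots> \<le> (\<integral>\<^sup>+y. ennreal (pi * (1 - exp (- \<bar>u * y\<bar>))) \<partial>\<nu>k)"
  proof (rule nn_integral_mono_AE)
    have "AE y in \<nu>k. 1 / u < y" unfolding \<nu>k_def by (subst AE_density) (auto simp: indicator_def)
    then show "AE y in \<nu>k. ennreal (pi / 2) \<le> ennreal (pi * (1 - exp (- \<bar>u * y\<bar>)))"
    proof eventually_elim
      case (elim y)
      then have "1 < u * y" using u by (simp add: field_simps)
      then have "exp (- \<bar>u * y\<bar>) \<le> exp (- 1)" by simp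
      also have "exp (- 1) \<le> (1 / 2 :: real)"
        using exp_ge_add_one_self[of "1::real"] by (simp add: exp_minus field_simps)
      finally have "pi * (1 / 2) \<le> pi * (1 - exp (- \<bar>u * y\<bar>))" by (intro mult_left_mono) auto
      then show ?case by (intro ennreal_leI) simp
    qed
  qed
  also have "\<dots> = (\<integral>\<^sup>+y. (\<integral>\<^sup>+\<xi>. ennreal (1 / (1 + \<xi>\<^sup>2)) * ennreal (1 - cos (u * \<xi> * y)) \<partial>lborel) \<partial>\<nu>k)"
    unfolding inner ..
  also have "\<dots> = (\<integral>\<^sup>+\<xi>. (\<integral>\<^sup>+y. ennreal (1 / (1 + \<xi>\<^sup>2)) * ennreal (1 - cos (u * \<xi> * y)) \<partial>\<nu>k) \<partial>lborel)"
    by (rule P.Fubini') measurable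
  also have "\<dots> \<le> (\<integral>\<^sup>+\<xi>. ennreal (1 / (1 + \<xi>\<^sup>2)) * ennreal (Re (\<sigma> (u * \<xi>))) \<partial>lborel)"
  proof (rule nn_integral_mono)
    fix \<xi> :: real
    have "(\<integral>\<^sup>+y. ennreal (1 / (1 + \<xi>\<^sup>2)) * ennreal (1 - cos (u * \<xi> * y)) \<partial>\<nu>k) = ennreal (1 / (1 + \<xi>\<^sup>2)) * (\<integral>\<^sup>+y. ennreal (1 - cos (u * \<xi> * y)) \<partial>\<nu>k)"
      by (rule nn_integral_cmult) measurable
    also have "(\<integral>\<^sup>+y. ennreal (1 - cos (u * \<xi> * y)) \<partial>\<nu>k) = (\<integral>\<^sup>+y. indicator {1 / u<..} y * ennreal (1 - cos (u * \<xi> * y)) \<partial>\<nu>)"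
      unfolding \<nu>k_def by (subst nn_integral_density) auto
    also have "\<dots> \<le> (\<integral>\<^sup>+y. ennreal (1 - cos (u * \<xi> * y)) \<partial>\<nu>)"
      by (intro nn_integral_mono) (auto simp: indicator_def)
    also have "\<dots> = ennreal (Re (\<sigma> (u * \<xi>)))"
      by (rule Levy_measure_Re_exponent[OF \<nu>, symmetric])
    finally show "(\<integral>\<^sup>+y. ennreal (1 / (1 + \<xi>\<^sup>2)) * ennreal (1 - cos (u * \<xi> * y)) \<partial>\<nu>k) \<le> ennreal (1 / (1 + \<xi>\<^sup>2)) * ennreal (Re (\<sigma> (u * \<xi>)))"
      by (simp add: mult_left_mono)
  qed
  finally show ?thesis by (simp add: u_def)
qed

context prob_space
begin

lemma subordinator_levy: "subordinator D \<Longrightarrow> levy_process D"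
  by (simp add: subordinator_def)

lemma subordinator_nonneg:
  assumes D: "subordinator D"
  shows "AE \<omega> in M. \<forall>t\<ge>0. 0 \<le> D t \<omega>"
proof -
  have "AE \<omega> in M. mono_on {0..} (\<lambda>t. D t \<omega>)" using D by (simp add: subordinator_def)
  then show ?thesis
    using levy_process_start[OF subordinator_levy[OF D]]
    by eventually_elim (metis atLeast_iff mono_onD order_refl)
qed

lemma subordinator_laplace_power:
  assumes D: "subordinator D" and t: "t \<ge> 0" and u: "u \<ge> 0"
  shows "expectation (\<lambda>\<omega>. exp (- \<bar>u * D t \<omega>\<bar>)) = (expectation (\<lambda>\<omega>. exp (- \<bar>u * D (t / real (Suc n)) \<omega>\<bar>))) ^ Suc n"
proof (cases "t = 0")
  case True
  have "expectation (\<lambda>\<omega>. exp (- \<bar>u * D 0 \<omega>\<bar>)) = expectation (\<lambda>\<omega>. 1)"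
    using levy_process_start[OF subordinator_levy[OF D]] levy_process_measurable[OF subordinator_levy[OF D], of 0]
    by (intro integral_cong_AE) auto
  then show ?thesis using True by (simp add: prob_space)
next
  case False
  then have t: "t > 0" using t by simp
  define h where "h = t / real (Suc n)"
  have h: "h > 0" using t by (simp add: h_def)
  have ht: "real (Suc n) * h = t" by (simp add: h_def del: of_nat_Suc)
  define I where "I j \<omega> = D (real (Suc j) * h) \<omega> - D (real j * h) \<omega>" for j \<omega>
  have [measurable]: "D (real j * h) \<in> borel_measurable M" for j
    using levy_process_measurable[OF subordinator_levy[OF D]] h by simp
  have [measurable]: "D h \<in> borel_measurable M"
    using levy_process_measurable[OF subordinator_levy[OF D]] h by simp
  have Im[measurable]: "I j \<in> borel_measurable M" for j unfolding I_def by measurable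
  have ind: "indep_vars (\<lambda>_. borel) I {..<Suc n}"
  proof -
    define s where "s j = real j * h" for j
    have "0 \<le> s 0 \<and> strict_mono_on {..Suc n} s \<longrightarrow> indep_vars (\<lambda>_. borel) (\<lambda>j \<omega>. D (s (Suc j)) \<omega> - D (s j) \<omega>) {..<Suc n}"
      using subordinator_levy[OF D] unfolding levy_process_def by blast
    moreover have "strict_mono_on {..Suc n} s"
      using h unfolding s_def by (intro strict_mono_onI mult_strict_right_mono) auto
    ultimately show ?thesis unfolding I_def s_def by simp
  qed
  have eq: "AE \<omega> in M. exp (- \<bar>u * D t \<omega>\<bar>) = (\<Prod>j<Suc n. exp (- \<bar>u * I j \<omega>\<bar>))"
  proof -
    have "AE \<omega> in M. mono_on {0..} (\<lambda>t. D t \<omega>)" using D by (simp add: subordinator_def)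
    then show ?thesis
      using levy_process_start[OF subordinator_levy[OF D]]
    proof eventually_elim
      case (elim \<omega>)
      have I: "0 \<le> I j \<omega>" for j
        using elim(1) h unfolding I_def by (auto intro!: mono_onD[OF elim(1)] mult_right_mono)
      have "(\<Sum>j<Suc n. I j \<omega>) = D (real (Suc n) * h) \<omega> - D (real 0 * h) \<omega>"
        unfolding I_def by (rule sum_lessThan_telescope)
      then have "D t \<omega> = (\<Sum>j<Suc n. I j \<omega>)" using elim(2) by (simp add: ht del: of_nat_Suc)
      moreover have "0 \<le> (\<Sum>j<Suc n. I j \<omega>)" using I by (intro sum_nonneg) auto
      ultimately have "\<bar>u * D t \<omega>\<bar> = u * (\<Sum>j<Suc n. I j \<omega>)"
        using u by (simp del: sum.lessThan_Suc)
      also have "\<dots> = (\<Sum>j<Suc n. \<bar>u * I j \<omega>\<bar>)"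
        unfolding sum_distrib_left using u I by (intro sum.cong) auto
      finally show ?case by (simp add: exp_sum[symmetric] sum_negf del: sum.lessThan_Suc prod.lessThan_Suc)
    qed
  qed
  have "expectation (\<lambda>\<omega>. exp (- \<bar>u * D t \<omega>\<bar>)) = expectation (\<lambda>\<omega>. \<Prod>j<Suc n. exp (- \<bar>u * I j \<omega>\<bar>))"
    using levy_process_measurable[OF subordinator_levy[OF D], of t] t eq by (intro integral_cong_AE) auto
  also have "\<dots> = (\<Prod>j<Suc n. expectation (\<lambda>\<omega>. exp (- \<bar>u * I j \<omega>\<bar>)))"
  proof (rule indep_vars_lebesgue_integral)
    show "indep_vars (\<lambda>_. borel) (\<lambda>j \<omega>. exp (- \<bar>u * I j \<omega>\<bar>)) {..<Suc n}"
      by (rule indep_vars_compose2[OF ind]) measurable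
    show "integrable M (\<lambda>\<omega>. exp (- \<bar>u * I j \<omega>\<bar>))" for j
      by (intro integrable_const_bound[of _ 1]) auto
  qed simp
  also have "\<dots> = (\<Prod>j<Suc n. expectation (\<lambda>\<omega>. exp (- \<bar>u * D h \<omega>\<bar>)))"
  proof (rule prod.cong[OF refl])
    fix j
    have "distr M borel (I j) = distr M borel (D h)"
      using levy_process_stationary[OF subordinator_levy[OF D], of "real j * h" h] h
      by (simp add: I_def[abs_def] ring_distribs add.commute)
    then have "(\<integral>x. exp (- \<bar>u * x\<bar>) \<partial>distr M borel (I j)) = (\<integral>x. exp (- \<bar>u * x\<bar>) \<partial>distr M borel (D h))" by simp
    then show "expectation (\<lambda>\<omega>. exp (- \<bar>u * I j \<omega>\<bar>)) = expectation (\<lambda>\<omega>. exp (- \<bar>u * D h \<omega>\<bar>))"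
      by (simp add: integral_distr)
  qed
  finally show ?thesis by (simp add: h_def)
qed

lemma subordinator_laplace_bound:
  assumes D: "subordinator D" and \<sigma>: "characteristic_exponent D \<sigma>"
    and \<nu>: "subordinator_drift_levy_measure \<sigma> 0 \<nu>" and t: "t \<ge> 0"
  shows "expectation (\<lambda>\<omega>. exp (- \<bar>real (Suc k) * D t \<omega>\<bar>)) \<le> exp (- (t * measure \<nu> {1 / real (Suc k)<..} / 2))"
proof -
  define u where "u = real (Suc k)"
  have u: "u > 0" by (simp add: u_def)
  define N where "N = measure \<nu> {1 / u<..}"
  have N: "emeasure \<nu> {1 / u<..} = ennreal N"
    using Levy_measure_tail_finite[OF \<nu>, of k] unfolding N_def u_def
    by (intro emeasure_eq_ennreal_measure) auto
  define L where "L = expectation (\<lambda>\<omega>. exp (- \<bar>u * D t \<omega>\<bar>))"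
  define a where "a n = expectation (\<lambda>\<omega>. exp (- \<bar>u * D (t / real (Suc n)) \<omega>\<bar>))" for n
  have L: "L = a n ^ Suc n" for n
    unfolding L_def a_def using u by (intro subordinator_laplace_power[OF D t]) simp
  have Dm: "D s \<in> borel_measurable M" if "s \<ge> 0" for s
    using levy_process_measurable[OF subordinator_levy[OF D] that] .
  obtain Z where Z: "regular_levy M Z \<sigma>"
    using levy_process_regular_version[OF subordinator_levy[OF D] \<sigma>] by blast
  interpret Z: regular_levy M Z \<sigma> by (rule Z)
  note Z.borel_measurable_exponent[measurable]
  have a: "0 \<le> a n" for n unfolding a_def by (rule Bochner_Integration.integral_nonneg) simp
  define q where "q n \<xi> = real (Suc n) * (1 - Re (exp (- (of_real t * \<sigma> (u * \<xi>) / of_nat (Suc n)))))" for n \<xi>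
  have qm[measurable]: "q n \<in> borel_measurable borel" for n unfolding q_def by measurable
  have q0: "0 \<le> q n \<xi>" for n \<xi>
  proof -
    have "Re (exp (- (of_real t * \<sigma> (u * \<xi>) / of_nat (Suc n)))) \<le> norm (exp (- (of_real t * \<sigma> (u * \<xi>) / of_nat (Suc n))))"
      by (rule complex_Re_le_cmod)
    also have "\<dots> \<le> 1" using t Z.Re_exponent_nonneg[of "u * \<xi>"] by (simp add: Re_divide_of_nat del: of_nat_Suc)
    finally show ?thesis by (simp add: q_def)
  qed
  have Iq: "has_bochner_integral lborel (\<lambda>\<xi>. 1 / (1 + \<xi>\<^sup>2) * q n \<xi>) (pi * (real (Suc n) * (1 - a n)))" for n
  proof -
    have [measurable]: "D (t / real (Suc n)) \<in> borel_measurable M" using t by (intro Dm) simp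
    have "expectation (\<lambda>\<omega>. iexp (\<xi> * (u * D (t / real (Suc n)) \<omega>))) = exp (- (of_real t * \<sigma> (u * \<xi>) / of_nat (Suc n)))" for \<xi>
    proof -
      have "expectation (\<lambda>\<omega>. iexp ((u * \<xi>) \<bullet> D (t / real (Suc n)) \<omega>)) = exp (- (of_real (t / real (Suc n)) * \<sigma> (u * \<xi>)))"
      proof -
        have "0 \<le> t / real (Suc n)" using t by simp
        then show ?thesis using \<sigma>[unfolded characteristic_exponent_def] by blast
      qed
      then show ?thesis by (simp add: mult_ac del: of_nat_Suc)
    qed
    then have *: "has_bochner_integral lborel (\<lambda>\<xi>. 1 / (1 + \<xi>\<^sup>2) * Re (exp (- (of_real t * \<sigma> (u * \<xi>) / of_nat (Suc n))))) (pi * a n)"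
      using expectation_exp_neg_abs[of "\<lambda>\<omega>. u * D (t / real (Suc n)) \<omega>"] by (simp add: a_def del: of_nat_Suc)
    have "has_bochner_integral lborel (\<lambda>\<xi>::real. 1 / (1 + \<xi>\<^sup>2)) pi"
    proof -
      have "has_bochner_integral lborel (\<lambda>\<xi>. Re (of_real (1 / (1 + \<xi>\<^sup>2)) * iexp (\<xi> * 0))) (Re (of_real (pi * exp (- \<bar>0\<bar>))))"
        using has_bochner_integral_Re[OF has_bochner_integral_integrable[OF integrable_cauchy_fourier[of 0]]]
        unfolding cauchy_fourier .
      then show ?thesis by simp
    qed
    from has_bochner_integral_mult_right[OF has_bochner_integral_diff[OF this *], of "real (Suc n)"]
    show ?thesis by (simp add: q_def algebra_simps del: of_nat_Suc)
  qed
  have qlim: "(\<lambda>n. q n \<xi>) \<longlonglongrightarrow> t * Re (\<sigma> (u * \<xi>))" for \<xi>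
  proof -
    have "(\<lambda>n. Re (of_nat (Suc n) * (1 - exp (- (of_real t * \<sigma> (u * \<xi>) / of_nat (Suc n)))))) \<longlonglongrightarrow> Re (of_real t * \<sigma> (u * \<xi>))"
      by (intro tendsto_Re LIMSEQ_exp_quotient)
    then show ?thesis by (simp add: q_def del: of_nat_Suc)
  qed
  have "ennreal t * (ennreal (pi / 2) * ennreal N) \<le> ennreal t * (\<integral>\<^sup>+\<xi>. ennreal (1 / (1 + \<xi>\<^sup>2)) * ennreal (Re (\<sigma> (u * \<xi>))) \<partial>lborel)"
    using Levy_measure_cauchy_lower[OF \<nu>, of k, folded u_def, unfolded N] by (rule mult_left_mono) simp
  also have "\<dots> = (\<integral>\<^sup>+\<xi>. ennreal (1 / (1 + \<xi>\<^sup>2) * (t * Re (\<sigma> (u * \<xi>)))) \<partial>lborel)"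
    using t Z.Re_exponent_nonneg
    by (subst nn_integral_cmult[symmetric]) (auto intro!: nn_integral_cong simp: ennreal_mult[symmetric] mult_ac)
  also have "\<dots> = (\<integral>\<^sup>+\<xi>. liminf (\<lambda>n. ennreal (1 / (1 + \<xi>\<^sup>2) * q n \<xi>)) \<partial>lborel)"
  proof (rule nn_integral_cong)
    fix \<xi> :: real
    have "(\<lambda>n. ennreal (1 / (1 + \<xi>\<^sup>2) * q n \<xi>)) \<longlonglongrightarrow> ennreal (1 / (1 + \<xi>\<^sup>2) * (t * Re (\<sigma> (u * \<xi>))))"
      by (intro tendsto_ennrealI tendsto_mult tendsto_const qlim)
    then show "ennreal (1 / (1 + \<xi>\<^sup>2) * (t * Re (\<sigma> (u * \<xi>)))) = liminf (\<lambda>n. ennreal (1 / (1 + \<xi>\<^sup>2) * q n \<xi>))"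
      by (intro lim_imp_Liminf[symmetric]) auto
  qed
  also have "\<dots> \<le> liminf (\<lambda>n. \<integral>\<^sup>+\<xi>. ennreal (1 / (1 + \<xi>\<^sup>2) * q n \<xi>) \<partial>lborel)"
    by (intro nn_integral_liminf) measurable
  also have "(\<lambda>n. \<integral>\<^sup>+\<xi>. ennreal (1 / (1 + \<xi>\<^sup>2) * q n \<xi>) \<partial>lborel) = (\<lambda>n. ennreal (pi * (real (Suc n) * (1 - a n))))"
  proof
    fix n
    show "(\<integral>\<^sup>+\<xi>. ennreal (1 / (1 + \<xi>\<^sup>2) * q n \<xi>) \<partial>lborel) = ennreal (pi * (real (Suc n) * (1 - a n)))"
      using Iq[of n] q0 by (subst nn_integral_eq_integral) (auto simp: has_bochner_integral_iff)
  qed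
  finally have main: "ennreal t * (ennreal (pi / 2) * ennreal N) \<le> liminf (\<lambda>n. ennreal (pi * (real (Suc n) * (1 - a n))))" .
  show ?thesis
  proof (cases "L \<le> 0")
    case True
    then show ?thesis unfolding L_def u_def by (rule order_trans) simp
  next
    case False
    have le: "real (Suc n) * (1 - a n) \<le> - ln L" for n
    proof -
      have "a n \<le> exp (- (1 - a n))" using exp_ge_add_one_self[of "a n - 1"] by simp
      then have "L \<le> exp (- (1 - a n)) ^ Suc n" unfolding L[of n] using a by (rule power_mono)
      also have "\<dots> = exp (- (real (Suc n) * (1 - a n)))" by (simp only: exp_of_nat_mult[symmetric] mult_minus_right)
      finally have "ln L \<le> - (real (Suc n) * (1 - a n))" using False by (simp only: ln_le_cancel_iff[symmetric] ln_exp not_le exp_gt_zero)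
      then show ?thesis by simp
    qed
    have "liminf (\<lambda>n. ennreal (pi * (real (Suc n) * (1 - a n)))) \<le> liminf (\<lambda>n::nat. ennreal (pi * (- ln L)))"
      by (intro Liminf_mono always_eventually allI ennreal_leI mult_left_mono le) auto
    then have "ennreal (t * (pi / 2 * N)) \<le> ennreal (pi * (- ln L))"
      using main t by (simp add: Liminf_const ennreal_mult[symmetric] N_def)
    moreover have "L \<le> 1"
    proof -
      have [measurable]: "D t \<in> borel_measurable M" by (rule Dm[OF t])
      have "L \<le> expectation (\<lambda>\<omega>. 1)" unfolding L_def
        by (intro integral_mono integrable_const_bound[of _ 1]) auto
      then show ?thesis by (simp add: prob_space)
    qed
    ultimately have "t * (pi / 2 * N) \<le> pi * (- ln L)"
      using False by (subst (asm) ennreal_le_iff) (auto simp: ln_le_zero_iff mult_nonneg_nonpos)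
    then have "pi * (t * N / 2) \<le> pi * (- ln L)" by (simp add: mult_ac)
    then have "t * N / 2 \<le> - ln L" by (rule mult_left_le_imp_le) simp
    then have "ln L \<le> - (t * N / 2)" by linarith
    then have "exp (ln L) \<le> exp (- (t * N / 2))" by (simp only: exp_le_cancel_iff)
    moreover have "exp (ln L) = L" using False by (intro exp_ln) simp
    ultimately have "L \<le> exp (- (t * N / 2))" by simp
    then show ?thesis unfolding L_def N_def u_def .
  qed
qed

lemma Levy_measure_tail_tendsto:
  assumes "sets \<nu> = sets borel"
  shows "(\<lambda>k. emeasure \<nu> {1 / real (Suc k)<..}) \<longlonglongrightarrow> emeasure \<nu> {0<..}"
proof -
  have union: "(\<Union>k. {1 / real (Suc k)<..}) = {0::real<..}"
  proof (intro equalityI subsetI)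
    fix x :: real assume "x \<in> {0<..}"
    then obtain k where "inverse (real (Suc k)) < x" using reals_Archimedean[of x] by auto
    then show "x \<in> (\<Union>k. {1 / real (Suc k)<..})" by (auto simp: inverse_eq_divide simp del: of_nat_Suc)
  qed (auto simp del: of_nat_Suc intro: order.strict_trans2[rotated] order.strict_trans[rotated])
  have inc: "incseq (\<lambda>k. {1 / real (Suc k)<..})"
  proof (rule incseq_SucI)
    fix k
    have "1 / real (Suc (Suc k)) \<le> 1 / real (Suc k)" by (intro divide_left_mono) auto
    then show "{1 / real (Suc k)<..} \<subseteq> {1 / real (Suc (Suc k))<..}"
      by (simp only: greaterThan_subset_iff)
  qed
  have "range (\<lambda>k. {1 / real (Suc k)<..}) \<subseteq> sets \<nu>"
    by (rule image_subsetI) (simp add: assms)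
  from Lim_emeasure_incseq[OF this inc] show ?thesis by (simp only: union)
qed

lemma subordinator_prob_zero:
  assumes D: "subordinator D" and \<sigma>: "characteristic_exponent D \<sigma>"
    and \<nu>: "subordinator_drift_levy_measure \<sigma> 0 \<nu>" and inf: "emeasure \<nu> {0<..} = \<infinity>" and t: "t > 0"
  shows "AE \<omega> in M. D t \<omega> \<noteq> 0"
proof -
  have [measurable]: "D t \<in> borel_measurable M"
    using levy_process_measurable[OF subordinator_levy[OF D]] t by simp
  define p where "p = prob {\<omega>\<in>space M. D t \<omega> = 0}"
  have le: "p \<le> exp (- (t * measure \<nu> {1 / real (Suc k)<..} / 2))" for k
  proof -
    have "p = expectation (indicator {\<omega>\<in>space M. D t \<omega> = 0})"
      unfolding p_def by simp
    also have "\<dots> \<le> expectation (\<lambda>\<omega>. exp (- \<bar>real (Suc k) * D t \<omega>\<bar>))"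
      by (intro integral_mono integrable_const_bound[of _ 1]) (auto simp: indicator_def)
    also have "\<dots> \<le> exp (- (t * measure \<nu> {1 / real (Suc k)<..} / 2))"
      using t by (intro subordinator_laplace_bound[OF D \<sigma> \<nu>]) simp
    finally show ?thesis .
  qed
  have "p \<le> 0"
  proof (rule ccontr)
    assume "\<not> p \<le> 0"
    then have p: "p > 0" by simp
    define B where "B = - 2 * ln p / t"
    have bound: "measure \<nu> {1 / real (Suc k)<..} \<le> B" for k
    proof -
      have "ln p \<le> - (t * measure \<nu> {1 / real (Suc k)<..} / 2)"
        using le[of k] p by (metis exp_gt_zero ln_exp ln_le_cancel_iff)
      then have "t * measure \<nu> {1 / real (Suc k)<..} \<le> - 2 * ln p" by linarith
      then have "measure \<nu> {1 / real (Suc k)<..} * t \<le> - 2 * ln p" by (simp only: mult.commute)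
      then show ?thesis unfolding B_def by (simp only: pos_le_divide_eq[OF t])
    qed
    have "emeasure \<nu> {0<..} \<le> ennreal B"
    proof (rule LIMSEQ_le_const2[OF Levy_measure_tail_tendsto])
      show "sets \<nu> = sets borel" using \<nu> by (simp add: subordinator_drift_levy_measure_def)
      have "emeasure \<nu> {1 / real (Suc k)<..} \<le> ennreal B" for k
        using bound[of k] Levy_measure_tail_finite[OF \<nu>, of k]
        by (subst emeasure_eq_ennreal_measure) (auto intro: ennreal_leI)
      then show "\<exists>N. \<forall>k\<ge>N. emeasure \<nu> {1 / real (Suc k)<..} \<le> ennreal B" by blast
    qed
    then show False using inf by (simp add: top_unique)
  qed
  then have "p = 0" using measure_nonneg[of M] unfolding p_def by (intro antisym) auto
  then have "emeasure M {\<omega>\<in>space M. D t \<omega> = 0} = 0" by (simp add: p_def emeasure_eq_measure)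
  then show ?thesis by (subst AE_iff_measurable[OF _ refl]) auto
qed

lemma subordinator_strict_mono:
  assumes D: "subordinator D" and \<sigma>: "characteristic_exponent D \<sigma>"
    and \<nu>: "subordinator_drift_levy_measure \<sigma> 0 \<nu>" and inf: "emeasure \<nu> {0<..} = \<infinity>"
  shows "AE \<omega> in M. strict_mono_on {0..} (\<lambda>t. D t \<omega>)"
proof -
  have Dm: "D s \<in> borel_measurable M" if "s \<ge> 0" for s
    using levy_process_measurable[OF subordinator_levy[OF D] that] .
  have ne: "AE \<omega> in M. D p \<omega> \<noteq> D q \<omega>" if "0 \<le> p" "p < q" for p q
  proof -
    have [measurable]: "D p \<in> borel_measurable M" "D q \<in> borel_measurable M" "D (q - p) \<in> borel_measurable M"
      using that by (auto intro!: Dm)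
    have "AE x in distr M borel (D (q - p)). x \<noteq> 0"
      using subordinator_prob_zero[OF D \<sigma> \<nu> inf, of "q - p"] that by (subst AE_distr_iff) auto
    also have "distr M borel (D (q - p)) = distr M borel (\<lambda>\<omega>. D q \<omega> - D p \<omega>)"
      using levy_process_stationary[OF subordinator_levy[OF D], of p "q - p"] that by simp
    finally show ?thesis by (subst (asm) AE_distr_iff) auto
  qed
  have "AE \<omega> in M. \<forall>p q :: rat. 0 \<le> p \<longrightarrow> p < q \<longrightarrow> D (of_rat p) \<omega> \<noteq> D (of_rat q) \<omega>"
    unfolding AE_all_countable using ne by (auto simp: of_rat_less)
  moreover have "AE \<omega> in M. mono_on {0..} (\<lambda>t. D t \<omega>)" using D by (simp add: subordinator_def)
  ultimately show ?thesis
  proof eventually_elim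
    case (elim \<omega>)
    show ?case
    proof (rule strict_mono_onI)
      fix s t :: real assume st: "s \<in> {0..}" "t \<in> {0..}" "s < t"
      obtain p where p: "s < of_rat p" "of_rat p < t" using of_rat_dense[OF st(3)] by blast
      obtain q where q: "of_rat p < (of_rat q :: real)" "of_rat q < t" using of_rat_dense[OF p(2)] by blast
      have p0: "(0::real) \<le> of_rat p" using st(1) p(1) by (simp del: zero_le_of_rat_iff)
      then have "0 \<le> p" "p < q" using q(1) by (simp_all add: of_rat_less)
      then have "D (of_rat p) \<omega> \<noteq> D (of_rat q) \<omega>" using elim(1) by blast
      moreover have "D s \<omega> \<le> D (of_rat p) \<omega>" "D (of_rat p) \<omega> \<le> D (of_rat q) \<omega>" "D (of_rat q) \<omega> \<le> D t \<omega>"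
        using st p q p0 order_trans[OF p0 less_imp_le[OF q(1)]]
        by (auto intro!: mono_onD[OF elim(2)] simp del: zero_le_of_rat_iff of_rat_less of_rat_less_eq)
      ultimately show "D s \<omega> < D t \<omega>" by linarith
    qed
  qed
qed

lemma subordinator_unbounded:
  assumes D: "subordinator D" and \<sigma>: "characteristic_exponent D \<sigma>"
    and \<nu>: "subordinator_drift_levy_measure \<sigma> 0 \<nu>" and inf: "emeasure \<nu> {0<..} = \<infinity>"
  shows "AE \<omega> in M. \<exists>t\<ge>0. D t \<omega> > 1"
proof -
  have [measurable]: "D (real n) \<in> borel_measurable M" for n
    using levy_process_measurable[OF subordinator_levy[OF D]] by simp
  have "\<exists>k. measure \<nu> {1 / real (Suc k)<..} > 0"
  proof (rule ccontr)
    assume "\<not> ?thesis"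
    then have "measure \<nu> {1 / real (Suc k)<..} = 0" for k
      using measure_nonneg[of \<nu>] by (simp add: not_less antisym)
    then have "emeasure \<nu> {1 / real (Suc k)<..} = 0" for k
      using Levy_measure_tail_finite[OF \<nu>, of k] by (subst emeasure_eq_ennreal_measure) auto
    moreover have "sets \<nu> = sets borel" using \<nu> by (simp add: subordinator_drift_levy_measure_def)
    ultimately have "(\<lambda>k::nat. 0) \<longlonglongrightarrow> emeasure \<nu> {0<..}" using Levy_measure_tail_tendsto[of \<nu>] by simp
    then show False using inf by (simp add: LIMSEQ_const_iff)
  qed
  then obtain k where k: "measure \<nu> {1 / real (Suc k)<..} > 0" by blast
  define N where "N = measure \<nu> {1 / real (Suc k)<..}"
  define A where "A n = {\<omega>\<in>space M. \<bar>D (real n) \<omega>\<bar> \<le> 1}" for n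
  have [measurable]: "A n \<in> sets M" for n unfolding A_def by measurable
  have le: "prob (\<Inter>n. A n) \<le> exp (real (Suc k)) * exp (- (real n * N / 2))" for n
  proof -
    have "exp (- real (Suc k)) * prob (\<Inter>n. A n) \<le> exp (- real (Suc k)) * prob (A n)"
      by (intro mult_left_mono finite_measure_mono) auto
    also have "\<dots> = expectation (\<lambda>\<omega>. exp (- real (Suc k)) * indicator (A n) \<omega>)" by simp
    also have "\<dots> \<le> expectation (\<lambda>\<omega>. exp (- \<bar>real (Suc k) * D (real n) \<omega>\<bar>))"
    proof (intro integral_mono integrable_const_bound[of _ 1])
      fix \<omega>
      show "exp (- real (Suc k)) * indicator (A n) \<omega> \<le> exp (- \<bar>real (Suc k) * D (real n) \<omega>\<bar>)"
        by (auto simp: A_def indicator_def abs_mult mult_left_le simp del: of_nat_Suc)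
    qed (auto simp: indicator_def)
    also have "\<dots> \<le> exp (- (real n * N / 2))"
      unfolding N_def by (intro subordinator_laplace_bound[OF D \<sigma> \<nu>]) simp
    finally have "exp (real (Suc k)) * (exp (- real (Suc k)) * prob (\<Inter>n. A n)) \<le> exp (real (Suc k)) * exp (- (real n * N / 2))"
      by (rule mult_left_mono) simp
    moreover have "exp (real (Suc k)) * (exp (- real (Suc k)) * prob (\<Inter>n. A n)) = prob (\<Inter>n. A n)"
      unfolding mult.assoc[symmetric] exp_add[symmetric] by simp
    ultimately show ?thesis by (simp only:)
  qed
  have "(\<lambda>n. exp (real (Suc k)) * exp (- (real n * N / 2))) \<longlonglongrightarrow> 0"
    using k unfolding N_def[symmetric] by real_asymp
  then have "prob (\<Inter>n. A n) \<le> 0"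
    by (rule LIMSEQ_le_const) (use le in blast)
  then have "emeasure M (\<Inter>n. A n) = 0" by (simp add: emeasure_eq_measure measure_le_0_iff)
  then have "AE \<omega> in M. \<omega> \<notin> (\<Inter>n. A n)" by (intro AE_not_in) auto
  then show ?thesis
    using AE_space subordinator_nonneg[OF D]
  proof eventually_elim
    case (elim \<omega>)
    then obtain n where "\<bar>D (real n) \<omega>\<bar> > 1" by (auto simp: A_def not_le)
    then show ?case using elim(3) by (intro exI[of _ "real n"]) auto
  qed
qed

end

section \<open>Indices\<close>

lemma Liminf_at_right_0_eq_0_iff:
  fixes f :: "real \<Rightarrow> real"
  assumes nn: "eventually (\<lambda>r. 0 \<le> f r) (at_right 0)"
  shows "Liminf (at_right 0) (\<lambda>r. ereal (f r)) = 0 \<longleftrightarrow> (\<forall>\<epsilon>>0. \<exists>\<^sub>F r in at_right 0. f r < \<epsilon>)"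
proof
  assume L: "Liminf (at_right 0) (\<lambda>r. ereal (f r)) = 0"
  show "\<forall>\<epsilon>>0. \<exists>\<^sub>F r in at_right 0. f r < \<epsilon>"
  proof (intro allI impI, rule ccontr)
    fix \<epsilon> :: real assume \<epsilon>: "\<epsilon> > 0" and "\<not> (\<exists>\<^sub>F r in at_right 0. f r < \<epsilon>)"
    then have "eventually (\<lambda>r. ereal \<epsilon> \<le> ereal (f r)) (at_right 0)"
      by (simp add: not_frequently not_less)
    then have "ereal \<epsilon> \<le> Liminf (at_right 0) (\<lambda>r. ereal (f r))" by (rule Liminf_bounded)
    then show False using L \<epsilon> by simp
  qed
next
  assume R: "\<forall>\<epsilon>>0. \<exists>\<^sub>F r in at_right 0. f r < \<epsilon>"
  have "0 \<le> Liminf (at_right 0) (\<lambda>r. ereal (f r))"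
    using nn by (intro Liminf_bounded) (auto elim: eventually_mono)
  moreover have "\<not> 0 < Liminf (at_right 0) (\<lambda>r. ereal (f r))"
  proof
    assume "0 < Liminf (at_right 0) (\<lambda>r. ereal (f r))"
    then obtain y where y: "0 < ereal y" "ereal y < Liminf (at_right 0) (\<lambda>r. ereal (f r))"
      using ereal_dense2 by blast
    from y(2) have "eventually (\<lambda>r. ereal y < ereal (f r)) (at_right 0)" by (rule less_LiminfD)
    then have "\<not> (\<exists>\<^sub>F r in at_right 0. f r < y)"
      unfolding not_frequently by eventually_elim simp
    then show False using R y(1) by simp
  qed
  ultimately show "Liminf (at_right 0) (\<lambda>r. ereal (f r)) = 0" by (metis order_le_less)
qed

lemma liminf_index_le_of_le:
  assumes c: "c > 0" and le: "eventually (\<lambda>r. V r \<le> c * V' r) (at_right 0)"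
    and nn: "eventually (\<lambda>r. 0 \<le> V r) (at_right 0)"
  shows "liminf_index V' \<le> liminf_index V"
  unfolding liminf_index_def
proof (rule Sup_subset_mono, safe)
  fix \<gamma> :: real
  assume \<gamma>: "0 \<le> \<gamma>" "Liminf (at_right 0) (\<lambda>r. ereal (V' r / r powr \<gamma>)) = 0"
  have nn': "eventually (\<lambda>r. 0 \<le> V r / r powr \<gamma>) (at_right 0)"
    using nn by eventually_elim simp
  have nn'': "eventually (\<lambda>r. 0 \<le> V' r / r powr \<gamma>) (at_right 0)"
    using nn le
  proof eventually_elim
    case (elim r)
    then have "0 \<le> c * V' r" by linarith
    then show ?case using c by (simp add: zero_le_mult_iff)
  qed
  have "\<forall>\<epsilon>>0. \<exists>\<^sub>F r in at_right 0. V r / r powr \<gamma> < \<epsilon>"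
  proof (intro allI impI)
    fix \<epsilon> :: real assume \<epsilon>: "\<epsilon> > 0"
    then have "\<exists>\<^sub>F r in at_right 0. V' r / r powr \<gamma> < \<epsilon> / c"
      using \<gamma>(2) c unfolding Liminf_at_right_0_eq_0_iff[OF nn''] by simp
    then have "\<exists>\<^sub>F r in at_right 0. V' r / r powr \<gamma> < \<epsilon> / c \<and> V r \<le> c * V' r"
      using le by (rule frequently_eventually_frequently)
    then show "\<exists>\<^sub>F r in at_right 0. V r / r powr \<gamma> < \<epsilon>"
    proof (rule frequently_elim1)
      fix r assume *: "V' r / r powr \<gamma> < \<epsilon> / c \<and> V r \<le> c * V' r"
      then have "V r / r powr \<gamma> \<le> c * V' r / r powr \<gamma>" by (intro divide_right_mono) auto
      also have "c * V' r / r powr \<gamma> = c * (V' r / r powr \<gamma>)" by simp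
      also have "\<dots> < c * (\<epsilon> / c)" using * c by (intro mult_strict_left_mono) auto
      finally show "V r / r powr \<gamma> < \<epsilon>" using c by simp
    qed
  qed
  then have "Liminf (at_right 0) (\<lambda>r. ereal (V r / r powr \<gamma>)) = 0"
    unfolding Liminf_at_right_0_eq_0_iff[OF nn'] .
  then show "\<exists>\<gamma>'. ennreal \<gamma> = ennreal \<gamma>' \<and> 0 \<le> \<gamma>' \<and> Liminf (at_right 0) (\<lambda>r. ereal (V r / r powr \<gamma>')) = 0"
    using \<gamma>(1) by blast
qed

lemma liminf_index_lessD:
  assumes lt: "liminf_index V < ennreal s" and nn: "eventually (\<lambda>r. 0 \<le> V r) (at_right 0)"
  obtains c g where "0 < c" "0 < g" "g < s" "eventually (\<lambda>r. c * r powr g \<le> V r) (at_right 0)"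
proof -
  obtain x where x: "liminf_index V < x" "x < ennreal s" using dense[OF lt] by blast
  obtain g where xg: "x = ennreal g" and g0: "0 \<le> g" using x(2) by (cases x rule: ennreal_cases) auto
  have g: "0 < g" "g < s"
  proof -
    have "0 < x" using x(1) by (rule order.strict_trans1[rotated]) simp
    then show "0 < g" unfolding xg by simp
    then show "g < s" using x(2) unfolding xg by (simp add: ennreal_less_iff)
  qed
  have nn': "eventually (\<lambda>r. 0 \<le> V r / r powr g) (at_right 0)"
    using nn by eventually_elim simp
  have "Liminf (at_right 0) (\<lambda>r. ereal (V r / r powr g)) \<noteq> 0"
  proof
    assume "Liminf (at_right 0) (\<lambda>r. ereal (V r / r powr g)) = 0"
    then have "ennreal g \<le> liminf_index V"
      unfolding liminf_index_def using g by (intro Sup_upper) auto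
    then show False using x(1) unfolding xg by simp
  qed
  then obtain c where c: "c > 0" "\<not> (\<exists>\<^sub>F r in at_right 0. V r / r powr g < c)"
    unfolding Liminf_at_right_0_eq_0_iff[OF nn'] by blast
  from c(2) have "eventually (\<lambda>r. c \<le> V r / r powr g) (at_right 0)"
    by (simp add: not_frequently not_less)
  then have "eventually (\<lambda>r. c * r powr g \<le> V r) (at_right 0)"
    using eventually_at_right_less[of "0::real"] by eventually_elim (simp add: pos_le_divide_eq)
  then show ?thesis using that c(1) g by blast
qed

lemma (in regular_levy) exponent_index_fun_nonneg: "0 \<le> exponent_index_fun \<Phi> r"
  unfolding exponent_index_fun_def
proof (intro Bochner_Integration.integral_nonneg mult_nonneg_nonneg cauchy_kernel_nonneg)
  show "0 \<le> Re (1 / (1 + \<Phi> (\<xi> /\<^sub>R r)))" for \<xi>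
    using Re_exponent_nonneg[of "\<xi> /\<^sub>R r"] by (simp add: Re_divide)
qed

lemma (in prob_space) levy_process_packing:
  fixes X :: "real \<Rightarrow> 'a \<Rightarrow> 'b::euclidean_space"
  assumes X: "levy_process X" and \<Phi>: "characteristic_exponent X \<Phi>"
  shows "AE \<omega> in M. (\<forall>s a. liminf_index (exponent_index_fun \<Phi>) < ennreal s \<longrightarrow> packing_premeasure s ((\<lambda>t. X t \<omega>) ` {0..<real (a::nat)}) = 0)
      \<and> (\<forall>s a. 0 < a \<longrightarrow> 0 \<le> s \<longrightarrow> ennreal s < liminf_index (exponent_index_fun \<Phi>) \<longrightarrow> packing_measure s ((\<lambda>t. X t \<omega>) ` {0..<a}) \<noteq> 0)"
proof -
  obtain Z where Z: "regular_levy M Z \<Phi>" and eq: "AE \<omega> in M. \<forall>t\<ge>0. Z t \<omega> = X t \<omega>"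
    by (rule levy_process_regular_version[OF X \<Phi>])
  interpret Z: regular_levy M Z \<Phi> by (rule Z)
  define I where "I = liminf_index (exponent_index_fun \<Phi>)"
  have up: "AE \<omega> in M. \<forall>q::rat. I < ennreal (of_rat q) \<longrightarrow> (\<forall>a::nat. packing_premeasure (of_rat q) ((\<lambda>t. Z t \<omega>) ` {0..<real a}) = 0)"
    unfolding AE_all_countable
  proof
    fix q :: rat
    show "AE \<omega> in M. I < ennreal (of_rat q) \<longrightarrow> (\<forall>a::nat. packing_premeasure (of_rat q) ((\<lambda>t. Z t \<omega>) ` {0..<real a}) = 0)"
    proof (cases "I < ennreal (of_rat q)")
      case True
      obtain c g where "0 < c" "0 < g" "g < of_rat q" "eventually (\<lambda>r. c * r powr g \<le> exponent_index_fun \<Phi> r) (at_right 0)"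
        using True unfolding I_def by (rule liminf_index_lessD) (simp add: Z.exponent_index_fun_nonneg)
      from Z.AE_packing_premeasure_zero[OF this(1,4,2,3)] show ?thesis by auto
    qed simp
  qed
  have low: "AE \<omega> in M. \<forall>q::rat. \<forall>k::nat. 0 \<le> q \<longrightarrow> ennreal (of_rat q) < I \<longrightarrow> packing_measure (of_rat q) ((\<lambda>t. Z t \<omega>) ` {0..<1 / real (Suc k)}) \<noteq> 0"
    unfolding AE_all_countable
  proof (intro allI)
    fix q :: rat and k :: nat
    show "AE \<omega> in M. 0 \<le> q \<longrightarrow> ennreal (of_rat q) < I \<longrightarrow> packing_measure (of_rat q) ((\<lambda>t. Z t \<omega>) ` {0..<1 / real (Suc k)}) \<noteq> 0"
    proof (cases "0 \<le> q \<and> ennreal (of_rat q) < I")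
      case True
      then obtain \<gamma> where \<gamma>: "0 \<le> \<gamma>" "Liminf (at_right 0) (\<lambda>r. ereal (exponent_index_fun \<Phi> r / r powr \<gamma>)) = 0" "ennreal (of_rat q) < ennreal \<gamma>"
        unfolding I_def liminf_index_def less_Sup_iff by auto
      have q\<gamma>: "of_rat q \<le> \<gamma>" using \<gamma>(1,3) True by (simp add: ennreal_less_iff)
      have "AE \<omega> in M. packing_measure \<gamma> ((\<lambda>t. Z t \<omega>) ` {0..<1 / real (Suc k)}) \<noteq> 0"
        using \<gamma>(2) by (rule Z.AE_packing_measure_nonzero) simp
      then show ?thesis
        by eventually_elim (use packing_measure_antimono_exponent[OF q\<gamma>] in \<open>metis le_zero_eq\<close>)
    qed auto
  qed
  show ?thesis
    using eq up low unfolding I_def[symmetric]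
  proof eventually_elim
    case (elim \<omega>)
    have img: "(\<lambda>t. Z t \<omega>) ` {0..<a} = (\<lambda>t. X t \<omega>) ` {0..<a}" for a :: real
      using elim(1) by (intro image_cong) auto
    show ?case
    proof (intro conjI allI impI)
      fix s :: real and a :: nat assume "I < ennreal s"
      then obtain x where x: "I < x" "x < ennreal s" using dense by blast
      obtain g where xg: "x = ennreal g" and g0: "0 \<le> g" using x(2) by (cases x rule: ennreal_cases) auto
      have "g < s" using x(2) g0 unfolding xg by (simp add: ennreal_less_iff)
      then obtain q where q: "g < of_rat q" "of_rat q < s" using of_rat_dense by blast
      have "ennreal g \<le> ennreal (of_rat q)" using q(1) by (intro ennreal_leI) simp
      with x(1) have "I < ennreal (of_rat q)" unfolding xg by (rule order.strict_trans2)
      then have "packing_premeasure (of_rat q) ((\<lambda>t. Z t \<omega>) ` {0..<real a}) = 0" using elim(2) by blast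
      then show "packing_premeasure s ((\<lambda>t. X t \<omega>) ` {0..<real a}) = 0"
        using packing_premeasure_antimono_exponent[of "of_rat q" s "(\<lambda>t. X t \<omega>) ` {0..<real a}"] q(2) unfolding img
        by simp
    next
      fix s a :: real assume a: "0 < a" and s: "0 \<le> s" "ennreal s < I"
      obtain x where x: "ennreal s < x" "x < I" using dense[OF s(2)] by blast
      obtain g where xg: "x = ennreal g" and g0: "0 \<le> g" using x(2) by (cases x rule: ennreal_cases) auto
      have "s < g" using x(1) s(1) unfolding xg by (simp add: ennreal_less_iff)
      then obtain q where q: "s < of_rat q" "of_rat q < g" using of_rat_dense by blast
      have q0: "0 \<le> q" using order.strict_trans1[OF s(1) q(1)] by simp
      have "ennreal (of_rat q) \<le> ennreal g" using q(2) by (intro ennreal_leI) simp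
      then have "ennreal (of_rat q) < I" using x(2) unfolding xg by (rule order.strict_trans1)
      obtain k where k: "1 / real (Suc k) < a" using reals_Archimedean[OF a] by (auto simp: inverse_eq_divide)
      have "packing_measure (of_rat q) ((\<lambda>t. Z t \<omega>) ` {0..<1 / real (Suc k)}) \<noteq> 0"
        using elim(3) q0 \<open>ennreal (of_rat q) < I\<close> by blast
      moreover have "packing_measure (of_rat q) ((\<lambda>t. Z t \<omega>) ` {0..<1 / real (Suc k)}) \<le> packing_measure s ((\<lambda>t. Z t \<omega>) ` {0..<1 / real (Suc k)})"
        using q(1) by (intro packing_measure_antimono_exponent) simp
      moreover have "\<dots> \<le> packing_measure s ((\<lambda>t. Z t \<omega>) ` {0..<a})"
        using k by (intro packing_measure_mono image_mono) auto
      ultimately show "packing_measure s ((\<lambda>t. X t \<omega>) ` {0..<a}) \<noteq> 0"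
        unfolding img by (metis le_zero_eq)
    qed
  qed
qed

lemma cauchy_kernel_le_1: "cauchy_kernel \<xi> \<le> 1"
  unfolding cauchy_kernel_def
  by (intro prod_le_1 conjI divide_le_eq_1_pos[THEN iffD2]) (auto intro: add_pos_nonneg)

lemma Re_inverse_bounds:
  assumes "0 \<le> Re z"
  shows "0 < Re (1 / (1 + z))" "Re (1 / (1 + z)) \<le> 1"
proof -
  have nz: "1 + z \<noteq> 0" using assms by (auto simp: complex_eq_iff)
  then have "0 < (1 + Re z)\<^sup>2 + (Im z)\<^sup>2" using assms by (auto intro!: add_pos_nonneg)
  then show "0 < Re (1 / (1 + z))" using assms by (simp add: Re_divide)
  have "1 \<le> Re (1 + z)" using assms by simp
  also have "\<dots> \<le> norm (1 + z)" by (rule complex_Re_le_cmod)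
  finally have "norm (1 / (1 + z)) \<le> 1" by (simp add: norm_divide divide_le_eq)
  then show "Re (1 / (1 + z)) \<le> 1" using complex_Re_le_cmod[of "1 / (1 + z)"] by linarith
qed

lemma lborel_integral_scaleR:
  fixes f :: "'a::euclidean_space \<Rightarrow> real"
  assumes [measurable]: "f \<in> borel_measurable borel" and r: "r > 0"
  shows "(\<integral>x. f x \<partial>lborel) = r ^ DIM('a) * (\<integral>x. f (r *\<^sub>R x) \<partial>lborel)"
proof -
  have "(\<integral>x. f x \<partial>lborel) = (\<integral>x. f x \<partial>density (distr lborel borel (\<lambda>x. 0 + r *\<^sub>R x)) (\<lambda>_. ennreal (\<bar>r\<bar> ^ DIM('a))))"
    using lborel_affine[of r "0 :: 'a"] r by simp
  also have "\<dots> = (\<integral>x. (\<bar>r\<bar> ^ DIM('a)) *\<^sub>R f x \<partial>distr lborel borel (\<lambda>x. 0 + r *\<^sub>R x))"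
    using r by (intro integral_density) auto
  also have "\<dots> = (\<integral>x. (\<bar>r\<bar> ^ DIM('a)) *\<^sub>R f (0 + r *\<^sub>R x) \<partial>lborel)"
    by (rule integral_distr) auto
  finally show ?thesis using r by simp
qed

text \<open>Near the origin both integrands are bounded, which costs a multiple of \<open>r ^ n\<close>; every
  exponent satisfies a lower bound of that order.\<close>

lemma exponent_index_fun_le_of_le:
  fixes \<Phi> \<Phi>' :: "'b::euclidean_space \<Rightarrow> complex"
  assumes m[measurable]: "\<Phi> \<in> borel_measurable borel" "\<Phi>' \<in> borel_measurable borel"
    and pos: "\<And>\<xi>. 0 \<le> Re (\<Phi> \<xi>)" "\<And>\<xi>. 0 \<le> Re (\<Phi>' \<xi>)" and K: "K \<ge> 0"
    and le: "\<And>\<xi>. R \<le> norm \<xi> \<Longrightarrow> Re (1 / (1 + \<Phi> \<xi>)) \<le> K * Re (1 / (1 + \<Phi>' \<xi>))"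
  obtains c where "c > 0" "eventually (\<lambda>r. exponent_index_fun \<Phi> r \<le> c * exponent_index_fun \<Phi>' r) (at_right 0)"
proof -
  define n where "n = DIM('b)"
  define g where "g \<xi> = Re (1 / (1 + \<Phi> \<xi>))" for \<xi>
  define g' where "g' \<xi> = Re (1 / (1 + \<Phi>' \<xi>))" for \<xi>
  note gb = Re_inverse_bounds[OF pos(1), folded g_def] and gb' = Re_inverse_bounds[OF pos(2), folded g'_def]
  have [measurable]: "g \<in> borel_measurable borel" "g' \<in> borel_measurable borel"
    unfolding g_def g'_def by measurable
  have int: "integrable lborel (\<lambda>\<xi>. g (\<xi> /\<^sub>R r) * cauchy_kernel \<xi>)" "integrable lborel (\<lambda>\<xi>. g' (\<xi> /\<^sub>R r) * cauchy_kernel \<xi>)" for r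
    using gb gb' less_imp_le[OF gb(1)] less_imp_le[OF gb'(1)]
    by (auto intro!: Bochner_Integration.integrable_bound[OF integrable_cauchy_kernel] AE_I2 mult_left_le_one_le simp: abs_mult cauchy_kernel_nonneg)
  define R' where "R' = max R 1"
  have R': "R' > 0" "R \<le> R'" by (auto simp: R'_def)
  define v where "v = unit_ball_vol (real n) * R' ^ n"
  have v: "v > 0" using R' by (simp add: v_def)
  have upper: "exponent_index_fun \<Phi> r \<le> K * exponent_index_fun \<Phi>' r + v * r ^ n" if r: "r > 0" for r
  proof -
    have "exponent_index_fun \<Phi> r = (\<integral>\<xi>. g (\<xi> /\<^sub>R r) * cauchy_kernel \<xi> \<partial>lborel)"
      by (simp add: exponent_index_fun_def g_def)
    also have "\<dots> \<le> (\<integral>\<xi>. K * (g' (\<xi> /\<^sub>R r) * cauchy_kernel \<xi>) + indicator (ball 0 (R' * r)) \<xi> \<partial>lborel)"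
    proof (rule integral_mono)
      show "integrable lborel (\<lambda>\<xi>. K * (g' (\<xi> /\<^sub>R r) * cauchy_kernel \<xi>) + indicator (ball 0 (R' * r)) \<xi>)"
        using R' r by (intro Bochner_Integration.integrable_add integrable_mult_right int integrable_real_indicator) (auto simp: emeasure_ball)
      fix \<xi> :: 'b
      show "g (\<xi> /\<^sub>R r) * cauchy_kernel \<xi> \<le> K * (g' (\<xi> /\<^sub>R r) * cauchy_kernel \<xi>) + indicator (ball 0 (R' * r)) \<xi>"
      proof (cases "\<xi> \<in> ball 0 (R' * r)")
        case True
        have "g (\<xi> /\<^sub>R r) * cauchy_kernel \<xi> \<le> 1"
          using gb cauchy_kernel_le_1 by (intro mult_le_one cauchy_kernel_nonneg) auto
        moreover have "0 \<le> K * (g' (\<xi> /\<^sub>R r) * cauchy_kernel \<xi>)"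
          using K less_imp_le[OF gb'(1)] by (intro mult_nonneg_nonneg cauchy_kernel_nonneg)
        ultimately show ?thesis using True by simp
      next
        case False
        then have "R' \<le> norm (\<xi> /\<^sub>R r)" using r by (simp add: field_simps)
        then have "g (\<xi> /\<^sub>R r) \<le> K * g' (\<xi> /\<^sub>R r)" using le R' unfolding g_def g'_def by auto
        then have "g (\<xi> /\<^sub>R r) * cauchy_kernel \<xi> \<le> K * g' (\<xi> /\<^sub>R r) * cauchy_kernel \<xi>"
          by (intro mult_right_mono cauchy_kernel_nonneg)
        then show ?thesis using False by (simp add: mult.assoc)
      qed
    qed (rule int)
    also have "\<dots> = K * exponent_index_fun \<Phi>' r + measure lborel (ball (0 :: 'b) (R' * r))"
      using R' r int by (subst Bochner_Integration.integral_add)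
        (auto simp: exponent_index_fun_def g'_def emeasure_ball intro!: integrable_mult_right integrable_real_indicator)
    also have "measure lborel (ball (0 :: 'b) (R' * r)) = v * r ^ n"
      using R' r by (simp add: content_ball v_def n_def power_mult_distrib)
    finally show ?thesis .
  qed
  define c0 where "c0 = (1/2) ^ n * (\<integral>\<xi>. indicator (cball 0 1) \<xi> * g' \<xi> \<partial>lborel)"
  have ind: "integrable lborel (\<lambda>\<xi>. indicator (cball 0 1) \<xi> * g' \<xi>)"
  proof (rule Bochner_Integration.integrable_bound)
    show "integrable lborel (\<lambda>\<xi>. indicator (cball 0 1) \<xi> :: real)"
      by (intro integrable_real_indicator) (auto simp: emeasure_cball)
  qed (use gb'(2) less_imp_le[OF gb'(1)] in \<open>auto simp: indicator_def\<close>)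
  have c0: "c0 > 0"
  proof -
    have "0 \<le> (\<integral>\<xi>. indicator (cball 0 1) \<xi> * g' \<xi> \<partial>lborel)"
      using less_imp_le[OF gb'(1)] by (intro Bochner_Integration.integral_nonneg) auto
    moreover have "(\<integral>\<xi>. indicator (cball 0 1) \<xi> * g' \<xi> \<partial>lborel) \<noteq> 0"
    proof
      assume "(\<integral>\<xi>. indicator (cball 0 1) \<xi> * g' \<xi> \<partial>lborel) = 0"
      then have "AE \<xi> in lborel. indicator (cball 0 1) \<xi> * g' \<xi> = 0"
        using less_imp_le[OF gb'(1)] by (subst (asm) integral_nonneg_eq_0_iff_AE[OF ind]) auto
      then have "AE \<xi> in lborel. \<xi> \<notin> cball (0 :: 'b) 1"
        by eventually_elim (use gb'(1) in \<open>auto simp: indicator_def less_imp_neq[symmetric] split: if_splits\<close>)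
      then have "emeasure lborel (cball (0 :: 'b) 1) = 0"
        by (subst (asm) AE_iff_measurable[of "cball (0 :: 'b) 1"]) (auto simp: cball_def)
      then show False using unit_ball_vol_pos[of "real DIM('b)"] by (simp add: emeasure_cball)
    qed
    ultimately show ?thesis by (simp add: c0_def)
  qed
  have lower: "c0 * r ^ n \<le> exponent_index_fun \<Phi>' r" if r: "0 < r" "r \<le> 1" for r
  proof -
    define F where "F \<xi> = (1/2) ^ n * (indicator (cball 0 r) \<xi> * g' (\<xi> /\<^sub>R r))" for \<xi> :: 'b
    have "(\<lambda>\<xi>. g' (\<xi> /\<^sub>R r)) \<in> borel_measurable borel"
      by (rule measurable_compose[of _ _ borel g']) measurable
    then have [measurable]: "F \<in> borel_measurable borel"
      unfolding F_def by (intro borel_measurable_times borel_measurable_const borel_measurable_indicator) auto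
    have FF: "F (r *\<^sub>R \<xi>) = (1/2) ^ n * (indicator (cball 0 1) \<xi> * g' \<xi>)" for \<xi>
      using r by (auto simp: F_def indicator_def)
    have F_nonneg: "0 \<le> F \<xi>" for \<xi>
      using less_imp_le[OF gb'(1)] by (simp add: F_def)
    have F_le: "F \<xi> \<le> g' (\<xi> /\<^sub>R r) * cauchy_kernel \<xi>" for \<xi>
    proof (cases "\<xi> \<in> cball 0 r")
      case True
      have "(1/2) ^ n = (\<Prod>b\<in>(Basis :: 'b set). 1/2 :: real)" by (simp add: n_def)
      also have "\<dots> \<le> cauchy_kernel \<xi>"
        unfolding cauchy_kernel_def
      proof (intro prod_mono conjI)
        fix b :: 'b assume b: "b \<in> Basis"
        have "\<bar>\<xi> \<bullet> b\<bar> \<le> 1" using Basis_le_norm[OF b, of \<xi>] True r by simp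
        then have "(\<xi> \<bullet> b)\<^sup>2 \<le> 1" by (simp add: abs_square_le_1)
        then show "1 / 2 \<le> 1 / (1 + (\<xi> \<bullet> b)\<^sup>2)" by (intro divide_left_mono) (auto intro!: add_pos_nonneg)
      qed simp
      finally show ?thesis
        using True mult_left_mono[OF _ less_imp_le[OF gb'(1)], of "(1/2) ^ n" "cauchy_kernel \<xi>" "\<xi> /\<^sub>R r"]
        by (simp add: F_def mult.commute)
    qed (use less_imp_le[OF gb'(1)] in \<open>simp add: F_def cauchy_kernel_nonneg\<close>)
    have "c0 * r ^ n = r ^ n * (\<integral>\<xi>. F (r *\<^sub>R \<xi>) \<partial>lborel)"
      by (simp add: FF c0_def)
    also have "\<dots> = (\<integral>\<xi>. F \<xi> \<partial>lborel)"
      using lborel_integral_scaleR[of F r] r by (simp add: n_def)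
    also have "\<dots> \<le> (\<integral>\<xi>. g' (\<xi> /\<^sub>R r) * cauchy_kernel \<xi> \<partial>lborel)"
    proof (rule integral_mono[OF _ int(2) F_le])
      show "integrable lborel F"
        by (rule Bochner_Integration.integrable_bound[OF int(2)[of r]])
           (use F_le order_trans[OF _ F_le] F_nonneg in \<open>auto intro!: AE_I2 order_trans[OF _ abs_ge_self]\<close>)
    qed
    finally show ?thesis by (simp add: exponent_index_fun_def g'_def)
  qed
  show ?thesis
  proof
    show "K + v / c0 > 0" using K v c0 by (simp add: add_nonneg_pos)
    have "eventually (\<lambda>r::real. 0 < r \<and> r < 1) (at_right 0)"
      by (intro eventually_at_rightI[of 0 1]) auto
    then show "eventually (\<lambda>r. exponent_index_fun \<Phi> r \<le> (K + v / c0) * exponent_index_fun \<Phi>' r) (at_right 0)"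
    proof eventually_elim
      case (elim r)
      have "v * r ^ n = v / c0 * (c0 * r ^ n)" using c0 by simp
      also have "\<dots> \<le> v / c0 * exponent_index_fun \<Phi>' r"
        using lower[of r] elim v c0 by (intro mult_left_mono) auto
      finally show ?case using upper[of r] elim by (simp add: ring_distribs)
    qed
  qed
qed

lemma cauchy_kernel_vec: "cauchy_kernel (\<xi> :: real ^ 'n) = (\<Prod>j\<in>UNIV. 1 / (1 + (\<xi> $ j)\<^sup>2))"
proof -
  have B: "(Basis :: (real ^ 'n) set) = (\<lambda>i. axis i 1) ` UNIV" by (auto simp: Basis_vec_def)
  have inj: "inj (\<lambda>i::'n. axis i (1::real))" by (auto simp: inj_on_def axis_eq_axis)
  show ?thesis
    unfolding cauchy_kernel_def B by (subst prod.reindex[OF inj]) (simp add: inner_axis)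
qed

lemma cauchy_kernel_Pair: "cauchy_kernel (x, y) = cauchy_kernel x * cauchy_kernel y"
proof -
  have inj: "inj_on (\<lambda>u::'a. (u, 0::'b)) Basis" "inj_on (\<lambda>v::'b. (0::'a, v)) Basis"
    by (auto intro: inj_onI)
  have disj: "(\<lambda>u::'a. (u, 0::'b)) ` Basis \<inter> (\<lambda>v::'b. (0::'a, v)) ` Basis = {}"
    by (auto simp: nonzero_Basis)
  show ?thesis
    unfolding cauchy_kernel_def Basis_prod_def
    by (subst prod.union_disjoint) (use disj in \<open>auto simp: prod.reindex[OF inj(1)] prod.reindex[OF inj(2)]\<close>)
qed

lemma cauchy_kernel_real: "cauchy_kernel (x :: real) = 1 / (1 + x\<^sup>2)"
  by (simp add: cauchy_kernel_def)

section \<open>Time change by the inverse of an increasing path\<close>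

locale inverse_path =
  fixes D E :: "real \<Rightarrow> real"
  assumes start: "D 0 = 0"
    and strict: "strict_mono_on {0..} D"
    and right_cont: "\<And>t. t \<ge> 0 \<Longrightarrow> (D \<longlongrightarrow> D t) (at_right t)"
    and exceeds: "\<exists>x\<ge>0. D x > 1"
    and E: "\<And>t. t \<ge> 0 \<Longrightarrow> E t = Inf {x. x \<ge> 0 \<and> D x > t}"
begin

lemma D_less_iff: "0 \<le> x \<Longrightarrow> 0 \<le> y \<Longrightarrow> D x < D y \<longleftrightarrow> x < y"
  using strict_mono_on_less[OF strict] by simp

lemma D_nonneg: "0 \<le> x \<Longrightarrow> 0 \<le> D x"
  using D_less_iff[of x 0] start by (cases "x = 0") auto

lemma E_D: "0 \<le> x \<Longrightarrow> E (D x) = x"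
proof -
  assume x: "0 \<le> x"
  then have "{y. y \<ge> 0 \<and> D y > D x} = {x<..}" using D_less_iff by auto
  then show ?thesis using E[OF D_nonneg[OF x]] by simp
qed

lemma above_nonempty: "t \<le> 1 \<Longrightarrow> {x. x \<ge> 0 \<and> D x > t} \<noteq> {}"
  using exceeds by force

lemma above_bdd: "bdd_below {x. x \<ge> 0 \<and> D x > t}"
  by (rule bdd_belowI[of _ 0]) auto

lemma E_bounds:
  assumes "0 \<le> t" "t \<le> 1"
  shows "0 \<le> E t" "E t \<le> E 1"
proof -
  show "0 \<le> E t" unfolding E[OF assms(1)] using above_nonempty[OF assms(2)] by (intro cInf_greatest) auto
  show "E t \<le> E 1"
    unfolding E[OF assms(1)] E[OF zero_le_one] using assms above_nonempty[of 1]
    by (intro cInf_superset_mono above_bdd) auto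
qed

lemma E_1_pos: "0 < E 1"
proof -
  have "(D \<longlongrightarrow> 0) (at_right 0)" using right_cont[of 0] start by simp
  then have "eventually (\<lambda>y. D y < 1) (at_right 0)" by (rule order_tendstoD) simp
  then obtain b where b: "b > 0" "\<And>y. 0 < y \<Longrightarrow> y < b \<Longrightarrow> D y < 1"
    unfolding eventually_at_right_field by blast
  have "b \<le> E 1"
    unfolding E[OF zero_le_one]
  proof (rule cInf_greatest[OF above_nonempty])
    fix y assume y: "y \<in> {x. x \<ge> 0 \<and> D x > 1}"
    then have "y \<noteq> 0" using start by auto
    then show "b \<le> y" using b(2)[of y] y by force
  qed simp
  then show ?thesis using b(1) by simp
qed

lemma D_le_1: "0 \<le> x \<Longrightarrow> x < E 1 \<Longrightarrow> D x \<le> 1"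
proof (rule ccontr)
  assume x: "0 \<le> x" "x < E 1" "\<not> D x \<le> 1"
  then have "E 1 \<le> x" unfolding E[OF zero_le_one] by (intro cInf_lower above_bdd) auto
  then show False using x by simp
qed

lemma E_image: "E ` {0..1} = {0..E 1}"
proof (intro equalityI subsetI)
  fix x assume x: "x \<in> {0..E 1}"
  show "x \<in> E ` {0..1}"
  proof (cases "x = E 1")
    case False
    then show ?thesis using x D_le_1[of x] D_nonneg[of x] E_D[of x] by (intro image_eqI[of _ _ "D x"]) auto
  qed auto
qed (use E_bounds in auto)

lemma D_E_ge:
  assumes t: "0 \<le> t" "t \<le> 1"
  shows "t \<le> D (E t)"
proof (rule tendsto_lowerbound[OF right_cont[OF E_bounds(1)[OF t]]])
  have "t \<le> D y" if y: "E t < y" for y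
  proof -
    obtain z where z: "z \<ge> 0" "D z > t" "z < y"
      using y unfolding E[OF t(1)] by (subst (asm) cInf_less_iff[OF above_nonempty[OF t(2)] above_bdd]) auto
    then show ?thesis using D_less_iff[of z y] by simp
  qed
  then show "eventually (\<lambda>y. t \<le> D y) (at_right (E t))"
    using eventually_at_right_less[of "E t"] by (auto elim: eventually_mono)
qed simp

definition jumps :: "real set" where
  "jumps = {x. 0 \<le> x \<and> (\<exists>t. t < D x \<and> (\<forall>y. 0 \<le> y \<longrightarrow> y < x \<longrightarrow> D y \<le> t))}"

lemma countable_jumps: "countable jumps"
proof -
  have "\<exists>q::rat. (\<forall>y. 0 \<le> y \<longrightarrow> y < x \<longrightarrow> D y < of_rat q) \<and> of_rat q < D x" if x: "x \<in> jumps" for x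
  proof -
    obtain t where t: "t < D x" "\<And>y. 0 \<le> y \<Longrightarrow> y < x \<Longrightarrow> D y \<le> t" using x by (auto simp: jumps_def)
    obtain q where "t < of_rat q" "of_rat q < D x" using of_rat_dense[OF t(1)] by blast
    then show ?thesis using t(2) by (meson order.strict_trans1)
  qed
  then obtain q :: "real \<Rightarrow> rat" where q: "\<And>x y. x \<in> jumps \<Longrightarrow> 0 \<le> y \<Longrightarrow> y < x \<Longrightarrow> D y < of_rat (q x)" "\<And>x. x \<in> jumps \<Longrightarrow> of_rat (q x) < D x"
    by metis
  have less: "q x < q y" if "x \<in> jumps" "y \<in> jumps" "x < y" for x y
  proof -
    have "0 \<le> x" using that(1) by (simp add: jumps_def)
    then have "of_rat (q x) < (of_rat (q y) :: real)" using q(1)[OF that(2) _ that(3)] q(2)[OF that(1)] by linarith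
    then show ?thesis by (simp add: of_rat_less)
  qed
  have "inj_on q jumps"
  proof (rule inj_onI)
    fix x y assume "x \<in> jumps" "y \<in> jumps" "q x = q y"
    then show "x = y" using less[of x y] less[of y x] by (cases x y rule: linorder_cases) auto
  qed
  then show ?thesis by (rule countable_image_inj_on[OF countableI_type])
qed

lemma E_jump:
  assumes t: "0 \<le> t" "t \<le> 1" and ne: "D (E t) \<noteq> t"
  shows "E t \<in> jumps"
  unfolding jumps_def
proof (intro CollectI conjI exI[of _ t] allI impI)
  show "0 \<le> E t" using E_bounds(1)[OF t] .
  show "t < D (E t)" using D_E_ge[OF t] ne by simp
  fix y assume y: "0 \<le> y" "y < E t"
  show "D y \<le> t"
  proof (rule ccontr)
    assume "\<not> D y \<le> t"
    then have "E t \<le> y" unfolding E[OF t(1)] using y by (intro cInf_lower above_bdd) auto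
    then show False using y by simp
  qed
qed

lemma packing_dim_time_changed_range:
  fixes Y :: "real \<Rightarrow> 'b::metric_space"
  assumes up: "\<And>s a. I < ennreal s \<Longrightarrow> packing_premeasure s (Y ` {0..<real (a::nat)}) = 0"
    and low: "\<And>s a. 0 < a \<Longrightarrow> 0 \<le> s \<Longrightarrow> ennreal s < I \<Longrightarrow> packing_measure s (Y ` {0..<a}) \<noteq> 0"
  shows "packing_dim ((\<lambda>t. Y (E t)) ` {0..1}) = I"
proof -
  have range: "(\<lambda>t. Y (E t)) ` {0..1} = Y ` {0..E 1}"
    by (simp add: E_image[symmetric] image_image)
  show ?thesis
    unfolding range
  proof (rule packing_dim_eqI)
    fix s assume s: "I < ennreal s"
    obtain N :: nat where N: "E 1 < real N" using reals_Archimedean2 by blast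
    show "packing_measure s (Y ` {0..E 1}) = 0"
      by (rule packing_measure_zeroI[of s "\<lambda>_. Y ` {0..<real N}"]) (use N up[OF s] in auto)
  next
    fix s assume s: "0 \<le> s" "ennreal s < I"
    have "packing_measure s (Y ` {0..<E 1}) \<le> packing_measure s (Y ` {0..E 1})"
      by (intro packing_measure_mono image_mono) auto
    then show "packing_measure s (Y ` {0..E 1}) \<noteq> 0" using low[OF E_1_pos s] by auto
  qed
qed

text \<open>The graph consists of points of the path of \<open>(D, Y)\<close> and, over each of the countably many
  jump times of \<open>D\<close>, of part of a horizontal segment.\<close>

lemma packing_dim_time_changed_graph:
  fixes Y :: "real \<Rightarrow> 'b::metric_space"
  assumes up: "\<And>s a. I < ennreal s \<Longrightarrow> packing_premeasure s ((\<lambda>x. (D x, Y x)) ` {0..<real (a::nat)}) = 0"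
    and low: "\<And>s a. 0 < a \<Longrightarrow> 0 \<le> s \<Longrightarrow> ennreal s < I \<Longrightarrow> packing_measure s ((\<lambda>x. (D x, Y x)) ` {0..<a}) \<noteq> 0"
  shows "packing_dim ((\<lambda>t. (t, Y (E t))) ` {0..1}) = max 1 I"
proof (rule packing_dim_eqI)
  fix s assume "max 1 I < ennreal s"
  then have s: "I < ennreal s" "1 < s" by (auto simp: ennreal_less_iff ennreal_1[symmetric] simp del: ennreal_1)
  obtain N :: nat where N: "E 1 < real N" using reals_Archimedean2 by blast
  define C where "C i = (case i of 0 \<Rightarrow> (\<lambda>x. (D x, Y x)) ` {0..<real N} | Suc j \<Rightarrow> (\<lambda>t. (t, Y (from_nat_into jumps j))) ` {0..1})" for i
  show "packing_measure s ((\<lambda>t. (t, Y (E t))) ` {0..1}) = 0"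
  proof (rule packing_measure_zeroI[of s C])
    fix i
    show "packing_premeasure s (C i) = 0"
    proof (cases i)
      case 0
      then show ?thesis using up[OF s(1)] by (simp add: C_def)
    next
      case (Suc j)
      have "packing_premeasure s ((\<lambda>t. (t, Y (from_nat_into jumps j))) ` {0..1::real}) \<le> packing_premeasure s {0..1::real}"
        by (rule packing_premeasure_image_le) (simp add: dist_Pair_Pair)
      then show ?thesis using Suc packing_premeasure_unit_interval[OF s(2)] by (simp add: C_def)
    qed
  next
    show "(\<lambda>t. (t, Y (E t))) ` {0..1} \<subseteq> (\<Union>i. C i)"
    proof clarify
      fix t :: real assume t: "t \<in> {0..1}"
      show "(t, Y (E t)) \<in> (\<Union>i. C i)"
      proof (cases "D (E t) = t")
        case True
        have "(D (E t), Y (E t)) \<in> C 0" using t E_bounds[of t] N by (auto simp: C_def)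
        then show ?thesis using True by auto
      next
        case False
        then have "E t \<in> jumps" using t by (intro E_jump) auto
        then have "from_nat_into jumps (to_nat_on jumps (E t)) = E t" using countable_jumps by simp
        then have "(t, Y (E t)) \<in> C (Suc (to_nat_on jumps (E t)))" using t by (auto simp: C_def)
        then show ?thesis by blast
      qed
    qed
  qed
next
  fix s assume s: "0 \<le> s" "ennreal s < max 1 I"
  let ?G = "(\<lambda>t. (t, Y (E t))) ` {0..1}"
  show "packing_measure s ?G \<noteq> 0"
  proof (cases "ennreal s < I")
    case True
    have "(\<lambda>x. (D x, Y x)) ` {0..<E 1} \<subseteq> ?G"
    proof clarify
      fix x assume x: "x \<in> {0..<E 1}"
      then show "(D x, Y x) \<in> ?G"
        using E_D[of x] D_le_1[of x] D_nonneg[of x] by (intro image_eqI[of _ _ "D x"]) auto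
    qed
    then have "packing_measure s ((\<lambda>x. (D x, Y x)) ` {0..<E 1}) \<le> packing_measure s ?G"
      by (rule packing_measure_mono)
    then show ?thesis using low[OF E_1_pos s(1) True] by auto
  next
    case False
    then have "ennreal s < 1" using s(2) by (auto simp: less_max_iff_disj)
    then have "s < 1" using s(1) by (simp add: ennreal_less_iff ennreal_1[symmetric] del: ennreal_1)
    have "packing_measure s (fst ` ?G) \<le> packing_measure s ?G"
      by (rule packing_measure_image_le) (rule dist_fst_le)
    moreover have "fst ` ?G = {0..1}" by force
    ultimately show ?thesis using packing_measure_unit_interval[OF \<open>s < 1\<close>] by auto
  qed
qed

end

lemma liminf_index_cong:
  assumes "\<And>r. r > 0 \<Longrightarrow> V r = V' r"
  shows "liminf_index V = liminf_index V'"
proof -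
  have "Liminf (at_right 0) (\<lambda>r. ereal (V r / r powr \<gamma>)) = Liminf (at_right 0) (\<lambda>r. ereal (V' r / r powr \<gamma>))" for \<gamma>
    using eventually_at_right_less[of "0::real"] by (intro Liminf_eq) (auto elim!: eventually_mono simp: assms)
  then show ?thesis by (simp add: liminf_index_def)
qed

theorem proposition3p3:
  fixes M :: "'w measure"
    and Y :: "real \<Rightarrow> 'w \<Rightarrow> real ^ 'd"
    and D :: "real \<Rightarrow> 'w \<Rightarrow> real"
    and E :: "real \<Rightarrow> 'w \<Rightarrow> real"
    and X :: "real \<Rightarrow> 'w \<Rightarrow> real ^ 'd"
    and \<psi> :: "real ^ 'd \<Rightarrow> complex"
    and \<sigma> :: "real \<Rightarrow> complex"
    and \<Phi> :: "real \<times> (real ^ 'd) \<Rightarrow> complex"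
    and \<nu>\<^sub>D :: "real measure"
    and K :: real
    and W W' :: "real \<Rightarrow> real"
  assumes "prob_space M"
    and "prob_space.levy_process M Y"
    and "prob_space.characteristic_exponent M Y \<psi>"
    and "prob_space.subordinator M D"
    and "prob_space.characteristic_exponent M D \<sigma>"
    and "subordinator_drift_levy_measure \<sigma> 0 \<nu>\<^sub>D"
    and "emeasure \<nu>\<^sub>D {0<..} = \<infinity>"
    and "\<And>t \<omega>. t \<ge> 0 \<Longrightarrow> E t \<omega> = Inf {x. x \<ge> 0 \<and> D x \<omega> > t}"
    and "\<And>t \<omega>. t \<ge> 0 \<Longrightarrow> X t \<omega> = Y (E t \<omega>) \<omega>"
    and "prob_space.levy_process M (\<lambda>x \<omega>. (D x \<omega>, Y x \<omega>))"
    and "prob_space.characteristic_exponent M (\<lambda>x \<omega>. (D x \<omega>, Y x \<omega>)) \<Phi>"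
    and "K \<ge> 1"
    and "\<exists>R. \<forall>\<eta> \<xi>. \<bar>\<eta>\<bar> + norm \<xi> \<ge> R \<longrightarrow>
           inverse K * Re (1 / (1 + \<sigma> \<eta> + \<psi> \<xi>)) \<le> Re (1 / (1 + \<Phi> (\<eta>, \<xi>))) \<and>
           Re (1 / (1 + \<Phi> (\<eta>, \<xi>))) \<le> K * Re (1 / (1 + \<sigma> \<eta> + \<psi> \<xi>))"
    and "\<And>r. r > 0 \<Longrightarrow> W r =
           (\<integral>\<xi>. Re (1 / (1 + \<psi> (\<xi> /\<^sub>R r))) * (\<Prod>j\<in>UNIV. 1 / (1 + (\<xi> $ j)\<^sup>2)) \<partial>lborel)"
    and "\<And>r. r > 0 \<Longrightarrow> W' r =
           (\<integral>(\<eta>, \<xi>). Re (1 / (1 + \<sigma> (\<eta> / r) + \<psi> (\<xi> /\<^sub>R r))) *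
              (1 / (1 + \<eta>\<^sup>2)) * (\<Prod>j\<in>UNIV. 1 / (1 + (\<xi> $ j)\<^sup>2)) \<partial>lborel)"
  shows "(AE \<omega> in M. packing_dim ((\<lambda>t. X t \<omega>) ` {0..1}) = liminf_index W) \<and>
         (AE \<omega> in M. packing_dim ((\<lambda>t. (t, X t \<omega>)) ` {0..1}) = max 1 (liminf_index W'))"
proof -
  interpret prob_space M by fact
  note Y = assms(2,3) and D = assms(4-7) and Z = assms(10,11)
  have Dl: "levy_process D" by (rule subordinator_levy[OF D(1)])

  obtain Y' where "regular_levy M Y' \<psi>" using levy_process_regular_version[OF Y] by blast
  then interpret Y': regular_levy M Y' \<psi> .
  obtain D' where "regular_levy M D' \<sigma>" using levy_process_regular_version[OF Dl D(2)] by blast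
  then interpret D': regular_levy M D' \<sigma> .
  obtain Z' where "regular_levy M Z' \<Phi>" using levy_process_regular_version[OF Z] by blast
  then interpret Z': regular_levy M Z' \<Phi> .

  have W: "liminf_index W = liminf_index (exponent_index_fun \<psi>)"
    by (rule liminf_index_cong) (simp add: assms(14) exponent_index_fun_def cauchy_kernel_vec)

  define \<Psi> where "\<Psi> p = \<sigma> (fst p) + \<psi> (snd p)" for p :: "real \<times> (real ^ 'd)"
  have \<Psi>m: "\<Psi> \<in> borel_measurable borel"
  proof -
    note [measurable] = D'.borel_measurable_exponent Y'.borel_measurable_exponent
    have "\<Psi> \<in> borel_measurable (borel \<Otimes>\<^sub>M borel)" unfolding \<Psi>_def by measurable
    then show ?thesis by (simp add: borel_prod)
  qed
  have \<Psi>0: "0 \<le> Re (\<Psi> p)" for p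
    using D'.Re_exponent_nonneg[of "fst p"] Y'.Re_exponent_nonneg[of "snd p"] by (simp add: \<Psi>_def)
  have kernel: "cauchy_kernel p = 1 / (1 + (fst p)\<^sup>2) * (\<Prod>j\<in>UNIV. 1 / (1 + (snd p $ j)\<^sup>2))" for p :: "real \<times> (real ^ 'd)"
    using cauchy_kernel_Pair[of "fst p" "snd p"] by (simp add: cauchy_kernel_real cauchy_kernel_vec)
  have W'_eq: "W' r = exponent_index_fun \<Psi> r" if "r > 0" for r
    unfolding assms(15)[OF that] exponent_index_fun_def
    by (intro Bochner_Integration.integral_cong refl)
       (simp add: case_prod_beta' \<Psi>_def kernel divide_inverse mult_ac add_ac)
  obtain R where R: "\<And>\<eta> \<xi>. R \<le> \<bar>\<eta>\<bar> + norm \<xi> \<Longrightarrow>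
      inverse K * Re (1 / (1 + \<sigma> \<eta> + \<psi> \<xi>)) \<le> Re (1 / (1 + \<Phi> (\<eta>, \<xi>))) \<and>
      Re (1 / (1 + \<Phi> (\<eta>, \<xi>))) \<le> K * Re (1 / (1 + \<sigma> \<eta> + \<psi> \<xi>))"
    using assms(13) by blast
  have RZ: "Re (1 / (1 + \<Phi> p)) \<le> K * Re (1 / (1 + \<Psi> p)) \<and> Re (1 / (1 + \<Psi> p)) \<le> K * Re (1 / (1 + \<Phi> p))"
    if p: "R \<le> norm p" for p
  proof -
    have "norm p \<le> \<bar>fst p\<bar> + norm (snd p)" using norm_Pair_le[of "fst p" "snd p"] by simp
    then have *: "inverse K * Re (1 / (1 + \<Psi> p)) \<le> Re (1 / (1 + \<Phi> p))" "Re (1 / (1 + \<Phi> p)) \<le> K * Re (1 / (1 + \<Psi> p))"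
      using R[of "fst p" "snd p"] p by (auto simp: \<Psi>_def add.assoc)
    have "K * (inverse K * Re (1 / (1 + \<Psi> p))) \<le> K * Re (1 / (1 + \<Phi> p))"
      using *(1) assms(12) by (intro mult_left_mono) auto
    moreover have "K * inverse K = 1" using assms(12) by simp
    ultimately show ?thesis using *(2) by (simp add: mult.assoc[symmetric])
  qed
  have W': "liminf_index W' = liminf_index (exponent_index_fun \<Phi>)"
  proof -
    obtain c1 where c1: "c1 > 0" "eventually (\<lambda>r. exponent_index_fun \<Phi> r \<le> c1 * exponent_index_fun \<Psi> r) (at_right 0)"
      by (rule exponent_index_fun_le_of_le[OF Z'.borel_measurable_exponent \<Psi>m Z'.Re_exponent_nonneg \<Psi>0, of K R]) (use RZ assms(12) in auto)
    obtain c2 where c2: "c2 > 0" "eventually (\<lambda>r. exponent_index_fun \<Psi> r \<le> c2 * exponent_index_fun \<Phi> r) (at_right 0)"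
      by (rule exponent_index_fun_le_of_le[OF \<Psi>m Z'.borel_measurable_exponent \<Psi>0 Z'.Re_exponent_nonneg, of K R]) (use RZ assms(12) in auto)
    have nn: "0 \<le> exponent_index_fun \<Psi> r" for r
      unfolding exponent_index_fun_def
      by (intro Bochner_Integration.integral_nonneg mult_nonneg_nonneg cauchy_kernel_nonneg less_imp_le Re_inverse_bounds \<Psi>0)
    have "liminf_index W' = liminf_index (exponent_index_fun \<Psi>)"
      by (rule liminf_index_cong) (rule W'_eq)
    also have "\<dots> = liminf_index (exponent_index_fun \<Phi>)"
      using liminf_index_le_of_le[OF c1] liminf_index_le_of_le[OF c2]
      by (intro antisym) (auto simp: nn Z'.exponent_index_fun_nonneg)
    finally show ?thesis .
  qed

  have path: "AE \<omega> in M. inverse_path (\<lambda>t. D t \<omega>) (\<lambda>t. E t \<omega>)"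
  proof -
    have "AE \<omega> in M. cadlag (\<lambda>t. D t \<omega>)" using Dl by (simp add: levy_process_def)
    then show ?thesis
      using levy_process_start[OF Dl] subordinator_strict_mono[OF D] subordinator_unbounded[OF D]
      by eventually_elim (unfold_locales, auto simp: cadlag_def assms(8))
  qed

  have "AE \<omega> in M. packing_dim ((\<lambda>t. X t \<omega>) ` {0..1}) = liminf_index W"
    using path levy_process_packing[OF Y]
  proof eventually_elim
    case (elim \<omega>)
    interpret inverse_path "\<lambda>t. D t \<omega>" "\<lambda>t. E t \<omega>" by (rule elim(1))
    have "(\<lambda>t. X t \<omega>) ` {0..1} = (\<lambda>t. Y (E t \<omega>) \<omega>) ` {0..1}"
      by (intro image_cong) (auto simp: assms(9))
    then show ?case
      using elim(2) unfolding W by (simp only:) (rule packing_dim_time_changed_range, blast+)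
  qed
  moreover have "AE \<omega> in M. packing_dim ((\<lambda>t. (t, X t \<omega>)) ` {0..1}) = max 1 (liminf_index W')"
    using path levy_process_packing[OF Z]
  proof eventually_elim
    case (elim \<omega>)
    interpret inverse_path "\<lambda>t. D t \<omega>" "\<lambda>t. E t \<omega>" by (rule elim(1))
    have "(\<lambda>t. (t, X t \<omega>)) ` {0..1} = (\<lambda>t. (t, Y (E t \<omega>) \<omega>)) ` {0..1}"
      by (intro image_cong) (auto simp: assms(9))
    then show ?case
      using elim(2) unfolding W' by (simp only:) (rule packing_dim_time_changed_graph, blast+)
  qed
  ultimately show ?thesis ..
qed

end
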